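(* Let $K_{15}$ be the middle-$15$th Cantor set and $\mu_{15}$ its Cantor–Lebesgue measure. Then: (1) $\dim_{\mathrm{H}}(K_{15}\cap W_{>1})=\dim_{\mathrm{H}} K_{15}$. (2) For every non-increasing function $\psi:\mathbb{N}\to(0,1]$ with $\sum_{q}\psi(q)<\infty$ we have $\mu_{15}(W(\psi))=0$. Moreover, $\mu_{15}(W(\psi))=1$ for $\psi(q)=1/(q\log\log q)$. (3) Let $K=K_{10^7+1}$ be the middle-$(10^7+1)$th Cantor set. There is a number $c>0$ such that for all $\nu\in(1,1+c)$, \[ \dim_{\mathrm{H}}(K\cap W_\nu)=\max\left\{\frac{\dim_{\mathrm{H}} K}{\nu+1},\ \frac{2}{\nu+1}+\dim_{\mathrm{H}} K-1\right\}. \]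
   Context: For $x\in\mathbb{R}^n$, $\|x\|$ denotes the distance from $x$ to the lattice $\mathbb{Z}^n$. For $\psi:\mathbb{N}\to(0,1]$ and $\gamma\in[0,1]^n$, $W(\psi,\gamma)=\{x\in\mathbb{R}^n:\|qx-\gamma\|\le\psi(q)\text{ for infinitely many }q\in\mathbb{N}\}$, and $W(\psi)=W(\psi,0)$. For $n=1$ and $\nu>1$, $W_\nu=W(\psi)$ with $\psi(q)=q^{-\nu}$, and $W_{>1}=\bigcup_{\nu>1}W_\nu$. (For $\psi(q)=1/(q\log\log q)$, only large $q$ matter for membership in $W(\psi)$.) For an integer $p>2$ and $D\subset\{0,\dots,p-1\}$ with at least two elements, $\mu_{p,D}$ is the law of $\sum_{j\ge1}a_jp^{-j}$ where the $a_j$ are i.i.d. uniform on $D$, and $K_{p,D}=\mathrm{supp}(\mu_{p,D})$. For odd $p>2$, the middle-$p$th Cantor set is $K_p=K_{p,D}$ with $D=\{0,\dots,p-1\}\setminus\{(p-1)/2\}$, and $\mu_p=\mu_{p,D}$ is the middle-$p$th Cantor measure. *)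

theory Defs
  imports "HOL-Probability.Probability"
begin

subsection \<open>Hausdorff measure and Hausdorff dimension\<close>

text \<open>
  The gauge \<open>diam(U)^s\<close>, with the usual conventions \<open>diam({})^s = 0\<close> and
  \<open>diam(U)^0 = 1\<close> for nonempty \<open>U\<close>. They need spelling out because
  \<open>0 powr 0 = 0\<close> in the library.
\<close>

definition diam_powr :: "real \<Rightarrow> 'a::metric_space set \<Rightarrow> ennreal" where
  "diam_powr s U = (if U = {} then 0 else if s = 0 then 1 else ennreal (diameter U powr s))"

text \<open>
  Boundedness of the covering sets is required explicitly, since \<^const>\<open>diameter\<close> is
  unspecified on unbounded sets. Finite covers are included by padding with empty sets.
\<close>

definition hausdorff_premeasure :: "real \<Rightarrow> real \<Rightarrow> 'a::metric_space set \<Rightarrow> ennreal" where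
  "hausdorff_premeasure s \<delta> A =
     (INF U \<in> {U :: nat \<Rightarrow> 'a set.
                 A \<subseteq> (\<Union>i. U i) \<and> (\<forall>i. bounded (U i) \<and> diameter (U i) \<le> \<delta>)}.
        \<Sum>i. diam_powr s (U i))"

definition hausdorff_measure :: "real \<Rightarrow> 'a::metric_space set \<Rightarrow> ennreal" where
  "hausdorff_measure s A = (SUP \<delta> \<in> {0<..}. hausdorff_premeasure s \<delta> A)"

definition hausdorff_dim :: "'a::metric_space set \<Rightarrow> ereal" where
  "hausdorff_dim A = Inf {ereal s | s. 0 \<le> s \<and> hausdorff_measure s A = 0}"

subsection \<open>Well approximable numbers\<close>

text \<open>
  On the real line the distance to the lattice of integers is \<^term>\<open>\<lambda>x::real. infdist x \<int>\<close>.
  Denominators \<open>q\<close> are positive. Changing finitely many values of \<open>\<psi>\<close> does not change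
  the set, so \<open>\<psi>\<close> is allowed to be an arbitrary real sequence here.
\<close>

definition W_inhom :: "(nat \<Rightarrow> real) \<Rightarrow> real \<Rightarrow> real set" where
  "W_inhom \<psi> \<gamma> = {x. infinite {q::nat. 0 < q \<and> infdist (real q * x - \<gamma>) \<int> \<le> \<psi> q}}"

definition W :: "(nat \<Rightarrow> real) \<Rightarrow> real set" where
  "W \<psi> = W_inhom \<psi> 0"

definition W_exp :: "real \<Rightarrow> real set" where
  "W_exp \<nu> = W (\<lambda>q. real q powr (- \<nu>))"

definition W_gt1 :: "real set" where
  "W_gt1 = (\<Union>\<nu>\<in>{1<..}. W_exp \<nu>)"

text \<open>Only Borel sets occur, so their \<^const>\<open>emeasure\<close> is not the default value 0.\<close>

lemma W_inhom_borel [measurable]: "W_inhom \<psi> \<gamma> \<in> sets borel"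
proof -
  have m: "{x. 0 < q \<and> infdist (real q * x - \<gamma>) \<int> \<le> \<psi> q} \<in> sets borel" for q :: nat
  proof (cases "0 < q")
    case True
    have "closed {x::real. infdist (real q * x - \<gamma>) \<int> \<le> \<psi> q}"
      by (intro closed_Collect_le continuous_intros)
    then show ?thesis using True by simp
  qed simp
  have "W_inhom \<psi> \<gamma> =
      (\<Inter>n. \<Union>q\<in>{n..}. {x. 0 < q \<and> infdist (real q * x - \<gamma>) \<int> \<le> \<psi> q})"
    by (auto simp: W_inhom_def infinite_nat_iff_unbounded_le)
  also have "\<dots> \<in> sets borel"
    by (intro sets.countable_INT' sets.countable_UN') (auto intro: m)
  finally show ?thesis .
qed

lemma W_borel [measurable]: "W \<psi> \<in> sets borel"
  by (simp add: W_def)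

subsection \<open>Missing digit measures and middle Cantor sets\<close>

definition measure_support :: "'a::topological_space measure \<Rightarrow> 'a set" where
  "measure_support M = {x. \<forall>U. open U \<and> x \<in> U \<longrightarrow> 0 < emeasure M U}"

definition digit_sequences :: "nat set \<Rightarrow> (nat \<Rightarrow> nat) measure" where
  "digit_sequences D = (\<Pi>\<^sub>M j\<in>UNIV. measure_pmf (pmf_of_set D))"

definition digit_expansion :: "nat \<Rightarrow> (nat \<Rightarrow> nat) \<Rightarrow> real" where
  "digit_expansion p a = (\<Sum>j. real (a j) / real p ^ Suc j)"

definition missing_digit_measure :: "nat \<Rightarrow> nat set \<Rightarrow> real measure" where
  "missing_digit_measure p D = distr (digit_sequences D) borel (digit_expansion p)"

definition missing_digit_set :: "nat \<Rightarrow> nat set \<Rightarrow> real set" where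
  "missing_digit_set p D = measure_support (missing_digit_measure p D)"

definition middle_digits :: "nat \<Rightarrow> nat set" where
  "middle_digits p = {0..p - 1} - {(p - 1) div 2}"

definition middle_cantor_measure :: "nat \<Rightarrow> real measure" where
  "middle_cantor_measure p = missing_digit_measure p (middle_digits p)"

definition middle_cantor_set :: "nat \<Rightarrow> real set" where
  "middle_cantor_set p = missing_digit_set p (middle_digits p)"

lemma digit_expansion_measurable [measurable]:
  "digit_expansion p \<in> borel_measurable (digit_sequences D)"
  unfolding digit_expansion_def[abs_def] digit_sequences_def by measurable

lemma prob_space_missing_digit_measure: "prob_space (missing_digit_measure p D)"
proof -
  interpret product_prob_space "\<lambda>_. measure_pmf (pmf_of_set D)" UNIV
    by unfold_locales
  have "prob_space (digit_sequences D)"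
    unfolding digit_sequences_def by (rule prob_space_axioms)
  then show ?thesis
    unfolding missing_digit_measure_def
    by (intro prob_space.prob_space_distr) simp_all
qed

lemma sets_missing_digit_measure [measurable_cong, simp]:
  "sets (missing_digit_measure p D) = sets borel"
  by (simp add: missing_digit_measure_def)

end

theory Submission
  imports Defs "HOL-Real_Asymp.Real_Asymp"
begin

text \<open>
  The measure of the points within \<open>\<epsilon>\<close> of an integer after multiplication by some \<open>q \<in> {Q..<2 * Q}\<close>
  is computed by trigonometric polynomials of degree \<open>1 / \<epsilon>\<close>. The error is a sum of Fourier
  coefficients at the products \<open>h * q\<close>, hence, by the divisor bound, at most \<open>X powr o(1)\<close> times the
  \<open>l\<^sup>1\<close>-sum of the coefficients up to \<open>X = Q / \<epsilon>\<close>. By self-similarity that sum grows like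
  \<open>X powr \<tau>\<close>, where \<open>p powr \<tau>\<close> bounds the \<open>l\<^sup>1\<close>-norm of one level of digits. As soon as
  \<open>\<tau> < 1 / 2\<close>, the error is smaller than the main term \<open>Q * \<epsilon>\<close> even for \<open>\<epsilon>\<close> slightly below
  \<open>1 / Q\<close>, and the same holds inside cylinders of length \<open>Q powr (- \<rho>)\<close>.

  The convergence statement is then the Borel--Cantelli lemma; for divergence one uses scales so sparse
  that the events are nearly independent. For the dimension, the count of fractions near the Cantor set
  gives the upper bound. For the lower bound, nested cylinders near fractions with rapidly increasing
  denominators are chosen. Counting shows that these are well distributed down to scale
  \<open>Q powr (- \<rho>)\<close>; below it, the separation of fractions is enough, because it loses only
  \<open>Q powr ((1 - dimK) * (\<nu> - 1))\<close>.
\<close>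

subsection \<open>Self-similarity of missing digit measures\<close>

text \<open>Parseval and Cauchy--Schwarz bound one level of digits by \<open>p / sqrt P\<close>,
  never less than \<open>sqrt p\<close>, so alone they cannot give \<tau> < 1/2. But one of the
  \<open>p\<close> values of \<open>phi\<close> is always of order 1, far above the quadratic mean.
  Treating it separately brings the sum below \<open>sqrt p\<close>: for \<open>p = 15\<close> it is
  at most 3.83, and 3.83^2 < 15. The dimension formula asks for more. Its lower bound needs (\<nu> +
  1) * (1 - dimK + \<tau>) \<le> 1, which near \<nu> = 1 means \<tau> < dimK - 1/2;
  \<open>p = 10^7 + 1\<close> meets this with 2740.

  Lower bounds face a second obstacle. Summing measures over a block of denominators counts a point
  near a fraction with small reduced denominator \<open>d\<close> about \<open>Q / d\<close> times,
  so a large sum need not mean a large union. Such points form a small set: the upper bound, applied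
  to the blocks of smaller denominators, shows that they account for a small part of the sum only.
  This uses first moments alone and works alike inside every cylinder, which is what makes distant
  scales nearly independent.\<close>

lemma digit_expansion_case_nat:
  assumes p: "p \<ge> 2" and w: "\<And>j. \<omega> j < p"
  shows "digit_expansion p (case_nat s \<omega>) = (real s + digit_expansion p \<omega>) / real p"
    and "0 \<le> digit_expansion p \<omega>" and "digit_expansion p \<omega> \<le> 1"
proof -
  let ?g = "\<lambda>j. real (\<omega> j) / real p ^ Suc j"
  have geo: "(\<lambda>j. (real p - 1) / real p * (1 / real p) ^ j) sums ((real p - 1) / real p * (1 / (1 - 1 / real p)))"
    by (intro sums_mult geometric_sums) (use p in auto)
  have one: "(real p - 1) / real p * (1 / (1 - 1 / real p)) = 1"
    using p by (simp add: field_simps)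
  have le: "?g j \<le> (real p - 1) / real p * (1 / real p) ^ j" for j
  proof -
    have "real (\<omega> j) \<le> real p - 1" using w[of j] by linarith
    then have "real (\<omega> j) / (real p * real p ^ j) \<le> (real p - 1) / (real p * real p ^ j)"
      using p by (intro divide_right_mono) auto
    then show ?thesis by (simp add: power_one_over)
  qed
  have sg: "summable ?g"
  proof (rule summable_comparison_test[OF _ sums_summable[OF geo]])
    show "\<exists>N. \<forall>n\<ge>N. norm (?g n) \<le> (real p - 1) / real p * (1 / real p) ^ n"
      by (rule exI[of _ 0], intro allI impI) (use le in simp)
  qed
  show "0 \<le> digit_expansion p \<omega>"
    unfolding digit_expansion_def by (intro suminf_nonneg sg) auto
  have "digit_expansion p \<omega> \<le> (\<Sum>j. (real p - 1) / real p * (1 / real p) ^ j)"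
    unfolding digit_expansion_def by (intro suminf_le le sg sums_summable[OF geo])
  also have "\<dots> = 1" using geo one sums_unique by metis
  finally show "digit_expansion p \<omega> \<le> 1" .
  let ?h = "\<lambda>j. real (case_nat s \<omega> j) / real p ^ Suc j"
  have hS: "?h (Suc j) = ?g j / real p" for j by simp
  have "summable (\<lambda>j. ?h (Suc j))"
    unfolding hS by (intro summable_divide sg)
  then have sh: "summable ?h" using summable_Suc_iff[of ?h] by blast
  have "digit_expansion p (case_nat s \<omega>) = (\<Sum>j. ?h (Suc j)) + ?h 0"
    unfolding digit_expansion_def using suminf_split_head[OF sh] by simp
  also have "(\<Sum>j. ?h (Suc j)) = digit_expansion p \<omega> / real p"
    unfolding hS digit_expansion_def by (rule suminf_divide[OF sg])
  finally show "digit_expansion p (case_nat s \<omega>) = (real s + digit_expansion p \<omega>) / real p"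
    by (simp add: add_divide_distrib)
qed

locale missing_digit =
  fixes p :: nat and D :: "nat set"
  assumes p2: "2 \<le> p" and D_sub: "D \<subseteq> {..<p}" and D_ne: "D \<noteq> {}"
begin

abbreviation P :: nat where "P \<equiv> card D"

abbreviation mu :: "real measure" where "mu \<equiv> missing_digit_measure p D"

lemma finite_D [simp]: "finite D"
  using D_sub finite_subset by blast

lemma P_pos [simp]: "0 < P"
  using D_ne by (simp add: card_gt_0_iff)

lemma P_le: "P \<le> p"
  using card_mono[OF _ D_sub] by simp

lemma p_pos [simp]: "0 < p" using p2 by simp

lemma prob_mu: "prob_space mu"
  by (rule prob_space_missing_digit_measure)

lemma AE_digits: "AE \<omega> in digit_sequences D. \<forall>j. \<omega> j < p"
proof -
  interpret S: product_prob_space "\<lambda>_::nat. measure_pmf (pmf_of_set D)" UNIV ..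
  have "AE x in measure_pmf (pmf_of_set D). x < p"
    using D_sub D_ne by (auto simp: AE_measure_pmf_iff)
  then have "AE \<omega> in digit_sequences D. \<omega> j < p" for j
    unfolding digit_sequences_def by (intro AE_PiM_component) (auto intro: measure_pmf.prob_space_axioms)
  then show ?thesis by (simp add: AE_all_countable)
qed

lemma space_mu [simp]: "space mu = UNIV"
  by (simp add: missing_digit_measure_def)

lemma prob_digit_sequences: "prob_space (digit_sequences D)"
proof -
  interpret S: product_prob_space "\<lambda>_::nat. measure_pmf (pmf_of_set D)" UNIV ..
  show ?thesis unfolding digit_sequences_def by (rule S.prob_space_axioms)
qed

lemma mu_unit_interval: "AE x in mu. x \<in> {0..1}"
  unfolding missing_digit_measure_def
proof (subst AE_distr_iff)
  show "AE x in digit_sequences D. digit_expansion p x \<in> {0..1}"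
    using AE_digits by eventually_elim (use digit_expansion_case_nat p2 in auto)
qed auto

text \<open>A digit sequence arises by putting one more digit in front of an independent sequence
  (\<open>S.PiM_iter\<close>); on expansions this is the map from x to (a + x) / p. The bound
  \<open>B\<close> supplies the integrability for Fubini.\<close>

lemma integral_mu_self_similar:
  fixes f :: "real \<Rightarrow> 'b :: {banach, second_countable_topology}"
  assumes f [measurable]: "f \<in> borel_measurable borel" and B: "\<And>x. norm (f x) \<le> B"
  shows "integral\<^sup>L mu f = (\<Sum>a\<in>D. \<integral>x. f ((real a + x) / real p) \<partial>mu) /\<^sub>R real P"
proof -
  let ?M = "measure_pmf (pmf_of_set D)"
  interpret S: sequence_space ?M ..
  have SD: "S.S = digit_sequences D" by (simp add: digit_sequences_def)
  interpret D: prob_space "digit_sequences D" by (rule prob_digit_sequences)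
  interpret PP: pair_prob_space ?M "digit_sequences D" ..
  have m1 [measurable]: "(\<lambda>(s, \<omega>). case_nat s \<omega>) \<in> measurable (?M \<Otimes>\<^sub>M digit_sequences D) (digit_sequences D)"
    unfolding digit_sequences_def by measurable
  have eq: "distr (?M \<Otimes>\<^sub>M digit_sequences D) (digit_sequences D) (\<lambda>(s, \<omega>). case_nat s \<omega>) = digit_sequences D"
    using S.PiM_iter unfolding SD .
  have "integral\<^sup>L mu f = (\<integral>\<omega>. f (digit_expansion p \<omega>) \<partial>digit_sequences D)"
    unfolding missing_digit_measure_def by (rule integral_distr) auto
  also have "\<dots> = (\<integral>\<omega>. f (digit_expansion p \<omega>) \<partial>distr (?M \<Otimes>\<^sub>M digit_sequences D) (digit_sequences D) (\<lambda>(s, \<omega>). case_nat s \<omega>))"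
    unfolding eq ..
  also have "\<dots> = (\<integral>z. f (digit_expansion p (case z of (s, \<omega>) \<Rightarrow> case_nat s \<omega>)) \<partial>(?M \<Otimes>\<^sub>M digit_sequences D))"
    by (rule integral_distr) measurable
  also have "\<dots> = (\<integral>z. (case z of (s, \<omega>) \<Rightarrow> f (digit_expansion p (case_nat s \<omega>))) \<partial>(?M \<Otimes>\<^sub>M digit_sequences D))"
    by (intro Bochner_Integration.integral_cong) auto
  also have "\<dots> = (\<integral>s. (\<integral>\<omega>. f (digit_expansion p (case_nat s \<omega>)) \<partial>digit_sequences D) \<partial>?M)"
  proof (rule PP.integral_fst[symmetric])
    show "integrable (?M \<Otimes>\<^sub>M digit_sequences D) (\<lambda>(s, \<omega>). f (digit_expansion p (case_nat s \<omega>)))"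
    proof (rule PP.P.integrable_const_bound[where B = B])
      have "(\<lambda>z. f (digit_expansion p (case z of (s, \<omega>) \<Rightarrow> case_nat s \<omega>))) \<in> borel_measurable (?M \<Otimes>\<^sub>M digit_sequences D)"
        by measurable
      then show "(\<lambda>(s, \<omega>). f (digit_expansion p (case_nat s \<omega>))) \<in> borel_measurable (?M \<Otimes>\<^sub>M digit_sequences D)"
        by (simp add: case_prod_beta' )
    qed (use B in auto)
  qed
  also have "\<dots> = (\<integral>s. (\<integral>x. f ((real s + x) / real p) \<partial>mu) \<partial>?M)"
  proof (rule Bochner_Integration.integral_cong[OF refl])
    fix s
    have "(\<integral>\<omega>. f (digit_expansion p (case_nat s \<omega>)) \<partial>digit_sequences D)
        = (\<integral>\<omega>. f ((real s + digit_expansion p \<omega>) / real p) \<partial>digit_sequences D)"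
    \<comment> \<open>The formula for a prepended digit presupposes digits below \<open>p\<close>,
      which in \<open>digit_sequences\<close> holds only almost surely.\<close>
    proof (rule integral_cong_AE)
      have "case_nat s \<in> measurable (digit_sequences D) (digit_sequences D)"
        unfolding digit_sequences_def by measurable
      then show "(\<lambda>\<omega>. f (digit_expansion p (case_nat s \<omega>))) \<in> borel_measurable (digit_sequences D)"
        by measurable
      show "AE \<omega> in digit_sequences D. f (digit_expansion p (case_nat s \<omega>)) = f ((real s + digit_expansion p \<omega>) / real p)"
        using AE_digits by eventually_elim (use digit_expansion_case_nat p2 in auto)
    qed measurable
    also have "\<dots> = (\<integral>x. f ((real s + x) / real p) \<partial>mu)"
      unfolding missing_digit_measure_def by (rule integral_distr[symmetric]) auto
    finally show "(\<integral>\<omega>. f (digit_expansion p (case_nat s \<omega>)) \<partial>digit_sequences D)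
        = (\<integral>x. f ((real s + x) / real p) \<partial>mu)" .
  qed
  also have "\<dots> = (\<Sum>a\<in>D. \<integral>x. f ((real a + x) / real p) \<partial>mu) /\<^sub>R real P"
    by (subst integral_measure_pmf[of D]) (use D_ne in \<open>auto simp: scaleR_sum_right divide_inverse\<close>)
  finally show ?thesis .
qed

text \<open>The normalised restriction of the measure to the cylinder of the level-\<open>k\<close> word whose
  digits are those of \<open>w < p ^ k\<close>.\<close>

definition cm :: "nat \<Rightarrow> nat \<Rightarrow> real measure" where
  "cm k w = distr mu borel (\<lambda>x. (real w + x) / real p ^ k)"

definition cyl :: "nat \<Rightarrow> nat \<Rightarrow> real set" where
  "cyl k w = {real w / real p ^ k .. (real w + 1) / real p ^ k}"

text \<open>Words are encoded as integers in base \<open>p\<close>, the digit appended last being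
  the least significant. Thus \<open>cyl (Suc k) (p * w + a)\<close> is the child of
  \<open>cyl k w\<close> for the digit \<open>a\<close>, and concatenation is
  \<open>w * p ^ m + u\<close>.\<close>

primrec Wd :: "nat \<Rightarrow> nat set" where
  "Wd 0 = {0}"
| "Wd (Suc m) = (\<lambda>(w, a). p * w + a) ` (Wd m \<times> D)"

lemma finite_Wd [simp]: "finite (Wd m)"
  by (induction m) auto

lemma inj_Wd: "inj_on (\<lambda>(w, a). p * w + a) (A \<times> D)"
proof (rule inj_onI, clarify)
  fix w a w' a' assume "a \<in> D" "a' \<in> D" and eq: "p * w + a = p * w' + a'"
  then have l: "a < p" "a' < p" using D_sub by auto
  have "(p * w + a) div p = (p * w' + a') div p" "(p * w + a) mod p = (p * w' + a') mod p"
    using eq by simp_all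
  then show "w = w' \<and> a = a'" using l by simp
qed

lemma sum_Wd_Suc: "(\<Sum>u\<in>Wd (Suc m). f u) = (\<Sum>u\<in>Wd m. \<Sum>a\<in>D. f (p * u + a))"
  unfolding Wd.simps sum.reindex[OF inj_Wd] sum.cartesian_product by (simp add: case_prod_beta)

lemma card_Wd [simp]: "card (Wd m) = P ^ m"
  by (induction m) (simp_all add: card_image[OF inj_Wd])

lemma Wd_add: "w \<in> Wd k \<Longrightarrow> u \<in> Wd m \<Longrightarrow> w * p ^ m + u \<in> Wd (k + m)"
proof (induction m arbitrary: u)
  case (Suc m)
  then obtain u' a where u': "u' \<in> Wd m" "a \<in> D" "u = p * u' + a" by auto
  then have "p * (w * p ^ m + u') + a \<in> Wd (k + Suc m)" using Suc by force
  then show ?case using u' by (simp add: algebra_simps)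
qed auto

lemma Wd_less: "u \<in> Wd m \<Longrightarrow> u < p ^ m"
proof (induction m arbitrary: u)
  case (Suc m)
  then obtain u' a where u': "u' \<in> Wd m" "a \<in> D" "u = p * u' + a" by auto
  then have "a < p" "u' + 1 \<le> p ^ m" using Suc.IH D_sub by (auto simp: Suc_leI)
  then have "p * u' + a < p * (u' + 1)" "p * (u' + 1) \<le> p * p ^ m" by (simp, intro mult_le_mono2)
  then show ?case using u' by simp
qed auto

lemma cyl_dist: "x \<in> cyl k v \<Longrightarrow> y \<in> cyl k v \<Longrightarrow> \<bar>y - x\<bar> \<le> 1 / real p ^ k"
proof -
  assume xy: "x \<in> cyl k v" "y \<in> cyl k v"
  have "(real v + 1) / real p ^ k = real v / real p ^ k + 1 / real p ^ k" by (simp add: add_divide_distrib)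
  then show ?thesis using xy unfolding cyl_def by auto
qed

lemma cyl_child: "u < p ^ m \<Longrightarrow> cyl (k + m) (w * p ^ m + u) \<subseteq> cyl k w"
proof -
  assume "u < p ^ m"
  then have "real u + 1 \<le> real p ^ m" by (metis Suc_leI of_nat_Suc of_nat_le_iff of_nat_power add.commute)
  then show ?thesis using p_pos
    by (auto simp: cyl_def power_add divide_simps) (auto simp: algebra_simps intro: order_trans)
qed

lemma prob_cm: "prob_space (cm k w)"
  unfolding cm_def by (rule prob_space.prob_space_distr[OF prob_mu]) auto

lemma sets_cm [simp, measurable_cong]: "sets (cm k w) = sets borel"
  by (simp add: cm_def)

lemma space_cm [simp]: "space (cm k w) = UNIV"
  by (simp add: cm_def)

lemma cm_0: "cm 0 0 = mu"
  unfolding cm_def using distr_id2[of borel mu] by simp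

lemma integral_cm:
  fixes f :: "real \<Rightarrow> 'b :: {banach, second_countable_topology}"
  assumes [measurable]: "f \<in> borel_measurable borel"
  shows "integral\<^sup>L (cm k w) f = (\<integral>x. f ((real w + x) / real p ^ k) \<partial>mu)"
  unfolding cm_def by (rule integral_distr) auto

lemma integral_cm_Suc:
  fixes f :: "real \<Rightarrow> 'b :: {banach, second_countable_topology}"
  assumes f [measurable]: "f \<in> borel_measurable borel" and B: "\<And>x. norm (f x) \<le> B"
  shows "integral\<^sup>L (cm k w) f = (\<Sum>a\<in>D. integral\<^sup>L (cm (Suc k) (p * w + a)) f) /\<^sub>R real P"
proof -
  have "integral\<^sup>L (cm k w) f = (\<Sum>a\<in>D. \<integral>x. f ((real w + (real a + x) / real p) / real p ^ k) \<partial>mu) /\<^sub>R real P"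
    unfolding integral_cm[OF f] by (rule integral_mu_self_similar[where B = B]) (use B in auto)
  moreover have "(real w + (real a + x) / real p) / real p ^ k = (real (p * w + a) + x) / real p ^ Suc k" for a x
    using p_pos by (simp add: field_simps)
  ultimately show ?thesis unfolding integral_cm[OF f] by simp
qed

lemma integral_cm_split:
  fixes f :: "real \<Rightarrow> 'b :: {banach, second_countable_topology}"
  assumes f [measurable]: "f \<in> borel_measurable borel" and B: "\<And>x. norm (f x) \<le> B"
  shows "integral\<^sup>L (cm k w) f = (\<Sum>u\<in>Wd m. integral\<^sup>L (cm (k + m) (w * p ^ m + u)) f) /\<^sub>R real (P ^ m)"
proof (induction m)
  case (Suc m)
  have "integral\<^sup>L (cm (k + m) (w * p ^ m + u)) f
     = (\<Sum>a\<in>D. integral\<^sup>L (cm (k + Suc m) (w * p ^ Suc m + (p * u + a))) f) /\<^sub>R real P" for u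
    using integral_cm_Suc[OF f B, of "k + m" "w * p ^ m + u"] by (simp add: algebra_simps)
  then show ?case
    unfolding Suc sum_Wd_Suc by (simp add: scaleR_sum_right field_simps)
qed simp

lemma measure_cm_split:
  assumes A: "A \<in> sets borel"
  shows "measure (cm k w) A = (\<Sum>u\<in>Wd m. measure (cm (k + m) (w * p ^ m + u)) A) / real (P ^ m)"
proof -
  have "integral\<^sup>L (cm k w) (indicator A :: real \<Rightarrow> real) = measure (cm k w) A" for k w
    using A by simp
  then show ?thesis
    using integral_cm_split[of "indicator A :: real \<Rightarrow> real" 1 k w m] A
    by (simp add: indicator_def divide_inverse mult.commute)
qed

lemma AE_cm_cyl: "AE x in cm k w. x \<in> cyl k w"
  unfolding cm_def
proof (subst AE_distr_iff)
  show "AE x in mu. (real w + x) / real p ^ k \<in> cyl k w"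
    using mu_unit_interval by eventually_elim (auto simp: cyl_def divide_right_mono)
qed (auto simp: cyl_def)

lemma measure_cm_cyl: "A \<in> sets borel \<Longrightarrow> cyl k w \<subseteq> A \<Longrightarrow> measure (cm k w) A = 1"
proof -
  assume A: "A \<in> sets borel" "cyl k w \<subseteq> A"
  interpret prob_space "cm k w" by (rule prob_cm)
  have "AE x in cm k w. x \<in> A" using AE_cm_cyl by eventually_elim (use A(2) in auto)
  then show ?thesis using A(1) prob_eq_1[of A] by simp
qed

lemma measure_cm_disjoint: "A \<in> sets borel \<Longrightarrow> cyl k w \<inter> A = {} \<Longrightarrow> measure (cm k w) A = 0"
proof -
  assume A: "A \<in> sets borel" "cyl k w \<inter> A = {}"
  interpret prob_space "cm k w" by (rule prob_cm)
  have "AE x in cm k w. x \<notin> A" using AE_cm_cyl by eventually_elim (use A(2) in auto)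
  then show ?thesis using A(1) prob_eq_0[of A] by simp
qed

lemma measure_cm_le_1: "measure (cm k w) A \<le> 1"
  using prob_space.prob_le_1[OF prob_cm] .

end

subsection \<open>The Fourier transform of a missing digit measure\<close>

lemma sum_lessThan_mult:
  fixes f :: "nat \<Rightarrow> 'a::comm_monoid_add"
  shows "(\<Sum>x<m * N. f x) = (\<Sum>r<N. \<Sum>i<m. f (i * N + r))"
proof -
  have "(\<Sum>x<m * N. f x) = (\<Sum>i<m. sum f {i * N..<i * N + N})"
    by (rule sum.nat_group[symmetric])
  also have "\<dots> = (\<Sum>i<m. \<Sum>r<N. f (i * N + r))"
  proof (rule sum.cong[OF refl])
    fix i
    show "sum f {i * N..<i * N + N} = (\<Sum>r<N. f (i * N + r))"
      using sum.shift_bounds_nat_ivl[of f 0 "i * N" N] by (simp add: lessThan_atLeast0 add.commute)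
  qed
  also have "\<dots> = (\<Sum>r<N. \<Sum>i<m. f (i * N + r))" by (rule sum.swap)
  finally show ?thesis .
qed

lemma borel_measurable_cis [measurable]: "cis \<in> borel_measurable borel"
  by (intro borel_measurable_continuous_onI continuous_intros)

lemma cis_2pi_add_int [simp]: "cis (2 * pi * (t + of_int n)) = cis (2 * pi * t)"
proof -
  have "cis (2 * pi * (t + of_int n)) = cis (2 * pi * t) * cis (2 * pi * of_int n)"
    by (simp add: cis_mult algebra_simps)
  then show ?thesis by (simp add: cis_multiple_2pi)
qed

context missing_digit
begin

text \<open>The characteristic function of one random digit, in units of 2 * pi. Iterating
  \<open>G_step\<close> makes \<open>G\<close>, that of \<open>mu\<close>, a product of values of
  \<open>phi\<close> at \<theta> / p, \<theta> / p^2, ... and a remaining factor of modulus at most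
  1.\<close>

definition phi :: "real \<Rightarrow> complex" where
  "phi t = (\<Sum>a\<in>D. cis (2 * pi * (real a * t))) / of_nat P"

definition G :: "real \<Rightarrow> complex" where
  "G \<theta> = (\<integral>x. cis (2 * pi * (\<theta> * x)) \<partial>mu)"

lemma G_step: "G \<theta> = phi (\<theta> / real p) * G (\<theta> / real p)"
proof -
  have "G \<theta> = (\<Sum>a\<in>D. \<integral>x. cis (2 * pi * (\<theta> * ((real a + x) / real p))) \<partial>mu) /\<^sub>R real P"
    unfolding G_def by (rule integral_mu_self_similar[where B = 1]) auto
  moreover have "(\<integral>x. cis (2 * pi * (\<theta> * ((real a + x) / real p))) \<partial>mu)
      = cis (2 * pi * (real a * (\<theta> / real p))) * G (\<theta> / real p)" for a
  proof -
    have "cis (2 * pi * (\<theta> * ((real a + x) / real p)))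
        = cis (2 * pi * (real a * (\<theta> / real p))) * cis (2 * pi * (\<theta> / real p * x))" for x
      unfolding cis_mult by (rule arg_cong[where f = cis]) (simp add: field_simps)
    then show ?thesis unfolding G_def by simp
  qed
  ultimately have "G \<theta> = (\<Sum>a\<in>D. cis (2 * pi * (real a * (\<theta> / real p))) * G (\<theta> / real p)) /\<^sub>R real P"
    by simp
  also have "\<dots> = phi (\<theta> / real p) * G (\<theta> / real p)"
    unfolding phi_def sum_distrib_right[symmetric] by (simp add: scaleR_conv_of_real divide_inverse)
  finally show ?thesis .
qed

lemma norm_G_le_1: "norm (G \<theta>) \<le> 1"
proof -
  interpret prob_space mu by (rule prob_mu)
  have "norm (G \<theta>) \<le> (\<integral>x. norm (cis (2 * pi * (\<theta> * x))) \<partial>mu)"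
    unfolding G_def by (rule integral_norm_bound)
  then show ?thesis using prob_space by simp
qed

text \<open>Passing to a cylinder divides the frequency by \<open>p ^ k\<close> and translates the
  argument. The translation is only a phase, so the bound is the same for all \<open>w\<close>; this
  is why all later estimates hold in every cylinder at once.\<close>

lemma abs_integral_cm_cos_le:
  "\<bar>\<integral>x. cos (2 * pi * (\<theta> * x)) \<partial>cm k w\<bar> \<le> norm (G (\<theta> / real p ^ k))"
proof -
  have "(\<integral>x. cis (2 * pi * (\<theta> * x)) \<partial>cm k w) = (\<integral>x. cis (2 * pi * (\<theta> * ((real w + x) / real p ^ k))) \<partial>mu)"
    by (rule integral_cm) auto
  also have "\<dots> = cis (2 * pi * (\<theta> * real w / real p ^ k)) * G (\<theta> / real p ^ k)"
  proof -
    have "cis (2 * pi * (\<theta> * ((real w + x) / real p ^ k)))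
        = cis (2 * pi * (\<theta> * real w / real p ^ k)) * cis (2 * pi * (\<theta> / real p ^ k * x))" for x
      unfolding cis_mult by (rule arg_cong[where f = cis]) (simp add: field_simps)
    then show ?thesis unfolding G_def by simp
  qed
  finally have eq: "norm (\<integral>x. cis (2 * pi * (\<theta> * x)) \<partial>cm k w) = norm (G (\<theta> / real p ^ k))"
    by (simp add: norm_mult)
  interpret prob_space "cm k w" by (rule prob_cm)
  have "integrable (cm k w) (\<lambda>x. cis (2 * pi * (\<theta> * x)))"
    by (rule integrable_const_bound[where B = 1]) auto
  then have "Re (\<integral>x. cis (2 * pi * (\<theta> * x)) \<partial>cm k w) = (\<integral>x. Re (cis (2 * pi * (\<theta> * x))) \<partial>cm k w)"
    by (rule integral_Re[symmetric])
  also have "\<dots> = (\<integral>x. cos (2 * pi * (\<theta> * x)) \<partial>cm k w)"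
    by (simp only: cis.sel)
  finally have "(\<integral>x. cos (2 * pi * (\<theta> * x)) \<partial>cm k w) = Re (\<integral>x. cis (2 * pi * (\<theta> * x)) \<partial>cm k w)"
    by (rule sym)
  then show ?thesis
    using abs_Re_le_cmod[of "\<integral>x. cis (2 * pi * (\<theta> * x)) \<partial>cm k w"] unfolding eq by (simp only:)
qed

lemma norm_G_le_prod: "norm (G \<theta>) \<le> (\<Prod>j<n. norm (phi (\<theta> / real p ^ Suc j)))"
proof -
  have "norm (G \<theta>) = (\<Prod>j<n. norm (phi (\<theta> / real p ^ Suc j))) * norm (G (\<theta> / real p ^ n))"
  proof (induction n)
    case (Suc n)
    have "norm (G (\<theta> / real p ^ n)) = norm (phi (\<theta> / real p ^ Suc n)) * norm (G (\<theta> / real p ^ Suc n))"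
      using G_step[of "\<theta> / real p ^ n"] by (simp add: norm_mult mult.commute)
    then show ?case using Suc by simp
  qed simp
  also have "\<dots> \<le> (\<Prod>j<n. norm (phi (\<theta> / real p ^ Suc j))) * 1"
    by (intro mult_left_mono norm_G_le_1 prod_nonneg) auto
  finally show ?thesis by simp
qed

lemma phi_add_nat [simp]: "phi (t + real m) = phi t"
proof -
  have "cis (2 * pi * (real a * (t + real m))) = cis (2 * pi * (real a * t))" for a
    using cis_2pi_add_int[of "real a * t" "int (a * m)"] by (simp add: algebra_simps)
  then show ?thesis by (simp add: phi_def)
qed

text \<open>Split off the top digit, \<xi> = i * p^(k + n) + r. By periodicity the factors with j <
  n see only r, while the last one sees a shift by i / p, so that the sum over i is at most
  \<open>lam\<close>. The base case counts \<open>p ^ k\<close> empty products.\<close>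

lemma sum_prod_phi_le:
  assumes lam: "\<And>t. (\<Sum>i<p. norm (phi (t + real i / real p))) \<le> lam"
  shows "(\<Sum>\<xi><p ^ (k + n). \<Prod>j<n. norm (phi (real \<xi> / real p ^ (k + Suc j)))) \<le> real p ^ k * lam ^ n"
proof (induction n)
  case (Suc n)
  let ?N = "p ^ (k + n)"
  have "(\<Sum>\<xi><p ^ (k + Suc n). \<Prod>j<Suc n. norm (phi (real \<xi> / real p ^ (k + Suc j))))
     = (\<Sum>r<?N. \<Sum>i<p. \<Prod>j<Suc n. norm (phi (real (i * ?N + r) / real p ^ (k + Suc j))))"
    unfolding add_Suc_right power_Suc by (rule sum_lessThan_mult)
  also have "\<dots> = (\<Sum>r<?N. (\<Prod>j<n. norm (phi (real r / real p ^ (k + Suc j)))) *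
       (\<Sum>i<p. norm (phi (real r / real p ^ (k + Suc n) + real i / real p))))"
  proof (rule sum.cong[OF refl])
    fix r
    have a: "phi (real (i * ?N + r) / real p ^ (k + Suc j)) = phi (real r / real p ^ (k + Suc j))"
      if j: "j < n" for i j
    proof -
      have "real (i * ?N + r) / real p ^ (k + Suc j) = real r / real p ^ (k + Suc j) + real (i * p ^ (n - Suc j))"
      proof -
        have "real p ^ (k + n) = real p ^ (k + Suc j) * real p ^ (n - Suc j)"
          unfolding power_add[symmetric] using j by simp
        then have "real (i * ?N) = real (i * p ^ (n - Suc j)) * real p ^ (k + Suc j)" by simp
        then have "real (i * ?N) / real p ^ (k + Suc j) = real (i * p ^ (n - Suc j))"
          by (metis nonzero_mult_div_cancel_right of_nat_0_less_iff p_pos power_eq_0_iff less_irrefl)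
        then show ?thesis unfolding of_nat_add add_divide_distrib by linarith
      qed
      then show ?thesis by (simp only: phi_add_nat)
    qed
    have b: "real (i * ?N + r) / real p ^ (k + Suc n) = real r / real p ^ (k + Suc n) + real i / real p" for i
      by (simp add: add_divide_distrib)
    have "(\<Prod>j<Suc n. norm (phi (real (i * ?N + r) / real p ^ (k + Suc j))))
       = (\<Prod>j<n. norm (phi (real r / real p ^ (k + Suc j)))) * norm (phi (real r / real p ^ (k + Suc n) + real i / real p))" for i
      unfolding prod.lessThan_Suc b
    proof (rule arg_cong2[where f = "(*)", OF prod.cong[OF refl] refl])
      fix j assume "j \<in> {..<n}"
      then show "norm (phi (real (i * ?N + r) / real p ^ (k + Suc j))) = norm (phi (real r / real p ^ (k + Suc j)))"
        using a[of j i] by simp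
    qed
    then show "(\<Sum>i<p. \<Prod>j<Suc n. norm (phi (real (i * ?N + r) / real p ^ (k + Suc j))))
      = (\<Prod>j<n. norm (phi (real r / real p ^ (k + Suc j)))) *
       (\<Sum>i<p. norm (phi (real r / real p ^ (k + Suc n) + real i / real p)))"
      unfolding sum_distrib_left by (intro sum.cong[OF refl])
  qed
  also have "\<dots> \<le> (\<Sum>r<?N. (\<Prod>j<n. norm (phi (real r / real p ^ (k + Suc j)))) * lam)"
    by (intro sum_mono mult_left_mono lam prod_nonneg) auto
  also have "\<dots> = (\<Sum>r<?N. (\<Prod>j<n. norm (phi (real r / real p ^ (k + Suc j))))) * lam"
    by (rule sum_distrib_right[symmetric])
  also have "\<dots> \<le> real p ^ k * lam ^ n * lam"
  proof (rule mult_right_mono[OF Suc])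
    have "0 \<le> (\<Sum>i<p. norm (phi (0 + real i / real p)))" by (intro sum_nonneg) auto
    then show "0 \<le> lam" using lam[of 0] by linarith
  qed
  finally show ?case unfolding power_Suc by (simp only: mult_ac)
qed simp

lemma sum_norm_G_le:
  assumes lam: "\<And>t. (\<Sum>i<p. norm (phi (t + real i / real p))) \<le> lam"
  shows "(\<Sum>\<xi><p ^ (k + n). norm (G (real \<xi> / real p ^ k))) \<le> real p ^ k * lam ^ n"
proof (rule order_trans[OF _ sum_prod_phi_le[OF lam]])
  show "(\<Sum>\<xi><p ^ (k + n). norm (G (real \<xi> / real p ^ k)))
    \<le> (\<Sum>\<xi><p ^ (k + n). \<Prod>j<n. norm (phi (real \<xi> / real p ^ (k + Suc j))))"
  proof (rule sum_mono)
    fix \<xi>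
    have "real \<xi> / real p ^ k / real p ^ Suc j = real \<xi> / real p ^ (k + Suc j)" for j
      by (simp add: power_add)
    then have "(\<Prod>j<n. norm (phi (real \<xi> / real p ^ (k + Suc j)))) = (\<Prod>j<n. norm (phi (real \<xi> / real p ^ k / real p ^ Suc j)))"
      by (intro prod.cong refl arg_cong[where f = "\<lambda>x. norm (phi x)"]) (rule sym)
    then show "norm (G (real \<xi> / real p ^ k)) \<le> (\<Prod>j<n. norm (phi (real \<xi> / real p ^ (k + Suc j))))"
      using norm_G_le_prod[of "real \<xi> / real p ^ k" n] by metis
  qed
qed

end

subsection \<open>Middle digit sets\<close>

lemma sum_cis_roots_of_unity:
  assumes p: "0 < p" and m: "\<not> int p dvd m"
  shows "(\<Sum>i<p. cis (2 * pi * (of_int m * real i / real p))) = 0"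
proof -
  define z where "z = cis (2 * pi * (of_int m / real p))"
  have z1: "z \<noteq> 1"
  proof
    assume "z = 1"
    then have "cos (2 * pi * (of_int m / real p)) = 1" by (simp add: z_def complex_eq_iff)
    then obtain k :: int where "2 * pi * (of_int m / real p) = of_int k * 2 * pi"
      using cos_one_2pi_int by auto
    then have "real_of_int m = of_int k * real p" using p by (simp add: field_simps)
    then have "m = k * int p" by (metis of_int_eq_iff of_int_mult of_int_of_nat_eq)
    then show False using m by simp
  qed
  have zp: "z ^ p = 1"
  proof -
    have "z ^ p = cis (2 * pi * of_int m)" unfolding z_def Complex.DeMoivre by (rule arg_cong[where f = cis]) (use p in simp)
    then show ?thesis by (simp add: cis_multiple_2pi)
  qed
  have "(\<Sum>i<p. cis (2 * pi * (of_int m * real i / real p))) = (\<Sum>i<p. z ^ i)"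
    unfolding z_def Complex.DeMoivre by (intro sum.cong refl arg_cong[where f = cis]) simp
  also have "\<dots> = 0" using z1 zp by (simp add: geometric_sum)
  finally show ?thesis .
qed

lemma sum_squares_shifted:
  "(\<Sum>a<n. (real a - x)\<^sup>2) = real n * x\<^sup>2 - real n * (real n - 1) * x + real n * (real n - 1) * (2 * real n - 1) / 6"
  by (induction n) (simp_all add: power2_eq_square field_simps)

lemma cos_ge_quadratic: "1 - x\<^sup>2 / 2 \<le> cos (x::real)"
proof -
  have "(sin (x / 2))\<^sup>2 \<le> (x / 2)\<^sup>2"
    using abs_sin_x_le_abs_x[of "x / 2"] by (metis abs_le_square_iff)
  moreover have "cos x = 1 - 2 * (sin (x / 2))\<^sup>2" using cos_double_sin[of "x / 2"] by simp
  ultimately show ?thesis by (simp add: power_divide)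
qed

lemma pi_squared_le: "pi\<^sup>2 \<le> 10"
proof -
  have "pi \<le> 3.16" using pi_approx(2) by simp
  then have "pi\<^sup>2 \<le> 3.16\<^sup>2" by (intro power_mono) auto
  then show ?thesis by (simp add: power2_eq_square)
qed

context missing_digit
begin

text \<open>Orthogonality of the characters modulo \<open>p\<close>: the digits are distinct
  residues, so only the diagonal survives the sum over the shifts.\<close>

lemma phi_parseval: "(\<Sum>i<p. (norm (phi (t + real i / real p)))\<^sup>2) = real p / real P"
proof -
  define c where "c a u = cis (2 * pi * (real a * u))" for a u
  have c_cnj: "c a u * cnj (c b u) = cis (2 * pi * ((real a - real b) * u))" for a b u
    by (simp add: c_def cis_cnj cis_mult algebra_simps)
  have inner: "(\<Sum>i<p. c a (t + real i / real p) * cnj (c b (t + real i / real p)))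
      = (if a = b then of_nat p else 0)" if ab: "a \<in> D" "b \<in> D" for a b
  proof (cases "a = b")
    case True
    then show ?thesis by (simp add: c_cnj)
  next
    case False
    have nd: "\<not> int p dvd (int a - int b)"
    proof
      assume "int p dvd (int a - int b)"
      moreover have "a < p" "b < p" using ab D_sub by auto
      ultimately show False using False
        using mod_eq_dvd_iff[of "int a" "int p" "int b"] by simp
    qed
    have "c a (t + real i / real p) * cnj (c b (t + real i / real p))
        = cis (2 * pi * ((real a - real b) * t)) * cis (2 * pi * (of_int (int a - int b) * real i / real p))" for i
      unfolding c_cnj cis_mult by (rule arg_cong[where f = cis]) (simp add: algebra_simps)
    then have "(\<Sum>i<p. c a (t + real i / real p) * cnj (c b (t + real i / real p)))
      = cis (2 * pi * ((real a - real b) * t)) * (\<Sum>i<p. cis (2 * pi * (of_int (int a - int b) * real i / real p)))"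
      unfolding sum_distrib_left by (intro sum.cong) auto
    then show ?thesis using sum_cis_roots_of_unity[OF p_pos nd] False by simp
  qed
  have sq: "of_real ((norm (phi u))\<^sup>2) = (\<Sum>a\<in>D. \<Sum>b\<in>D. c a u * cnj (c b u)) / (of_nat P)\<^sup>2" for u
  proof -
    have ph: "phi u = (\<Sum>a\<in>D. c a u) / of_nat P" by (simp add: phi_def c_def)
    have "phi u * cnj (phi u) = (\<Sum>a\<in>D. \<Sum>b\<in>D. c a u * cnj (c b u)) / (of_nat P)\<^sup>2"
      unfolding ph complex_cnj_divide cnj_sum complex_cnj_of_nat times_divide_times_eq sum_product power2_eq_square ..
    then show ?thesis using complex_norm_square[of "phi u"] by (simp only:)
  qed
  have "of_real (\<Sum>i<p. (norm (phi (t + real i / real p)))\<^sup>2)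
     = (\<Sum>i<p. (\<Sum>a\<in>D. \<Sum>b\<in>D. c a (t + real i / real p) * cnj (c b (t + real i / real p))) / (of_nat P)\<^sup>2)"
    unfolding of_real_sum by (intro sum.cong refl sq)
  also have "\<dots> = (\<Sum>i<p. \<Sum>a\<in>D. \<Sum>b\<in>D. c a (t + real i / real p) * cnj (c b (t + real i / real p))) / (of_nat P)\<^sup>2"
    by (rule sum_divide_distrib[symmetric])
  also have "(\<Sum>i<p. \<Sum>a\<in>D. \<Sum>b\<in>D. c a (t + real i / real p) * cnj (c b (t + real i / real p)))
     = (\<Sum>a\<in>D. \<Sum>i<p. \<Sum>b\<in>D. c a (t + real i / real p) * cnj (c b (t + real i / real p)))"
    by (rule sum.swap)
  also have "\<dots> = (\<Sum>a\<in>D. \<Sum>b\<in>D. \<Sum>i<p. c a (t + real i / real p) * cnj (c b (t + real i / real p)))"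
    by (rule sum.cong[OF refl sum.swap])
  also have "\<dots> = (\<Sum>a\<in>D. \<Sum>b\<in>D. if a = b then of_nat p else 0)"
    by (intro sum.cong refl inner)
  also have "\<dots> = of_nat P * of_nat p" by simp
  also have "of_nat P * of_nat p / (of_nat P)\<^sup>2 = complex_of_real (real p / real P)"
    by (simp add: power2_eq_square)
  finally show ?thesis by (simp only: of_real_eq_iff)
qed

text \<open>Parseval alone gives \<open>p / sqrt P\<close>, which exceeds \<open>sqrt p\<close>. One large term makes up for
  it: all the others are linearised at \<open>\<alpha>\<close>, a value below the large one.\<close>

lemma sum_norm_phi_le:
  assumes big: "\<exists>i<p. y \<le> real P * norm (phi (t + real i / real p))" and \<alpha>: "0 < \<alpha>" "\<alpha> \<le> y"
  shows "(\<Sum>i<p. real P * norm (phi (t + real i / real p)))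
    \<le> y - y\<^sup>2 / (2 * \<alpha>) + real p * real P / (2 * \<alpha>) + (real p - 1) * \<alpha> / 2"
proof -
  define z where "z i = real P * norm (phi (t + real i / real p))" for i
  have sq: "(\<Sum>i<p. (z i)\<^sup>2) = real p * real P"
    unfolding z_def power_mult_distrib sum_distrib_left[symmetric] phi_parseval
    by (simp add: power2_eq_square)
  obtain i0 where i0: "i0 < p" "y \<le> z i0" using big z_def by auto
  have lin: "z i \<le> (z i)\<^sup>2 / (2 * \<alpha>) + \<alpha> / 2" for i
  proof -
    have "0 \<le> (z i - \<alpha>)\<^sup>2" by simp
    then have "2 * \<alpha> * z i \<le> (z i)\<^sup>2 + \<alpha>\<^sup>2" by (simp add: power2_diff algebra_simps)
    then show ?thesis using \<alpha> by (simp add: field_simps power2_eq_square)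
  qed
  have "(\<Sum>i<p. z i) = z i0 + (\<Sum>i\<in>{..<p} - {i0}. z i)"
    using i0 by (subst sum.remove[of _ i0]) auto
  also have "(\<Sum>i\<in>{..<p} - {i0}. z i) \<le> (\<Sum>i\<in>{..<p} - {i0}. (z i)\<^sup>2 / (2 * \<alpha>) + \<alpha> / 2)"
    by (intro sum_mono lin)
  also have "\<dots> = (\<Sum>i\<in>{..<p} - {i0}. (z i)\<^sup>2) / (2 * \<alpha>) + (real p - 1) * \<alpha> / 2"
    using i0 p_pos by (simp add: sum.distrib sum_divide_distrib of_nat_diff)
  also have "(\<Sum>i\<in>{..<p} - {i0}. (z i)\<^sup>2) = real p * real P - (z i0)\<^sup>2"
    using sq i0 by (simp add: sum.remove[of "{..<p}" i0])
  also have "z i0 + ((real p * real P - (z i0)\<^sup>2) / (2 * \<alpha>) + (real p - 1) * \<alpha> / 2)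
     \<le> y - y\<^sup>2 / (2 * \<alpha>) + real p * real P / (2 * \<alpha>) + (real p - 1) * \<alpha> / 2"
  proof -
    \<comment> \<open>The function z - z^2 / (2 * \<alpha>) decreases for z \<ge> \<alpha>, so the
      large term may be replaced by its lower bound \<open>y\<close>.\<close>
    have "0 \<le> (z i0 - y) * (z i0 + y - 2 * \<alpha>)" using i0 \<alpha> by (intro mult_nonneg_nonneg) auto
    then have "2 * \<alpha> * z i0 - (z i0)\<^sup>2 \<le> 2 * \<alpha> * y - y\<^sup>2" by (simp add: algebra_simps power2_eq_square)
    then have "(2 * \<alpha> * z i0 - (z i0)\<^sup>2) / (2 * \<alpha>) \<le> (2 * \<alpha> * y - y\<^sup>2) / (2 * \<alpha>)"
      using \<alpha> by (intro divide_right_mono) auto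
    then show ?thesis using \<alpha> by (simp add: diff_divide_distrib)
  qed
  finally show ?thesis by (simp add: z_def)
qed

end

lemma missing_digit_middle:
  assumes "3 \<le> p" shows "missing_digit p (middle_digits p)"
proof
  have "0 \<in> middle_digits p" using assms by (auto simp: middle_digits_def)
  then show "middle_digits p \<noteq> {}" by auto
qed (use assms in \<open>auto simp: middle_digits_def\<close>)

lemma card_middle_digits: "1 \<le> p \<Longrightarrow> card (middle_digits p) = p - 1"
  by (auto simp: middle_digits_def card_Diff_subset)

text \<open>Some shift brings \<open>t\<close> within 1 / (2 * p) of an integer, where all phases
  nearly agree. Centred at the missing digit, which then contributes nothing to the sum of squares,
  the quadratic bound for the cosine costs 2 * pi^2 * u^2 * (p^2 - 1) * p / 12. This is at most 5/12
  * p because pi^2 \<le> 10, and it is subtracted from \<open>p - 1\<close>.\<close>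

lemma norm_phi_middle_ge:
  assumes p: "3 \<le> p" "odd p"
  shows "\<exists>i<p. 7 / 12 * real p - 1 \<le> real (p - 1) * norm (missing_digit.phi (middle_digits p) (t + real i / real p))"
proof -
  interpret missing_digit p "middle_digits p" by (rule missing_digit_middle[OF p(1)])
  obtain h where h: "p = 2 * h + 1" using p(2) oddE by blast
  have P: "P = p - 1" using p by (simp add: card_middle_digits)
  define m where "m = round (real p * t)"
  define i where "i = nat ((- m) mod int p)"
  have ip: "i < p" using p by (simp add: i_def nat_less_iff)
  have "int i = (- m) mod int p" using p by (simp add: i_def)
  then obtain n where n: "int i + m = int p * n"
  proof -
    have "int p dvd (- m) - (- m) mod int p" by (rule dvd_minus_mod)
    then obtain n where "(- m) - (- m) mod int p = int p * n" unfolding dvd_def by blast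
    then have "(- m) - int i = int p * n" using \<open>int i = _\<close> by simp
    then have "int i + m = int p * (- n)" by simp
    then show ?thesis using that by blast
  qed
  define u where "u = t - of_int m / real p"
  have tu: "t + real i / real p = u + of_int n"
  proof -
    have "real i + of_int m = real p * of_int n" using n by (metis of_int_add of_int_mult of_int_of_nat_eq)
    then show ?thesis using p by (simp add: u_def field_simps)
  qed
  have u: "\<bar>u\<bar> \<le> 1 / (2 * real p)"
  proof -
    have "\<bar>of_int m - real p * t\<bar> \<le> 1 / 2" unfolding m_def by (rule of_int_round_abs_le)
    moreover have "real p * u = real p * t - of_int m" using p by (simp add: u_def field_simps)
    moreover have "\<bar>real p * u\<bar> = real p * \<bar>u\<bar>" by (simp add: abs_mult)
    ultimately have "real p * \<bar>u\<bar> \<le> 1 / 2" by linarith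
    then show ?thesis using p by (simp add: field_simps)
  qed
  define D where "D = middle_digits p"
  have D: "D = {..<p} - {h}" using h by (auto simp: D_def middle_digits_def)
  have phin: "phi (t + real i / real p) = phi u"
  proof -
    have "cis (2 * pi * (real a * (u + of_int n))) = cis (2 * pi * (real a * u))" for a
      using cis_2pi_add_int[of "real a * u" "int a * n"] by (simp add: algebra_simps)
    then show ?thesis unfolding tu phi_def by simp
  qed
  have "real P * norm (phi u) = norm (\<Sum>a\<in>D. cis (2 * pi * (real a * u)))"
    by (simp add: phi_def D_def norm_divide)
  also have "\<dots> = norm (cis (- (2 * pi * (real h * u))) * (\<Sum>a\<in>D. cis (2 * pi * (real a * u))))"
    by (simp add: norm_mult)
  also have "cis (- (2 * pi * (real h * u))) * (\<Sum>a\<in>D. cis (2 * pi * (real a * u))) = (\<Sum>a\<in>D. cis (2 * pi * ((real a - real h) * u)))"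
    unfolding sum_distrib_left cis_mult by (intro sum.cong refl arg_cong[where f = cis]) (simp add: algebra_simps)
  also have "norm (\<Sum>a\<in>D. cis (2 * pi * ((real a - real h) * u))) \<ge> (\<Sum>a\<in>D. cos (2 * pi * ((real a - real h) * u)))"
    using complex_Re_le_cmod[of "\<Sum>a\<in>D. cis (2 * pi * ((real a - real h) * u))"] by simp
  also have "(\<Sum>a\<in>D. cos (2 * pi * ((real a - real h) * u))) \<ge> (\<Sum>a\<in>D. 1 - (2 * pi * ((real a - real h) * u))\<^sup>2 / 2)"
    by (intro sum_mono cos_ge_quadratic)
  also have "(\<Sum>a\<in>D. 1 - (2 * pi * ((real a - real h) * u))\<^sup>2 / 2) = real (card D) - 2 * pi\<^sup>2 * u\<^sup>2 * (\<Sum>a\<in>D. (real a - real h)\<^sup>2)"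
  proof -
    have "(2 * pi * (x * u))\<^sup>2 / 2 = 2 * pi\<^sup>2 * u\<^sup>2 * x\<^sup>2" for x
      by (simp add: power_mult_distrib)
    then show ?thesis unfolding sum_subtractf sum_distrib_left by (simp add: mult.assoc)
  qed
  also have "(\<Sum>a\<in>D. (real a - real h)\<^sup>2) = (\<Sum>a<p. (real a - real h)\<^sup>2)"
    unfolding D using h by (subst (2) sum.remove[of _ h]) auto
  also have "\<dots> = ((real p)\<^sup>2 - 1) * real p / 12"
    unfolding sum_squares_shifted h by (simp add: field_simps power2_eq_square)
  also have "real (card D) - 2 * pi\<^sup>2 * u\<^sup>2 * (((real p)\<^sup>2 - 1) * real p / 12) \<ge> 7 / 12 * real p - 1"
  proof -
    have "u\<^sup>2 \<le> (1 / (2 * real p))\<^sup>2" using u by (metis abs_le_square_iff abs_of_nonneg divide_nonneg_nonneg mult_nonneg_nonneg of_nat_0_le_iff zero_le_numeral zero_le_one)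
    then have "pi\<^sup>2 * u\<^sup>2 \<le> 10 * (1 / (2 * real p))\<^sup>2" by (intro mult_mono pi_squared_le) auto
    then have "2 * (pi\<^sup>2 * u\<^sup>2) * (((real p)\<^sup>2 - 1) * real p / 12) \<le> 2 * (10 * (1 / (2 * real p))\<^sup>2) * ((real p)\<^sup>2 * real p / 12)"
      using p by (intro mult_mono[OF mult_left_mono[OF \<open>pi\<^sup>2 * u\<^sup>2 \<le> _\<close>]]) (auto intro!: divide_right_mono mult_right_mono)
    also have "\<dots> = 5 / 12 * real p" using p by (simp add: power2_eq_square field_simps)
    finally show ?thesis using P p unfolding D_def by (simp add: of_nat_diff mult.assoc)
  qed
  finally show ?thesis using ip phin P by auto
qed

lemma sum_norm_phi_middle_le:
  assumes p: "3 \<le> p" "odd p" and y: "y \<le> 7 / 12 * real p - 1" and \<alpha>: "0 < \<alpha>" "\<alpha> \<le> y"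
    and le: "y - y\<^sup>2 / (2 * \<alpha>) + real p * real (p - 1) / (2 * \<alpha>) + (real p - 1) * \<alpha> / 2 \<le> real (p - 1) * lam"
  shows "(\<Sum>i<p. norm (missing_digit.phi (middle_digits p) (t + real i / real p))) \<le> lam"
proof -
  interpret missing_digit p "middle_digits p" by (rule missing_digit_middle[OF p(1)])
  have P: "P = p - 1" using p by (simp add: card_middle_digits)
  have "\<exists>i<p. y \<le> real P * norm (phi (t + real i / real p))"
    using norm_phi_middle_ge[OF p, of t] y unfolding P by (meson order_trans)
  from sum_norm_phi_le[OF this \<alpha>] le
  have "(\<Sum>i<p. real P * norm (phi (t + real i / real p))) \<le> real P * lam" by (simp add: P)
  then have "real P * (\<Sum>i<p. norm (phi (t + real i / real p))) \<le> real P * lam" by (simp add: sum_distrib_left)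
  then show ?thesis using P_pos by (simp only: mult_le_cancel_left_pos of_nat_0_less_iff)
qed

text \<open>Here y = 7/12 * 15 - 1, and \<alpha> is close to the optimum sqrt ((p * P - y^2) / (p -
  1)), the bound for the quadratic mean of the other terms. The point of 3.83 is that its square is
  below 15.\<close>

lemma sum_norm_phi_middle_15:
  "(\<Sum>i<15. norm (missing_digit.phi (middle_digits 15) (t + real i / real 15))) \<le> 3.83"
  by (rule sum_norm_phi_middle_le[where y = "31/4" and \<alpha> = "327/100"]) (simp_all add: power2_eq_square)

text \<open>A round \<open>y\<close> below 7/12 * p leaves enough room; the optimal \<alpha> would
  be about 2739. The value 2740 enters through 2740^2 * p < (p - 1)^2.\<close>

lemma sum_norm_phi_middle_large:
  "(\<Sum>i<10^7+1. norm (missing_digit.phi (middle_digits (10^7+1)) (t + real i / real (10^7+1)))) \<le> 2740"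
  by (rule sum_norm_phi_middle_le[where y = "5000000" and \<alpha> = "2700"]) (simp_all add: power2_eq_square)

subsection \<open>The divisor bound\<close>

text \<open>Splitting off the full power of a prime \<open>q\<close> multiplies the number of divisors by at most
  \<open>a + 1\<close>. This is at most \<open>q powr (a \<epsilon>)\<close> as soon as \<open>2 \<le> q powr \<epsilon>\<close>, so only finitely many
  primes cost more than that.\<close>

lemma card_divisors_prime_power_mult:
  fixes q m :: nat
  assumes q: "prime q" and m: "0 < m" "\<not> q dvd m"
  shows "card {d. d dvd q ^ a * m} \<le> (a + 1) * card {d. d dvd m}"
proof -
  have "{d. d dvd q ^ a * m} \<subseteq> (\<lambda>(i, d). q ^ i * d) ` ({..a} \<times> {d. d dvd m})"
  proof
    fix d assume "d \<in> {d. d dvd q ^ a * m}"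
    then obtain u v where uv: "d = u * v" "u dvd q ^ a" "v dvd m"
      using division_decomp by blast
    obtain i where "i \<le> a" "u = q ^ i"
      using uv(2) divides_primepow_nat[OF q] by blast
    then show "d \<in> (\<lambda>(i, d). q ^ i * d) ` ({..a} \<times> {d. d dvd m})" using uv by auto
  qed
  moreover have fin: "finite {d. d dvd m}" using m by simp
  ultimately have "card {d. d dvd q ^ a * m} \<le> card ((\<lambda>(i, d). q ^ i * d) ` ({..a} \<times> {d. d dvd m}))"
    by (intro card_mono) auto
  also have "\<dots> \<le> card ({..a} \<times> {d. d dvd m})" by (intro card_image_le) (use fin in auto)
  finally show ?thesis by (simp add: card_cartesian_product)
qed

lemma Suc_le_powr_bound:
  fixes \<epsilon> :: real
  assumes "0 < \<epsilon>"
  obtains C where "1 \<le> C" "\<And>a::nat. real a + 1 \<le> C * 2 powr (a * \<epsilon>)"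
proof -
  define C where "C = 1 + 1 / (\<epsilon> * ln 2)"
  have C1: "1 \<le> C" using assms by (simp add: C_def)
  have "real a + 1 \<le> C * 2 powr (a * \<epsilon>)" for a :: nat
  proof -
    have "1 + real a * \<epsilon> * ln 2 \<le> exp (real a * \<epsilon> * ln 2)" by (rule exp_ge_add_one_self)
    also have "\<dots> = 2 powr (a * \<epsilon>)" by (simp add: powr_def mult_ac)
    finally have e: "1 + real a * \<epsilon> * ln 2 \<le> 2 powr (a * \<epsilon>)" .
    have "real a + 1 \<le> C * (1 + real a * \<epsilon> * ln 2)"
    proof -
      have "1 / (\<epsilon> * ln 2) * (real a * \<epsilon> * ln 2) = real a" using assms by simp
      moreover have "0 \<le> real a * \<epsilon> * ln 2" "0 \<le> 1 / (\<epsilon> * ln 2)" using assms by simp_all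
      ultimately show ?thesis unfolding C_def distrib_right distrib_left by linarith
    qed
    also have "\<dots> \<le> C * 2 powr (a * \<epsilon>)" using e C1 by (intro mult_left_mono) auto
    finally show ?thesis .
  qed
  with C1 that show thesis by blast
qed

lemma card_divisors_le:
  fixes \<epsilon> :: real
  assumes eps: "0 < \<epsilon>"
  shows "\<exists>C\<ge>1. \<forall>n\<ge>1. real (card {d. d dvd n}) \<le> C * real n powr \<epsilon>"
proof -
  obtain C where C: "1 \<le> C" "\<And>a::nat. real a + 1 \<le> C * 2 powr (a * \<epsilon>)"
    using Suc_le_powr_bound[OF eps] by blast
  define B where "B = nat \<lceil>2 powr (1 / \<epsilon>)\<rceil>"
  have B: "2 \<le> real q powr \<epsilon>" if "B \<le> q" for q :: nat
  proof -
    have "2 powr (1 / \<epsilon>) \<le> real q" using that unfolding B_def by linarith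
    then have "(2 powr (1 / \<epsilon>)) powr \<epsilon> \<le> real q powr \<epsilon>" using eps by (intro powr_mono2) auto
    then show ?thesis using eps by (simp add: powr_powr)
  qed
  \<comment> \<open>Only prime divisors below \<open>B\<close> are charged a factor \<open>C\<close>
    in the induction, and their number is at most \<open>B\<close> whatever \<open>n\<close>
    is.\<close>
  define S where "S n = {q. prime q \<and> q dvd n \<and> q < B}" for n :: nat
  have "real (card {d. d dvd n}) \<le> C ^ card (S n) * real n powr \<epsilon>" if "1 \<le> n" for n
    using that
  proof (induction n rule: less_induct)
    case (less n)
    show ?case
    proof (cases "n = 1")
      case True
      then show ?thesis using one_le_power[OF C(1)] by simp
    next
      case False
      then obtain q where q: "prime q" "q dvd n" using prime_factor_nat by blast
      define a where "a = multiplicity q n"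
      obtain m where m: "n = q ^ a * m" "\<not> q dvd m"
        using multiplicity_decompose'[of n q] less.prems q by (metis a_def not_prime_unit not_one_le_zero)
      have m0: "0 < m" using m less.prems by (cases "m = 0") auto
      have a0: "0 < a" using m q(2) by (cases a) auto
      have qa: "1 < q ^ a" using a0 q(1) prime_gt_1_nat one_less_power by blast
      have mn: "m < n" using m qa m0 by simp
      have IH: "real (card {d. d dvd m}) \<le> C ^ card (S m) * real m powr \<epsilon>"
        using less.IH[OF mn] m0 by simp
      have q0: "0 < real q" using prime_gt_0_nat[OF q(1)] by simp
      have q_powr: "(real q ^ a) powr \<epsilon> = real q powr (a * \<epsilon>)"
        unfolding powr_realpow[OF q0, symmetric] by (rule powr_powr)
      have rn: "real n = real q ^ a * real m"
        unfolding of_nat_power[symmetric] of_nat_mult[symmetric] by (rule arg_cong[OF m(1)])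
      have n_powr: "real n powr \<epsilon> = real q powr (a * \<epsilon>) * real m powr \<epsilon>"
        unfolding rn q_powr[symmetric] by (rule powr_mult)
      have finS: "finite (S n)" by (rule finite_subset[of _ "{..<B}"]) (auto simp: S_def)
      have "real (card {d. d dvd n}) \<le> (real a + 1) * real (card {d. d dvd m})"
      proof -
        have "card {d. d dvd n} \<le> (a + 1) * card {d. d dvd m}"
          using card_divisors_prime_power_mult[OF q(1) m0 m(2), of a] unfolding m(1)[symmetric] .
        then have "real (card {d. d dvd n}) \<le> real ((a + 1) * card {d. d dvd m})" by (rule of_nat_mono)
        then show ?thesis by (simp only: of_nat_mult of_nat_add of_nat_1)
      qed
      also have "\<dots> \<le> (real a + 1) * (C ^ card (S m) * real m powr \<epsilon>)"
        using IH by (intro mult_left_mono) auto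
      also have "\<dots> \<le> C ^ card (S n) * real n powr \<epsilon>"
      proof (cases "q < B")
        case True
        have "S m \<subseteq> S n - {q}" using m by (auto simp: S_def)
        then have "card (S m) \<le> card (S n - {q})" using finS by (intro card_mono) auto
        moreover have "q \<in> S n" using q True by (simp add: S_def)
        ultimately have "Suc (card (S m)) \<le> card (S n)" using finS
          by (metis Suc_le_mono card.remove)
        then have CC: "C * C ^ card (S m) \<le> C ^ card (S n)"
          using power_increasing[of "Suc (card (S m))" "card (S n)" C] C(1) by simp
        have "real a + 1 \<le> C * real q powr (a * \<epsilon>)"
        proof -
          have "2 powr (a * \<epsilon>) \<le> real q powr (a * \<epsilon>)"
            using eps prime_ge_2_nat[OF q(1)] by (intro powr_mono2) auto
          then have "C * 2 powr (a * \<epsilon>) \<le> C * real q powr (a * \<epsilon>)" using C(1) by (intro mult_left_mono) auto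
          then show ?thesis using C(2)[of a] by linarith
        qed
        then have "(real a + 1) * (C ^ card (S m) * real m powr \<epsilon>) \<le> C * real q powr (a * \<epsilon>) * (C ^ card (S m) * real m powr \<epsilon>)"
          using C(1) by (intro mult_right_mono) auto
        also have "\<dots> = C * C ^ card (S m) * real n powr \<epsilon>" unfolding n_powr by (simp only: mult_ac)
        also have "\<dots> \<le> C ^ card (S n) * real n powr \<epsilon>" by (intro mult_right_mono CC) auto
        finally show ?thesis .
      next
        case False
        have "S m \<subseteq> S n" using m by (auto simp: S_def)
        then have CC: "C ^ card (S m) \<le> C ^ card (S n)"
          using finS C(1) by (intro power_increasing card_mono) auto
        have "real (Suc a) \<le> real (2 ^ a)" by (intro of_nat_mono Suc_leI less_exp)
        then have "real a + 1 \<le> 2 ^ a" by simp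
        also have "\<dots> \<le> (real q powr \<epsilon>) ^ a" using B[of q] False by (intro power_mono) auto
        also have "\<dots> = real q powr (a * \<epsilon>)"
          using powr_realpow[of "real q powr \<epsilon>" a] q0 powr_powr[of "real q" \<epsilon> "real a"] by (simp add: mult.commute)
        finally have "(real a + 1) * (C ^ card (S m) * real m powr \<epsilon>) \<le> real q powr (a * \<epsilon>) * (C ^ card (S n) * real m powr \<epsilon>)"
          using CC C(1) by (intro mult_mono mult_right_mono) auto
        then show ?thesis unfolding n_powr by (simp only: mult_ac)
      qed
      finally show ?thesis .
    qed
  qed
  moreover have "C ^ card (S n) \<le> C ^ B" for n
  proof -
    have "card (S n) \<le> card {..<B}" by (intro card_mono) (auto simp: S_def)
    then show ?thesis using C(1) by (intro power_increasing) auto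
  qed
  ultimately have "real (card {d. d dvd n}) \<le> C ^ B * real n powr \<epsilon>" if "1 \<le> n" for n
    using that by (meson mult_right_mono order_trans powr_ge_zero)
  then show ?thesis using one_le_power[OF C(1), of B] by blast
qed

subsection \<open>Counting points near fractions by trigonometric polynomials\<close>

context missing_digit
begin

text \<open>A bound for all nonconstant Fourier terms of a block of denominators inside a cylinder
  of level \<open>k\<close>. The word of the cylinder does not enter, since it changes only
  phases.\<close>

definition Err :: "nat \<Rightarrow> nat \<Rightarrow> nat \<Rightarrow> real" where
  "Err k Q H = (\<Sum>q\<in>{Q..<2*Q}. \<Sum>h\<in>{1..H}. norm (G (real (h * q) / real p ^ k)))"

lemma Err_nonneg: "0 \<le> Err k Q H"
  unfolding Err_def by (intro sum_nonneg) auto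

text \<open>Sort the pairs (q, h) by their product \<xi>: the denominator q is a divisor of \<xi>
  and determines h.\<close>

lemma Err_le_divisor_sum:
  assumes "1 \<le> Q"
  shows "Err k Q H \<le> (\<Sum>\<xi>\<in>{1..2*Q*H}. real (card {d. d dvd \<xi>}) * norm (G (real \<xi> / real p ^ k)))"
proof -
  define S where "S = {Q..<2*Q} \<times> {1..H}"
  define f where "f \<xi> = norm (G (real \<xi> / real p ^ k))" for \<xi> :: nat
  have "Err k Q H = (\<Sum>x\<in>S. f (snd x * fst x))"
    unfolding Err_def S_def f_def by (simp add: sum.cartesian_product case_prod_beta)
  also have "\<dots> = (\<Sum>\<xi>\<in>{1..2*Q*H}. \<Sum>x\<in>{x\<in>S. snd x * fst x = \<xi>}. f (snd x * fst x))"
  proof (rule sum.group[symmetric])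
    show "(\<lambda>x. snd x * fst x) ` S \<subseteq> {1..2 * Q * H}"
    proof
      fix \<xi> assume "\<xi> \<in> (\<lambda>x. snd x * fst x) ` S"
      then obtain q h where qh: "\<xi> = h * q" "Q \<le> q" "q < 2 * Q" "1 \<le> h" "h \<le> H" by (auto simp: S_def)
      have "h * q \<le> H * (2 * Q)" using qh by (intro mult_le_mono) auto
      moreover have "1 \<le> h * q" using qh assms by (simp add: Suc_le_eq)
      ultimately show "\<xi> \<in> {1..2 * Q * H}" using qh(1) by (simp add: mult_ac)
    qed
  qed (auto simp: S_def)
  also have "\<dots> \<le> (\<Sum>\<xi>\<in>{1..2*Q*H}. real (card {d. d dvd \<xi>}) * f \<xi>)"
  proof (rule sum_mono)
    fix \<xi> assume \<xi>: "\<xi> \<in> {1..2*Q*H}"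
    let ?T = "{x\<in>S. snd x * fst x = \<xi>}"
    have "card ?T \<le> card {d. d dvd \<xi>}"
    proof (rule card_inj_on_le[where f = fst])
      show "inj_on fst ?T"
      proof (rule inj_onI)
        fix x y assume xy: "x \<in> ?T" "y \<in> ?T" "fst x = fst y"
        have "fst x \<noteq> 0" using xy(1) assms by (auto simp: S_def)
        then have "snd x = snd y" using xy by auto
        then show "x = y" using xy(3) by (simp add: prod_eq_iff)
      qed
      show "fst ` ?T \<subseteq> {d. d dvd \<xi>}" by auto
      show "finite {d. d dvd \<xi>}" using \<xi> by simp
    qed
    moreover have "(\<Sum>x\<in>?T. f (snd x * fst x)) = real (card ?T) * f \<xi>"
      by simp
    ultimately show "(\<Sum>x\<in>?T. f (snd x * fst x)) \<le> real (card {d. d dvd \<xi>}) * f \<xi>"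
      by (simp add: f_def mult_right_mono)
  qed
  finally show ?thesis by (simp add: f_def)
qed

text \<open>The frequencies up to 2 * Q * H are extended to a full range of \<open>k + n + 1\<close>
  digits, where p^n \<le> 2 * Q * H. Of these, \<open>n + 1\<close> give
  \<open>lam ^ (n + 1)\<close>, of order (Q * H) powr \<tau>; the other \<open>k\<close> bring no
  saving and cost \<open>p ^ k\<close>. The gap between \<tau> and \<tau>' pays for the divisor
  bound.\<close>

lemma Err_bound:
  assumes lam: "\<And>t. (\<Sum>i<p. norm (phi (t + real i / real p))) \<le> lam"
    and lam_\<tau>: "lam \<le> real p powr \<tau>" and \<tau>: "0 \<le> \<tau>" "\<tau> < \<tau>'"
  shows "\<exists>C>0. \<forall>k Q H. 1 \<le> Q \<longrightarrow> 1 \<le> H \<longrightarrow> Err k Q H \<le> C * real p ^ k * (real Q * real H) powr \<tau>'"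
proof -
  define \<epsilon> where "\<epsilon> = \<tau>' - \<tau>"
  have \<epsilon>: "0 < \<epsilon>" using \<tau> by (simp add: \<epsilon>_def)
  obtain C where C: "1 \<le> C" "\<And>n. 1 \<le> n \<Longrightarrow> real (card {d. d dvd n}) \<le> C * real n powr \<epsilon>"
    using card_divisors_le[OF \<epsilon>] by blast
  have lam0: "0 \<le> lam"
  proof -
    have "0 \<le> (\<Sum>i<p. norm (phi (0 + real i / real p)))" by (intro sum_nonneg) auto
    then show "0 \<le> lam" using lam[of 0] by linarith
  qed
  have main: "Err k Q H \<le> (C * (lam + 1) * 2 powr \<tau>') * real p ^ k * (real Q * real H) powr \<tau>'"
    if Q: "1 \<le> Q" and H: "1 \<le> H" for k Q H
  proof -
    define N where "N = 2 * Q * H"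
    have N1: "1 \<le> N" using Q H by (simp add: N_def)
    then obtain n where n: "p ^ n \<le> N" "N < p ^ (n + 1)" using ex_power_ivl1[OF p2, of N] by blast
    have "N < p ^ (k + (n + 1))"
    proof -
      have "p ^ (n + 1) \<le> p ^ (k + (n + 1))" using p2 by (intro power_increasing) auto
      then show ?thesis using n(2) by linarith
    qed
    then have sub: "{1..N} \<subseteq> {..<p ^ (k + (n + 1))}" by auto
    have lam_n: "lam ^ (n + 1) \<le> (lam + 1) * real N powr \<tau>"
    proof -
      have "lam ^ n \<le> (real p powr \<tau>) ^ n" using lam_\<tau> lam0 by (rule power_mono)
      also have "\<dots> = (real p ^ n) powr \<tau>"
        using p_pos by (simp add: powr_powr powr_realpow[symmetric] powr_power mult.commute)
      also have "\<dots> \<le> real N powr \<tau>"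
        using n(1) \<tau>(1) by (intro powr_mono2) (auto simp flip: of_nat_power)
      finally have "lam ^ n \<le> real N powr \<tau>" .
      then have "lam * lam ^ n \<le> (lam + 1) * real N powr \<tau>" using lam0 by (intro mult_mono) auto
      then show ?thesis by simp
    qed
    have "Err k Q H \<le> (\<Sum>\<xi>\<in>{1..N}. real (card {d. d dvd \<xi>}) * norm (G (real \<xi> / real p ^ k)))"
      unfolding N_def by (rule Err_le_divisor_sum[OF Q])
    also have "\<dots> \<le> (\<Sum>\<xi>\<in>{1..N}. C * real N powr \<epsilon> * norm (G (real \<xi> / real p ^ k)))"
    proof (intro sum_mono mult_right_mono)
      fix \<xi> assume \<xi>: "\<xi> \<in> {1..N}"
      have "real \<xi> powr \<epsilon> \<le> real N powr \<epsilon>" using \<xi> \<epsilon> by (intro powr_mono2) auto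
      then have "C * real \<xi> powr \<epsilon> \<le> C * real N powr \<epsilon>" using C(1) by (intro mult_left_mono) auto
      then show "real (card {d. d dvd \<xi>}) \<le> C * real N powr \<epsilon>" using C(2)[of \<xi>] \<xi> by auto
    qed auto
    also have "\<dots> = C * real N powr \<epsilon> * (\<Sum>\<xi>\<in>{1..N}. norm (G (real \<xi> / real p ^ k)))"
      by (rule sum_distrib_left[symmetric])
    also have "\<dots> \<le> C * real N powr \<epsilon> * (\<Sum>\<xi><p ^ (k + (n + 1)). norm (G (real \<xi> / real p ^ k)))"
      using C(1) sub by (intro mult_left_mono sum_mono2) auto
    also have "\<dots> \<le> C * real N powr \<epsilon> * (real p ^ k * lam ^ (n + 1))"
      using C(1) by (intro mult_left_mono sum_norm_G_le lam) auto
    also have "\<dots> \<le> C * real N powr \<epsilon> * (real p ^ k * ((lam + 1) * real N powr \<tau>))"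
      using C(1) by (intro mult_left_mono lam_n) auto
    also have "\<dots>
      = C * (lam + 1) * real p ^ k * (real N powr \<epsilon> * real N powr \<tau>)" by (simp only: mult_ac)
    also have "real N powr \<epsilon> * real N powr \<tau> = real N powr \<tau>'"
      unfolding powr_add[symmetric] \<epsilon>_def by simp
    also have "real N powr \<tau>' = 2 powr \<tau>' * (real Q * real H) powr \<tau>'"
      unfolding N_def by (simp add: powr_mult mult.assoc)
    finally show ?thesis using C(1) lam0 by (simp add: mult_ac)
  qed
  show ?thesis
    by (rule exI[of _ "C * (lam + 1) * 2 powr \<tau>'"]) (use main C(1) lam0 in auto)
qed

end

section \<open>Distance to the integers and squared trigonometric sums\<close>

lemma infdist_Ints: "infdist y \<int> = \<bar>y - of_int (round y)\<bar>" for y :: real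
proof (rule antisym)
  show "infdist y \<int> \<le> \<bar>y - of_int (round y)\<bar>"
    using infdist_le[of "of_int (round y)" "\<int>" y] by (simp add: dist_real_def)
  have "\<bar>y - of_int (round y)\<bar> \<le> (INF a\<in>\<int>. dist y a)"
  proof (rule cINF_greatest)
    fix a :: real assume "a \<in> \<int>"
    then obtain n where "a = of_int n" by (elim Ints_cases)
    then show "\<bar>y - of_int (round y)\<bar> \<le> dist y a"
      using round_diff_minimal[of y n] by (simp add: dist_real_def)
  qed auto
  then show "\<bar>y - of_int (round y)\<bar> \<le> infdist y \<int>"
    using infdist_notempty[of \<int> y] Ints_0 by (metis empty_iff)
qed

lemma infdist_Ints_le_iff: "infdist y \<int> \<le> \<epsilon> \<longleftrightarrow> (\<exists>n::int. \<bar>y - of_int n\<bar> \<le> \<epsilon>)" for y :: real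
  unfolding infdist_Ints using round_diff_minimal[of y] order_trans by blast

lemma infdist_Ints_le_half: "infdist y \<int> \<le> 1 / 2" for y :: real
  unfolding infdist_Ints using of_int_round_abs_le[of y] by linarith

lemma cos_2pi_infdist: "cos (2 * pi * y) = cos (2 * pi * infdist y \<int>)"
proof -
  have "cos (2 * pi * y) = cos (2 * pi * (y - of_int (round y)))"
    using cis_2pi_add_int[of "y - of_int (round y)" "round y"] by (simp add: complex_eq_iff)
  also have "\<dots> = cos (2 * pi * \<bar>y - of_int (round y)\<bar>)"
    using cos_abs_real[of "2 * pi * (y - of_int (round y))"] by (simp add: abs_mult)
  finally show ?thesis by (simp add: infdist_Ints)
qed

lemma sin_ge_half: "0 \<le> x \<Longrightarrow> x \<le> pi / 2 \<Longrightarrow> x / 2 \<le> sin (x::real)"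
proof -
  assume x: "0 \<le> x" "x \<le> pi / 2"
  have "\<bar>sin x - (\<Sum>m<3. sin_coeff m * x ^ m)\<bar> \<le> inverse (fact 3) * \<bar>x\<bar> ^ 3"
    by (rule Maclaurin_sin_bound)
  then have "\<bar>sin x - x\<bar> \<le> x ^ 3 / 6"
    using x by (simp add: sin_coeff_def eval_nat_numeral fact_numeral)
  moreover have "x ^ 3 / 6 \<le> x / 2"
  proof -
    have "x\<^sup>2 \<le> (pi / 2)\<^sup>2" using x by (intro power_mono) auto
    then have "x\<^sup>2 \<le> 3" using pi_squared_le by (simp add: power_divide)
    then have "x * x\<^sup>2 \<le> x * 3" using x by (intro mult_left_mono) auto
    then show ?thesis by (simp add: eval_nat_numeral)
  qed
  ultimately show ?thesis by linarith
qed

text \<open>Squared norms of such sums serve as nonnegative kernels: constant weights give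
  \<open>J\<close> times the Fejer kernel, sine weights the kernel behind the lower bound.\<close>

definition trig_sum :: "(nat \<Rightarrow> real) \<Rightarrow> nat \<Rightarrow> real \<Rightarrow> complex" where
  "trig_sum b J y = (\<Sum>j<J. of_real (b j) * cis (2 * pi * (real j * y)))"

lemma norm_trig_sum_squared:
  "(norm (trig_sum b J y))\<^sup>2 = (\<Sum>i<J. \<Sum>j<J. b i * b j * cos (2 * pi * ((real i - real j) * y)))"
proof -
  have "of_real ((norm (trig_sum b J y))\<^sup>2) = trig_sum b J y * cnj (trig_sum b J y)"
    by (rule complex_norm_square)
  also have "\<dots> = (\<Sum>i<J. \<Sum>j<J. of_real (b i * b j) * cis (2 * pi * ((real i - real j) * y)))"
    unfolding trig_sum_def cnj_sum sum_product
  proof (intro sum.cong refl)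
    fix i j
    have "cis (2 * pi * (real i * y)) * cnj (cis (2 * pi * (real j * y))) = cis (2 * pi * ((real i - real j) * y))"
      by (simp add: cis_cnj cis_mult algebra_simps)
    then show "of_real (b i) * cis (2 * pi * (real i * y)) * cnj (of_real (b j) * cis (2 * pi * (real j * y)))
      = of_real (b i * b j) * cis (2 * pi * ((real i - real j) * y))"
      by (simp add: mult_ac)
  qed
  finally have "Re (of_real ((norm (trig_sum b J y))\<^sup>2)) = Re (\<Sum>i<J. \<Sum>j<J. of_real (b i * b j) * cis (2 * pi * ((real i - real j) * y)))"
    by (rule arg_cong)
  then show ?thesis by simp
qed

lemma norm_trig_sum_squared_le:
  "(norm (trig_sum b J y))\<^sup>2 \<le> real J * (\<Sum>j<J. (b j)\<^sup>2)"
proof -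
  have "norm (trig_sum b J y) \<le> (\<Sum>j<J. \<bar>b j\<bar>)"
    unfolding trig_sum_def by (rule order_trans[OF norm_sum]) (simp add: norm_mult)
  then have "(norm (trig_sum b J y))\<^sup>2 \<le> (\<Sum>j<J. \<bar>b j\<bar>)\<^sup>2" by (intro power_mono) auto
  also have "\<dots> \<le> (\<Sum>j<J. \<bar>b j\<bar>\<^sup>2) * card {..<J}" by (rule sum_squared_le_sum_of_squares)
  finally show ?thesis by (simp add: mult.commute)
qed

lemma sum_abs_diff_le:
  fixes g :: "nat \<Rightarrow> real"
  assumes g: "\<And>h. 0 \<le> g h" and i: "i < J"
  shows "(\<Sum>j\<in>{..<J} - {i}. g (if j < i then i - j else j - i)) \<le> 2 * (\<Sum>h\<in>{1..J}. g h)"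
proof -
  have split: "{..<J} - {i} = {..<i} \<union> {i<..<J}" using i by auto
  have "(\<Sum>j\<in>{..<J} - {i}. g (if j < i then i - j else j - i)) = (\<Sum>j<i. g (i - j)) + (\<Sum>j\<in>{i<..<J}. g (j - i))"
    unfolding split by (subst sum.union_disjoint) auto
  moreover have "(\<Sum>j<i. g (i - j)) = (\<Sum>h\<in>(\<lambda>j. i - j) ` {..<i}. g h)"
    by (subst sum.reindex) (auto simp: inj_on_def)
  moreover have "(\<Sum>h\<in>(\<lambda>j. i - j) ` {..<i}. g h) \<le> (\<Sum>h\<in>{1..J}. g h)"
    using g i by (intro sum_mono2) auto
  moreover have "(\<Sum>j\<in>{i<..<J}. g (j - i)) = (\<Sum>h\<in>(\<lambda>j. j - i) ` {i<..<J}. g h)"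
    by (subst sum.reindex) (auto simp: inj_on_def)
  moreover have "(\<Sum>h\<in>(\<lambda>j. j - i) ` {i<..<J}. g h) \<le> (\<Sum>h\<in>{1..J}. g h)"
    using g i by (intro sum_mono2) auto
  ultimately show ?thesis by linarith
qed

context missing_digit
begin

lemma integral_cos_nat_le:
  "\<bar>\<integral>x. cos (2 * pi * (real h * (real q * x))) \<partial>cm k w\<bar> \<le> norm (G (real (h * q) / real p ^ k))"
  using abs_integral_cm_cos_le[where \<theta> = "real (h * q)" and k = k and w = w] by (simp add: mult.assoc)

lemma integrable_cm_bounded:
  fixes f :: "real \<Rightarrow> real"
  assumes "f \<in> borel_measurable borel" "\<And>x. \<bar>f x\<bar> \<le> B"
  shows "integrable (cm k w) f"
proof -
  interpret prob_space "cm k w" by (rule prob_cm)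
  show ?thesis by (rule integrable_const_bound[where B = B]) (use assms in auto)
qed

lemma integrable_cm_cos [simp]: "integrable (cm k w) (\<lambda>x. cos (2 * pi * (r * (s * x))))"
  by (rule integrable_cm_bounded[where B = 1]) auto

text \<open>The main term is the diagonal of the double sum. Off the diagonal each difference h of
  indices occurs at most 2 * J times, with a coefficient bounded through \<open>G\<close>.\<close>

lemma integral_norm_trig_sum_squared:
  assumes b: "\<And>j. \<bar>b j\<bar> \<le> 1"
  shows "\<bar>(\<integral>x. (norm (trig_sum b J (real q * x)))\<^sup>2 \<partial>cm k w) - (\<Sum>j<J. (b j)\<^sup>2)\<bar>
    \<le> 2 * real J * (\<Sum>h\<in>{1..J}. norm (G (real (h * q) / real p ^ k)))"
proof -
  interpret prob_space "cm k w" by (rule prob_cm)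
  define g where "g h = norm (G (real (h * q) / real p ^ k))" for h
  define I where "I i j = b i * b j * (\<integral>x. cos (2 * pi * ((real i - real j) * (real q * x))) \<partial>cm k w)" for i j
  have "(\<integral>x. (norm (trig_sum b J (real q * x)))\<^sup>2 \<partial>cm k w) = (\<Sum>i<J. \<Sum>j<J. I i j)"
    unfolding norm_trig_sum_squared I_def by (simp add: Bochner_Integration.integral_sum)
  also have "\<dots> = (\<Sum>i<J. I i i + (\<Sum>j\<in>{..<J} - {i}. I i j))"
    by (intro sum.cong refl) (simp add: sum.remove)
  also have "\<dots> = (\<Sum>j<J. (b j)\<^sup>2) + (\<Sum>i<J. \<Sum>j\<in>{..<J} - {i}. I i j)"
    using prob_space by (simp add: sum.distrib I_def power2_eq_square)
  finally have "\<bar>(\<integral>x. (norm (trig_sum b J (real q * x)))\<^sup>2 \<partial>cm k w) - (\<Sum>j<J. (b j)\<^sup>2)\<bar>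
    = \<bar>\<Sum>i<J. \<Sum>j\<in>{..<J} - {i}. I i j\<bar>" by simp
  also have "\<dots> \<le> (\<Sum>i<J. \<Sum>j\<in>{..<J} - {i}. \<bar>I i j\<bar>)"
    by (intro order_trans[OF sum_abs] sum_mono sum_abs)
  also have "\<dots> \<le> (\<Sum>i<J. 2 * (\<Sum>h\<in>{1..J}. g h))"
  proof (rule sum_mono)
    fix i assume i: "i \<in> {..<J}"
    have "\<bar>I i j\<bar> \<le> g (if j < i then i - j else j - i)" for j
    proof -
      have "\<bar>b i * b j\<bar> \<le> 1" unfolding abs_mult using b mult_mono[of "\<bar>b i\<bar>" 1 "\<bar>b j\<bar>" 1] by simp
      then have "\<bar>I i j\<bar> \<le> 1 * \<bar>\<integral>x. cos (2 * pi * ((real i - real j) * (real q * x))) \<partial>cm k w\<bar>"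
        unfolding I_def abs_mult[of "b i * b j"] by (intro mult_right_mono) auto
      also have "\<dots> \<le> g (if j < i then i - j else j - i)"
      proof (cases "j < i")
        case True
        then show ?thesis using integral_cos_nat_le[where h = "i - j" and q = q and k = k and w = w]
          by (simp add: g_def of_nat_diff)
      next
        case False
        then have "cos (2 * pi * ((real i - real j) * (real q * x))) = cos (2 * pi * (real (j - i) * (real q * x)))" for x
          using cos_minus[of "2 * pi * ((real i - real j) * (real q * x))"] by (simp add: of_nat_diff algebra_simps)
        then show ?thesis using False integral_cos_nat_le[where h = "j - i" and q = q and k = k and w = w]
          by (simp add: g_def)
      qed
      finally show ?thesis .
    qed
    then have "(\<Sum>j\<in>{..<J} - {i}. \<bar>I i j\<bar>) \<le> (\<Sum>j\<in>{..<J} - {i}. g (if j < i then i - j else j - i))"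
      by (intro sum_mono)
    also have "\<dots> \<le> 2 * (\<Sum>h\<in>{1..J}. g h)" using i by (intro sum_abs_diff_le) (auto simp: g_def)
    finally show "(\<Sum>j\<in>{..<J} - {i}. \<bar>I i j\<bar>) \<le> 2 * (\<Sum>h\<in>{1..J}. g h)" .
  qed
  finally show ?thesis by (simp add: g_def)
qed

definition near :: "nat \<Rightarrow> real \<Rightarrow> real set" where
  "near q \<epsilon> = {x. infdist (real q * x) \<int> \<le> \<epsilon>}"

lemma closed_near: "closed (near q \<epsilon>)"
  unfolding near_def by (intro closed_Collect_le continuous_intros)

lemma near_borel [measurable, simp]: "near q \<epsilon> \<in> sets borel"
  by (simp add: closed_near borel_closed)

lemma near_mono: "\<epsilon> \<le> \<epsilon>' \<Longrightarrow> near q \<epsilon> \<subseteq> near q \<epsilon>'"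
  by (auto simp: near_def)

lemma measurable_trig [measurable]: "(\<lambda>x. (norm (trig_sum b J (real q * x)))\<^sup>2) \<in> borel_measurable borel"
  unfolding norm_trig_sum_squared by measurable

lemma abs_norm_trig_sum_squared_le: "\<bar>(norm (trig_sum b J y))\<^sup>2\<bar> \<le> real J * (\<Sum>j<J. (b j)\<^sup>2)"
  using norm_trig_sum_squared_le by simp

lemma integrable_trig [simp]: "integrable (cm k w) (\<lambda>x. (norm (trig_sum b J (real q * x)))\<^sup>2)"
  by (rule integrable_cm_bounded[OF measurable_trig abs_norm_trig_sum_squared_le])

text \<open>The Fejer kernel as a majorant: if q * x is within 1 / (8 * H) of an integer, all
  \<open>H\<close> phases lie within pi / 4 of 0. Each cosine is then at least 1 - (pi / 4)^2 / 2
  \<ge> 2/3, and the kernel at least 4/9 * H^2. The constants 3 and 5 are 9/4 and 9/2 rounded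
  up.\<close>

lemma sum_measure_near_le:
  assumes H: "1 \<le> H"
  shows "(\<Sum>q\<in>{Q..<2*Q}. measure (cm k w) (near q (1 / (8 * real H)))) \<le> (3 * real Q + 5 * Err k Q H) / real H"
proof -
  interpret prob_space "cm k w" by (rule prob_cm)
  let ?K = "\<lambda>q x. (norm (trig_sum (\<lambda>_. 1) H (real q * x)))\<^sup>2"
  have one: "measure (cm k w) (near q (1 / (8 * real H)))
     \<le> 9 / 4 / (real H)\<^sup>2 * (real H + 2 * real H * (\<Sum>h\<in>{1..H}. norm (G (real (h * q) / real p ^ k))))" for q
  proof -
    have pt: "indicator (near q (1 / (8 * real H))) x \<le> 9 / 4 / (real H)\<^sup>2 * ?K q x" for x
    proof (cases "x \<in> near q (1 / (8 * real H))")
      case True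
      define y where "y = real q * x"
      obtain n :: int where n: "\<bar>y - of_int n\<bar> \<le> 1 / (8 * real H)"
        using True infdist_Ints_le_iff by (auto simp: near_def y_def)
      have c: "2 / 3 \<le> cos (2 * pi * (real j * y))" if j: "j < H" for j
      proof -
        have "cos (2 * pi * (real j * y)) = cos (2 * pi * (real j * (y - of_int n)))"
          using cis_2pi_add_int[of "real j * (y - of_int n)" "int j * n"]
          by (simp add: complex_eq_iff algebra_simps)
        moreover have ab: "\<bar>2 * pi * (real j * (y - of_int n))\<bar> \<le> pi / 4"
        proof -
          have "real j * \<bar>y - of_int n\<bar> \<le> real H * (1 / (8 * real H))"
            using j n by (intro mult_mono) auto
          also have "\<dots> = 1 / 8" using H by simp
          finally have "2 * pi * (real j * \<bar>y - of_int n\<bar>) \<le> 2 * pi * (1 / 8)"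
            by (intro mult_left_mono) auto
          then show ?thesis by (simp add: abs_mult)
        qed
        moreover have "(2 * pi * (real j * (y - of_int n)))\<^sup>2 \<le> (pi / 4)\<^sup>2"
          using power_mono[OF ab, of 2] by (simp only: power2_abs abs_ge_zero)
        moreover have "1 - (2 * pi * (real j * (y - of_int n)))\<^sup>2 / 2 \<le> cos (2 * pi * (real j * (y - of_int n)))"
          by (rule cos_ge_quadratic)
        ultimately have "1 - (pi / 4)\<^sup>2 / 2 \<le> cos (2 * pi * (real j * y))"
          by linarith
        then show ?thesis using pi_squared_le by (simp add: power_divide)
      qed
      have "2 / 3 * real H = (\<Sum>j<H. 2 / 3)" by simp
      also have "\<dots> \<le> (\<Sum>j<H. cos (2 * pi * (real j * y)))" by (intro sum_mono c) auto
      also have "\<dots> = Re (trig_sum (\<lambda>_. 1) H y)" by (simp add: trig_sum_def)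
      also have "\<dots> \<le> norm (trig_sum (\<lambda>_. 1) H y)" by (rule complex_Re_le_cmod)
      finally have "(2 / 3 * real H)\<^sup>2 \<le> (norm (trig_sum (\<lambda>_. 1) H y))\<^sup>2" by (intro power_mono) auto
      then show ?thesis using True H by (simp add: y_def field_simps power2_eq_square)
    qed (use H in simp)
    have "measure (cm k w) (near q (1 / (8 * real H))) = (\<integral>x. indicator (near q (1 / (8 * real H))) x \<partial>cm k w)"
      by simp
    also have "\<dots> \<le> (\<integral>x. 9 / 4 / (real H)\<^sup>2 * ?K q x \<partial>cm k w)"
      by (rule integral_mono[OF _ _ pt]) (auto simp: emeasure_eq_measure)
    also have "\<dots> = 9 / 4 / (real H)\<^sup>2 * (\<integral>x. ?K q x \<partial>cm k w)" by simp
    also have "\<dots> \<le> 9 / 4 / (real H)\<^sup>2 * (real H + 2 * real H * (\<Sum>h\<in>{1..H}. norm (G (real (h * q) / real p ^ k))))"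
      using integral_norm_trig_sum_squared[where b = "\<lambda>_. 1" and J = H and q = q and k = k and w = w] by (intro mult_left_mono) auto
    finally show ?thesis .
  qed
  have "(\<Sum>q\<in>{Q..<2*Q}. measure (cm k w) (near q (1 / (8 * real H))))
    \<le> (\<Sum>q\<in>{Q..<2*Q}. 9 / 4 / (real H)\<^sup>2 * (real H + 2 * real H * (\<Sum>h\<in>{1..H}. norm (G (real (h * q) / real p ^ k)))))"
    by (intro sum_mono one)
  also have "\<dots> = 9 / 4 / (real H)\<^sup>2 * (real Q * real H + 2 * real H * Err k Q H)"
    unfolding sum_distrib_left[symmetric] sum.distrib Err_def by simp
  also have "\<dots> = (9 / 4 * real Q + 9 / 2 * Err k Q H) / real H"
    using H by (simp add: field_simps power2_eq_square)
  also have "\<dots> \<le> (3 * real Q + 5 * Err k Q H) / real H"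
    using Err_nonneg[of k Q H] by (intro divide_right_mono) auto
  finally show ?thesis .
qed

end

text \<open>The weights \<open>sin ((j + 1) x)\<close> are eigenvectors of the second difference, so multiplying the
  trigonometric sum by \<open>2 cos \<theta> - 2 cos x\<close> leaves only boundary terms.\<close>

lemma sine_weighted_geometric_sum:
  fixes z :: complex
  shows "(z\<^sup>2 + 1 - 2 * of_real (cos x) * z) * (\<Sum>j<J. of_real (sin (real (Suc j) * x)) * z ^ j)
    = of_real (sin (real J * x)) * z ^ Suc J - of_real (sin (real (Suc J) * x)) * z ^ J + of_real (sin x)"
proof (induction J)
  case (Suc J)
  have rec: "sin (real (Suc (Suc J)) * x) = 2 * cos x * sin (real (Suc J) * x) - sin (real J * x)"
  proof -
    have "sin (real (Suc (Suc J)) * x) = sin (real (Suc J) * x + x)"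
      by (simp add: algebra_simps)
    moreover have "sin (real J * x) = sin (real (Suc J) * x - x)"
      by (simp add: algebra_simps)
    ultimately show ?thesis by (simp add: sin_add sin_diff)
  qed
  have "(z\<^sup>2 + 1 - 2 * of_real (cos x) * z) * (\<Sum>j<Suc J. of_real (sin (real (Suc j) * x)) * z ^ j)
    = of_real (sin (real J * x)) * z ^ Suc J - of_real (sin (real (Suc J) * x)) * z ^ J + of_real (sin x)
     + (z\<^sup>2 + 1 - 2 * of_real (cos x) * z) * (of_real (sin (real (Suc J) * x)) * z ^ J)"
    unfolding sum.lessThan_Suc distrib_left Suc ..
  also have "\<dots> = of_real (sin (real (Suc J) * x)) * z ^ Suc (Suc J) - of_real (sin (real (Suc (Suc J)) * x)) * z ^ Suc J + of_real (sin x)"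
    unfolding rec by (simp add: power2_eq_square algebra_simps)
  finally show ?case .
qed simp

text \<open>For x = pi / N and J = N - 1 the boundary values are sin (J * x) = sin x and sin (N * x)
  = 0, which leaves sin x * (z^N + 1). Multiplication by the conjugate of z makes the quadratic
  factor real, and multiplication by the conjugate of the sum produces the kernel.\<close>

lemma sine_kernel_identity:
  fixes N :: nat and y :: real
  assumes N: "2 \<le> N"
  defines "x \<equiv> pi / real N" and "J \<equiv> N - 1"
  defines "b \<equiv> (\<lambda>j. sin (real (Suc j) * x))"
  shows "(2 * cos (2 * pi * y) - 2 * cos x) * (norm (trig_sum b J y))\<^sup>2
    = sin x * (\<Sum>j<J. b j * (cos (2 * pi * (real (J - j) * y)) + cos (2 * pi * (real (Suc j) * y))))"
proof -
  define z where "z = cis (2 * pi * y)"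
  define S where "S = trig_sum b J y"
  have zj: "cis (2 * pi * (real j * y)) = z ^ j" for j
    unfolding z_def Complex.DeMoivre by (rule arg_cong[where f = cis]) simp
  have S: "S = (\<Sum>j<J. of_real (sin (real (Suc j) * x)) * z ^ j)"
    unfolding S_def trig_sum_def zj b_def ..
  have z0: "z \<noteq> 0" by (simp add: z_def)
  have SJ: "Suc J = N" using N by (simp add: J_def)
  have pi: "real (Suc J) * x = pi" using N unfolding SJ by (simp add: x_def)
  then have "real J * x = pi - x" by (simp add: algebra_simps)
  then have sJ: "sin (real J * x) = sin x" "sin (real (Suc J) * x) = 0" unfolding pi by simp_all
  have id: "(z\<^sup>2 + 1 - 2 * of_real (cos x) * z) * S = of_real (sin x) * (z ^ Suc J + 1)"
    using sine_weighted_geometric_sum[of z x J] unfolding S sJ by (simp add: distrib_left)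
  have zz: "z * cnj z = 1" by (simp add: z_def cis_cnj cis_mult)
  have c: "z + cnj z = of_real (2 * cos (2 * pi * y))" by (simp add: z_def complex_eq_iff)
  have "cnj z * ((z\<^sup>2 + 1 - 2 * of_real (cos x) * z) * S) = cnj z * (of_real (sin x) * (z ^ Suc J + 1))"
    unfolding id ..
  moreover have "cnj z * (z\<^sup>2 + 1 - 2 * of_real (cos x) * z) = z * (z * cnj z) + cnj z - 2 * of_real (cos x) * (z * cnj z)"
    by (simp add: algebra_simps power2_eq_square)
  moreover have "cnj z * (z ^ Suc J + 1) = z ^ J * (z * cnj z) + cnj z"
    by (simp add: algebra_simps)
  ultimately have "(z + cnj z - 2 * of_real (cos x)) * S = of_real (sin x) * (z ^ J + cnj z)"
    unfolding zz by (metis (no_types, lifting) mult.assoc mult.left_commute mult.right_neutral)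
  then have "of_real (2 * cos (2 * pi * y) - 2 * cos x) * S = of_real (sin x) * (z ^ J + cnj z)"
    unfolding c by simp
  then have "of_real (2 * cos (2 * pi * y) - 2 * cos x) * (S * cnj S) = of_real (sin x) * ((z ^ J + cnj z) * cnj S)"
    by (simp only: mult.assoc[symmetric])
  then have "Re (of_real (2 * cos (2 * pi * y) - 2 * cos x) * of_real ((norm S)\<^sup>2)) = Re (of_real (sin x) * ((z ^ J + cnj z) * cnj S))"
    unfolding complex_norm_square by (rule arg_cong)
  moreover have "Re (of_real r * w) = r * Re w" for r w by simp
  ultimately have eq: "(2 * cos (2 * pi * y) - 2 * cos x) * (norm S)\<^sup>2 = sin x * Re ((z ^ J + cnj z) * cnj S)"
    by (simp only: Re_complex_of_real)
  have "(z ^ J + cnj z) * cnj S = (\<Sum>j<J. of_real (b j) * ((z ^ J + cnj z) * cnj (z ^ j)))"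
    unfolding S_def trig_sum_def zj cnj_sum sum_distrib_left by (intro sum.cong refl) (simp add: mult_ac)
  then have "Re ((z ^ J + cnj z) * cnj S) = (\<Sum>j<J. b j * Re ((z ^ J + cnj z) * cnj (z ^ j)))"
    by simp
  also have "\<dots> = (\<Sum>j<J. b j * (cos (2 * pi * (real (J - j) * y)) + cos (2 * pi * (real (Suc j) * y))))"
  proof (intro sum.cong refl arg_cong[where f = "\<lambda>u. b _ * u"])
    fix j assume "j \<in> {..<J}"
    then have "z ^ J = z ^ (J - j) * z ^ j" by (simp flip: power_add)
    moreover have "z ^ j * cnj (z ^ j) = 1" unfolding z_def Complex.DeMoivre by (simp add: cis_cnj cis_mult)
    ultimately have "z ^ J * cnj (z ^ j) = z ^ (J - j)" by (simp add: mult.assoc)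
    then have "(z ^ J + cnj z) * cnj (z ^ j) = z ^ (J - j) + cnj (z ^ Suc j)" by (simp add: distrib_right)
    then show "Re ((z ^ J + cnj z) * cnj (z ^ j)) = cos (2 * pi * (real (J - j) * y)) + cos (2 * pi * (real (Suc j) * y))"
      unfolding zj[symmetric] by simp
  qed
  finally show ?thesis using eq by (simp only: S_def)
qed

lemma sum_sin_squared:
  assumes N: "2 \<le> N"
  shows "(\<Sum>j<N - 1. (sin (real (Suc j) * (pi / real N)))\<^sup>2) = real N / 2"
proof -
  have "(\<Sum>i<N. cis (2 * pi * (of_int 1 * real i / real N))) = 0"
    using N by (intro sum_cis_roots_of_unity) auto
  then have "Re (\<Sum>i<N. cis (2 * pi * (of_int 1 * real i / real N))) = 0" by simp
  then have c: "(\<Sum>i<N. cos (2 * (real i * (pi / real N)))) = 0" by (simp add: mult_ac)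
  have "(\<Sum>i<N. (sin (real i * (pi / real N)))\<^sup>2) = (\<Sum>i<N. 1 / 2 - cos (2 * (real i * (pi / real N))) / 2)"
    by (intro sum.cong refl) (simp only: cos_double_sin, simp add: field_simps)
  also have "\<dots> = real N / 2" using c by (simp add: sum_subtractf sum_divide_distrib[symmetric])
  finally have "(\<Sum>i<N. (sin (real i * (pi / real N)))\<^sup>2) = real N / 2" .
  moreover have "N = Suc (N - 1)" using N by simp
  ultimately show ?thesis using sum.lessThan_Suc_shift[of "\<lambda>i. (sin (real i * (pi / real N)))\<^sup>2" "N - 1"] by simp
qed

context missing_digit
begin

text \<open>The minorant is (cos (2 * pi * y) - cos (2 * x)) times the sine kernel, with x = pi / N:
  it is nonpositive once y is farther than 1 / N from the integers. By
  \<open>sine_kernel_identity\<close> the first cosine may be replaced by cos x up to a combination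
  of nonconstant cosines, whose integrals are error terms. The mean is therefore about (cos x - cos
  (2 * x)) * M0, which is positive.\<close>

lemma sum_measure_near_ge:
  assumes N: "2 \<le> N"
  shows "(\<Sum>q\<in>{Q..<2*Q}. measure (cm k w) (near q (1 / real N)))
    \<ge> real Q / (2 * real (N - 1)) - 6 * Err k Q (N - 1) / real (N - 1)"
proof -
  interpret prob_space "cm k w" by (rule prob_cm)
  define x where "x = pi / real N"
  define J where "J = N - 1"
  define b where "b = (\<lambda>j. sin (real (Suc j) * x))"
  define M0 where "M0 = (\<Sum>j<J. (b j)\<^sup>2)"
  define A where "A = cos x - cos (2 * x)"
  define B where "B = 1 - cos (2 * x)"
  define E where "E q = (\<Sum>h\<in>{1..J}. norm (G (real (h * q) / real p ^ k)))" for q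
  let ?S = "\<lambda>y. (norm (trig_sum b J y))\<^sup>2"
  have J1: "1 \<le> J" using N by (simp add: J_def)
  have M0: "M0 = real N / 2"
    using sum_sin_squared[OF N] by (simp add: M0_def b_def x_def J_def)
  have x0: "0 < x" "x \<le> pi / 2" using N by (auto simp: x_def field_simps)
  have s0: "1 / real N \<le> sin x"
  proof -
    have "2 / real N \<le> pi / real N" using pi_ge_two by (intro divide_right_mono) auto
    then have "1 / real N \<le> x / 2" by (simp add: x_def)
    then show ?thesis using sin_ge_half[of x] x0 by linarith
  qed
  have c0: "0 \<le> cos x" "cos x \<le> 1" using x0 by (auto intro: cos_ge_zero)
  have B_sin: "B = 2 * (sin x)\<^sup>2" by (simp add: B_def cos_double_sin)
  have A_ge: "B / 2 \<le> A"
  proof -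
    have "0 \<le> cos x * (1 - cos x)" using c0 by (intro mult_nonneg_nonneg) auto
    moreover have "cos (2 * x) = 2 * (cos x * cos x) - 1" using cos_double_cos[of x] by (simp only: power2_eq_square)
    ultimately show ?thesis by (simp add: A_def B_def right_diff_distrib)
  qed
  have A_le: "A \<le> B" using c0 by (simp add: A_def B_def)
  have "0 < 1 / real N" using N by simp
  then have s_pos: "0 < sin x" using s0 by linarith
  then have B0: "0 < B" unfolding B_sin by simp
  have b1: "\<bar>b j\<bar> \<le> 1" for j by (simp add: b_def)
  have E0: "0 \<le> E q" for q unfolding E_def by (intro sum_nonneg) auto
  have one: "(A * M0 - (2 * A * real J + sin x) * E q) / (B * real J * M0) \<le> measure (cm k w) (near q (1 / real N))" for q
  proof -
    define R where "R y = (\<Sum>j<J. b j * (cos (2 * pi * (real (J - j) * y)) + cos (2 * pi * (real (Suc j) * y))))" for y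
    define I where "I j = (\<integral>t. cos (2 * pi * (real j * (real q * t))) \<partial>cm k w)" for j
    have pt: "A * ?S y + sin x / 2 * R y \<le> B * real J * M0 * (if infdist y \<int> \<le> 1 / real N then 1 else 0)" for y
    proof -
      have "A * ?S y + sin x / 2 * R y = (cos (2 * pi * y) - cos (2 * x)) * ?S y"
      proof -
        have "(2 * cos (2 * pi * y) - 2 * cos x) * ?S y = sin x * R y"
          unfolding R_def b_def x_def J_def by (rule sine_kernel_identity[OF N])
        then show ?thesis unfolding A_def left_diff_distrib by linarith
      qed
      also have "\<dots> \<le> B * real J * M0 * (if infdist y \<int> \<le> 1 / real N then 1 else 0)"
      proof (cases "infdist y \<int> \<le> 1 / real N")
        case True
        have "(cos (2 * pi * y) - cos (2 * x)) * ?S y \<le> B * ?S y"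
          unfolding B_def by (intro mult_right_mono) auto
        also have "\<dots> \<le> B * (real J * M0)"
          unfolding M0_def using B0 by (intro mult_left_mono norm_trig_sum_squared_le) auto
        finally show ?thesis using True by simp
      next
        case False
        have "cos (2 * pi * y) = cos (2 * pi * infdist y \<int>)" by (rule cos_2pi_infdist)
        also have "\<dots> \<le> cos (2 * x)"
        proof (rule cos_monotone_0_pi_le)
          show "2 * x \<le> 2 * pi * infdist y \<int>"
          proof -
            have "2 * pi * (1 / real N) \<le> 2 * pi * infdist y \<int>" using False by (intro mult_left_mono) auto
            then show ?thesis by (simp add: x_def)
          qed
          show "2 * pi * infdist y \<int> \<le> pi"
            using mult_left_mono[OF infdist_Ints_le_half[of y], of "2 * pi"] by simp
        qed (use x0 in simp)
        finally show ?thesis using False by (simp add: mult_nonpos_nonneg)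
      qed
      finally show ?thesis .
    qed
    have intR: "integrable (cm k w) (\<lambda>t. R (real q * t))" unfolding R_def by (intro Bochner_Integration.integrable_sum integrable_mult_right Bochner_Integration.integrable_add integrable_cm_cos)
    have "A * (\<integral>t. ?S (real q * t) \<partial>cm k w) + sin x / 2 * (\<integral>t. R (real q * t) \<partial>cm k w)
       = (\<integral>t. A * ?S (real q * t) + sin x / 2 * R (real q * t) \<partial>cm k w)"
      using intR by simp
    also have "\<dots> \<le> (\<integral>t. B * real J * M0 * indicator (near q (1 / real N)) t \<partial>cm k w)"
    proof (rule integral_mono)
      show "A * ?S (real q * t) + sin x / 2 * R (real q * t) \<le> B * real J * M0 * indicator (near q (1 / real N)) t" for t
        using pt[of "real q * t"] by (cases "infdist (real q * t) \<int> \<le> 1 / real N") (simp_all add: indicator_def near_def)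
    qed (use intR in \<open>auto simp: emeasure_eq_measure\<close>)
    also have "\<dots> = B * real J * M0 * measure (cm k w) (near q (1 / real N))" by simp
    finally have le: "A * (\<integral>t. ?S (real q * t) \<partial>cm k w) + sin x / 2 * (\<integral>t. R (real q * t) \<partial>cm k w)
      \<le> B * real J * M0 * measure (cm k w) (near q (1 / real N))" .
    have S_ge: "M0 - 2 * real J * E q \<le> (\<integral>t. ?S (real q * t) \<partial>cm k w)"
      using integral_norm_trig_sum_squared[where b = b and J = J and q = q and k = k and w = w, OF b1] unfolding M0_def E_def by linarith
    have "\<bar>\<integral>t. R (real q * t) \<partial>cm k w\<bar> \<le> 2 * E q"
    proof -
      have "(\<integral>t. R (real q * t) \<partial>cm k w) = (\<Sum>j<J. b j * (I (J - j) + I (Suc j)))"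
        unfolding R_def I_def by (simp add: Bochner_Integration.integral_sum del: of_nat_Suc)
      also have "\<bar>\<dots>\<bar> \<le> (\<Sum>j<J. \<bar>b j * (I (J - j) + I (Suc j))\<bar>)" by (rule sum_abs)
      also have "\<dots> \<le> (\<Sum>j<J. \<bar>I (J - j)\<bar> + \<bar>I (Suc j)\<bar>)"
      proof (rule sum_mono)
        fix j
        have "\<bar>b j * (I (J - j) + I (Suc j))\<bar> \<le> 1 * \<bar>I (J - j) + I (Suc j)\<bar>"
          unfolding abs_mult by (intro mult_right_mono b1) auto
        also have "1 * \<bar>I (J - j) + I (Suc j)\<bar> \<le> \<bar>I (J - j)\<bar> + \<bar>I (Suc j)\<bar>"
          unfolding mult_1 by (rule abs_triangle_ineq)
        finally show "\<bar>b j * (I (J - j) + I (Suc j))\<bar> \<le> \<bar>I (J - j)\<bar> + \<bar>I (Suc j)\<bar>" .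
      qed
      also have "\<dots> = (\<Sum>j<J. \<bar>I (J - j)\<bar>) + (\<Sum>j<J. \<bar>I (Suc j)\<bar>)" by (rule sum.distrib)
      also have "(\<Sum>j<J. \<bar>I (J - j)\<bar>) = (\<Sum>h\<in>{1..J}. \<bar>I h\<bar>)"
        by (rule sum.reindex_bij_witness[where i = "\<lambda>h. J - h" and j = "\<lambda>j. J - j"]) auto
      also have "(\<Sum>j<J. \<bar>I (Suc j)\<bar>) = (\<Sum>h\<in>{1..J}. \<bar>I h\<bar>)"
        by (rule sum.reindex_bij_witness[where i = "\<lambda>h. h - 1" and j = Suc]) auto
      also have "(\<Sum>h\<in>{1..J}. \<bar>I h\<bar>) + (\<Sum>h\<in>{1..J}. \<bar>I h\<bar>) \<le> E q + E q"
        unfolding I_def E_def by (intro add_mono sum_mono integral_cos_nat_le)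
      finally show ?thesis by simp
    qed
    then have "sin x / 2 * (\<integral>t. R (real q * t) \<partial>cm k w) \<ge> sin x / 2 * (- (2 * E q))"
      using s_pos by (intro mult_left_mono) auto
    moreover have "A * (M0 - 2 * real J * E q) \<le> A * (\<integral>t. ?S (real q * t) \<partial>cm k w)"
      using S_ge A_ge B0 by (intro mult_left_mono) auto
    ultimately have "A * (M0 - 2 * real J * E q) - sin x * E q \<le> B * real J * M0 * measure (cm k w) (near q (1 / real N))"
      using le by (simp add: algebra_simps)
    moreover have "0 < B * real J * M0" using B0 J1 M0 N by simp
    ultimately show ?thesis by (simp add: divide_le_eq algebra_simps)
  qed
  have two: "1 / (2 * real J) - 6 * E q / real J \<le> measure (cm k w) (near q (1 / real N))" for q
  proof -
    have pos: "0 < B * real J * M0" using B0 J1 M0 N by simp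
    have n1: "sin x \<le> B * real N"
    proof -
      have "1 \<le> real N * sin x" using s0 N by (simp add: field_simps)
      then have "sin x * 1 \<le> sin x * (2 * (real N * sin x))" using s_pos by (intro mult_left_mono) auto
      then show ?thesis by (simp add: B_sin power2_eq_square mult_ac)
    qed
    have n2: "2 * A * real J \<le> 2 * B * real N" using A_le A_ge B0 N by (intro mult_mono) (auto simp: J_def)
    have "(2 * A * real J + sin x) * E q \<le> (3 * B * real N) * E q"
      using n1 n2 by (intro mult_right_mono E0) auto
    moreover have "B / 2 * M0 \<le> A * M0" using A_ge M0 by (intro mult_right_mono) auto
    ultimately have "B / 2 * M0 - 3 * B * real N * E q \<le> A * M0 - (2 * A * real J + sin x) * E q" by linarith
    then have "(B / 2 * M0 - 3 * B * real N * E q) / (B * real J * M0) \<le> (A * M0 - (2 * A * real J + sin x) * E q) / (B * real J * M0)"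
      using pos by (intro divide_right_mono) auto
    moreover have "(B / 2 * M0 - 3 * B * real N * E q) / (B * real J * M0) = 1 / (2 * real J) - 6 * E q / real J"
      using B0 J1 N unfolding M0 by (simp add: field_simps)
    ultimately show ?thesis using one[of q] by linarith
  qed
  have "(\<Sum>q\<in>{Q..<2*Q}. measure (cm k w) (near q (1 / real N))) \<ge> (\<Sum>q\<in>{Q..<2*Q}. 1 / (2 * real J) - 6 * E q / real J)"
    by (intro sum_mono two)
  also have "(\<Sum>q\<in>{Q..<2*Q}. 1 / (2 * real J) - 6 * E q / real J) = real Q / (2 * real J) - 6 * Err k Q J / real J"
    unfolding sum_subtractf sum_divide_distrib[symmetric] sum_distrib_left[symmetric] Err_def E_def by simp
  finally show ?thesis by (simp add: J_def)
qed

end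

subsection \<open>Lower bounds for unions over a dyadic block of denominators\<close>

lemma card_multiples_le:
  fixes A :: "nat set"
  assumes A: "A \<subseteq> {Q..<2 * Q}" and dvd: "\<And>q. q \<in> A \<Longrightarrow> d dvd q" and d: "0 < d"
  shows "card A \<le> Suc (Q div d)"
proof (cases "A = {}")
  case False
  have fin: "finite A" using A finite_subset by blast
  define m where "m = Min A"
  have m: "m \<in> A" "\<And>q. q \<in> A \<Longrightarrow> m \<le> q" using fin False by (auto simp: m_def)
  have "card A \<le> card {..Q div d}"
  proof (rule card_inj_on_le[where f = "\<lambda>q. (q - m) div d"])
    show "inj_on (\<lambda>q. (q - m) div d) A"
    proof (rule inj_onI)
      fix x y assume xy: "x \<in> A" "y \<in> A" "(x - m) div d = (y - m) div d"
      have "d dvd x - m" "d dvd y - m" using dvd m(1) xy by (auto intro: dvd_diff_nat)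
      then have "x - m = y - m" using xy(3) by (metis dvd_div_mult_self)
      then show "x = y" using m(2) xy by (metis eq_diff_iff)
    qed
    show "(\<lambda>q. (q - m) div d) ` A \<subseteq> {..Q div d}"
    proof (intro image_subsetI)
      fix q assume "q \<in> A"
      then have "q < 2 * Q" "Q \<le> m" using A m(1) by auto
      then have "q - m \<le> Q" by simp
      then show "(q - m) div d \<in> {..Q div d}" by (simp add: div_le_mono)
    qed
  qed auto
  then show ?thesis by simp
qed simp

text \<open>All fractions with denominators in \<open>{Q..<2 * Q}\<close> that are this close to \<open>x\<close> coincide; what
  matters is the denominator \<open>d\<close> of their common value in lowest terms.\<close>

lemma common_reduced_fraction:
  fixes x \<epsilon> :: real
  assumes Q: "1 \<le> Q" and \<epsilon>: "8 * real Q * \<epsilon> < 1"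
    and A: "A = {q \<in> {Q..<2 * Q}. infdist (real q * x) \<int> \<le> \<epsilon>}" and ne: "A \<noteq> {}"
  obtains d where "1 \<le> d" "infdist (real d * x) \<int> \<le> real d * \<epsilon> / real Q" "\<And>q. q \<in> A \<Longrightarrow> d dvd q"
proof -
  obtain q1 where q1: "q1 \<in> A" using ne by blast
  then obtain n1 where n1: "\<bar>real q1 * x - of_int n1\<bar> \<le> \<epsilon>" using A infdist_Ints_le_iff by blast
  have q1Q: "Q \<le> q1" "q1 < 2 * Q" using q1 A by auto
  define g where "g = gcd n1 (int q1)"
  have g0: "0 < g" using q1Q Q by (simp add: g_def)
  define d where "d = nat (int q1 div g)"
  define a where "a = n1 div g"
  have dg: "int q1 = int d * g"
    using g0 by (simp add: d_def g_def pos_imp_zdiv_nonneg_iff)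
  have ag: "n1 = a * g" by (simp add: a_def g_def)
  have cop: "coprime a (int d)"
    using div_gcd_coprime[of n1 "int q1"] q1Q Q g0 by (simp add: a_def d_def g_def pos_imp_zdiv_nonneg_iff)
  have d1: "1 \<le> d" using dg q1Q Q by (cases d) auto
  have rg: "real q1 = real d * of_int g" using dg by (metis of_int_mult of_int_of_nat_eq)
  show thesis
  proof (rule that[OF d1])
    have "of_int g * \<bar>real d * x - of_int a\<bar> = \<bar>real q1 * x - of_int n1\<bar>"
    proof -
      have "of_int g * (real d * x - of_int a) = real q1 * x - of_int n1"
        unfolding rg ag by (simp add: algebra_simps)
      then show ?thesis using g0 abs_mult[of "of_int g" "real d * x - of_int a"] by simp
    qed
    then have "of_int g * \<bar>real d * x - of_int a\<bar> \<le> \<epsilon>" using n1 by simp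
    then have "\<bar>real d * x - of_int a\<bar> \<le> \<epsilon> / of_int g" using g0 by (simp add: field_simps)
    also have "\<dots> = real d * \<epsilon> / real q1" using d1 g0 unfolding rg by simp
    also have "\<dots> \<le> real d * \<epsilon> / real Q"
      using q1Q Q n1 by (intro divide_left_mono mult_nonneg_nonneg) (auto intro: order_trans[OF abs_ge_zero])
    finally show "infdist (real d * x) \<int> \<le> real d * \<epsilon> / real Q" using infdist_Ints_le_iff by blast
  next
    fix q assume q: "q \<in> A"
    then obtain n where n: "\<bar>real q * x - of_int n\<bar> \<le> \<epsilon>" using A infdist_Ints_le_iff by blast
    have qQ: "Q \<le> q" "q < 2 * Q" using q A by auto
    have \<epsilon>0: "0 \<le> \<epsilon>" using n1 by linarith
    \<comment> \<open>The cross-multiplied difference of the two fractions is an integer of absolute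
      value at most 4 * Q * \<epsilon> < 1, hence 0.\<close>
    have "real_of_int (n * int q1 - n1 * int q) = real q * (real q1 * x - of_int n1) - real q1 * (real q * x - of_int n)"
      by (simp add: algebra_simps)
    also have "\<bar>\<dots>\<bar> \<le> real q * \<epsilon> + real q1 * \<epsilon>"
    proof -
      have "\<bar>real q * (real q1 * x - of_int n1)\<bar> \<le> real q * \<epsilon>" "\<bar>real q1 * (real q * x - of_int n)\<bar> \<le> real q1 * \<epsilon>"
        using n n1 by (simp_all add: abs_mult mult_left_mono)
      then show ?thesis by linarith
    qed
    also have "\<dots> \<le> 2 * real Q * \<epsilon> + 2 * real Q * \<epsilon>"
      using qQ q1Q \<epsilon>0 by (intro add_mono mult_right_mono) auto
    also have "\<dots> < 1" using \<epsilon> \<epsilon>0 mult_nonneg_nonneg[of "real Q" \<epsilon>] unfolding mult.assoc by linarith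
    finally have "\<bar>n * int q1 - n1 * int q\<bar> < 1" by linarith
    then have "n * int q1 = n1 * int q" by simp
    then have "g * (n * int d) = g * (a * int q)" using dg ag by (simp add: mult_ac)
    then have "n * int d = a * int q" using g0 by simp
    then have "int d dvd a * int q" by (metis dvd_triv_right)
    then have "int d dvd int q" using cop by (simp add: coprime_dvd_mult_right_iff coprime_commute)
    then show "d dvd q" by simp
  qed
qed

lemma less_twice_floor: "1 \<le> r \<Longrightarrow> r < 2 * real (nat \<lfloor>r\<rfloor>)"
proof -
  assume "1 \<le> r"
  then have "1 \<le> \<lfloor>r\<rfloor>" by simp
  then have "1 \<le> real (nat \<lfloor>r\<rfloor>)" "r < real (nat \<lfloor>r\<rfloor>) + 1" by linarith+
  then show ?thesis by linarith
qed

context missing_digit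
begin

text \<open>All q that count at \<open>x\<close> are multiples of one reduced denominator
  \<open>d\<close>, so there are at most Q / d + 1 of them. Either d exceeds \<open>Q div M\<close>
  and the multiplicity is bounded in terms of \<open>M\<close>, or d is small and d * x is within d
  / (Q * N) of an integer; this rare event is charged to d with weight 2 * Q / d.\<close>

lemma count_near_le:
  fixes M :: nat
  assumes Q: "1 \<le> Q" and N: "8 * Q < N" and M: "1 \<le> M"
  shows "(\<Sum>q\<in>{Q..<2*Q}. indicator (near q (1 / real N)) x)
    \<le> (real M + 1) * indicator (\<Union>q\<in>{Q..<2*Q}. near q (1 / real N)) x
      + (\<Sum>d\<in>{1..Q div M}. 2 * real Q / real d * indicator (near d (real d / (real Q * real N))) x)"
    (is "?L \<le> ?R1 + ?R2")
proof -
  define A where "A = {q \<in> {Q..<2 * Q}. infdist (real q * x) \<int> \<le> 1 / real N}"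
  have L: "?L = real (card A)"
  proof -
    have "?L = (\<Sum>q\<in>{Q..<2*Q}. if infdist (real q * x) \<int> \<le> 1 / real N then 1 else 0)"
      by (intro sum.cong refl) (simp add: indicator_def near_def)
    also have "\<dots> = (\<Sum>q\<in>A. 1)" unfolding A_def by (rule sum.inter_filter[symmetric]) simp
    finally show ?thesis by simp
  qed
  have R1: "0 \<le> ?R1" by simp
  have R2: "0 \<le> ?R2" by (intro sum_nonneg) auto
  show ?thesis
  proof (cases "A = {}")
    case True
    then show ?thesis using L R1 R2 by simp
  next
    case False
    have N0: "0 < N" using N by simp
    have "8 * real Q * (1 / real N) < 1" using N N0 by (simp flip: of_nat_less_iff)
    from common_reduced_fraction[OF Q this A_def False]
    obtain d where d: "1 \<le> d" "infdist (real d * x) \<int> \<le> real d * (1 / real N) / real Q" "\<And>q. q \<in> A \<Longrightarrow> d dvd q"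
      by blast
    have card: "card A \<le> Suc (Q div d)" by (rule card_multiples_le[OF _ d(3)]) (use d(1) in \<open>auto simp: A_def\<close>)
    show ?thesis
    proof (cases "d \<le> Q div M")
      case True
      then have dQ: "d \<le> Q" using div_le_dividend order_trans by blast
      have "x \<in> near d (real d / (real Q * real N))" using d(2) by (simp add: near_def mult.commute)
      then have "2 * real Q / real d \<le> (\<Sum>d\<in>{d}. 2 * real Q / real d * indicator (near d (real d / (real Q * real N))) x)"
        by simp
      also have "\<dots> \<le> ?R2" using True d(1) by (intro sum_mono2) auto
      finally have "2 * real Q / real d \<le> ?R2" .
      moreover have "real (card A) \<le> 2 * real Q / real d"
      proof -
        have "real (Q div d) \<le> real Q / real d" by (rule of_nat_div_le_of_nat)
        moreover have "1 \<le> real Q / real d" using dQ d(1) by simp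
        ultimately have "real (Suc (Q div d)) \<le> 2 * (real Q / real d)" by simp
        then show ?thesis using card by simp
      qed
      ultimately show ?thesis using L R1 by linarith
    next
      case False
      then have "Q < d * M" using M by (simp add: not_le div_less_iff_less_mult)
      then have "Q div d < M" using d(1) by (simp add: div_less_iff_less_mult mult.commute)
      then have "real (card A) \<le> real M + 1" using card by simp
      moreover have "x \<in> (\<Union>q\<in>{Q..<2*Q}. near q (1 / real N))" using \<open>A \<noteq> {}\<close> by (auto simp: A_def near_def)
      ultimately show ?thesis using L R2 by simp
    qed
  qed
qed

lemma measure_near_mono: "\<epsilon> \<le> \<epsilon>' \<Longrightarrow> measure (cm k w) (near q \<epsilon>) \<le> measure (cm k w) (near q \<epsilon>')"
  by (rule finite_measure.finite_measure_mono[OF prob_space.finite_measure[OF prob_cm] near_mono]) auto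

text \<open>This is the upper bound \<open>sum_measure_near_le\<close> for the block from 2^i, with
  \<open>H\<close> about Q * N / 2^(i + 4). Then 1 / (8 * H) covers every tolerance d / (Q * N), and
  as 2^i * H stays below Q * N the error bound is the same for each i.\<close>

lemma dyadic_small_denominators:
  assumes EB: "\<And>k Q H. 1 \<le> Q \<Longrightarrow> 1 \<le> H \<Longrightarrow> Err k Q H \<le> C * real p ^ k * (real Q * real H) powr \<tau>"
    and C: "0 \<le> C" "0 \<le> \<tau>" and Q: "1 \<le> Q" and N: "1 \<le> N" and i: "2048 * 2 ^ i \<le> Q"
  shows "(\<Sum>d\<in>{2^i..<2*2^i}. 2 * real Q / real d * measure (cm k w) (near d (real d / (real Q * real N))))
    \<le> 64 / real N * (3 * 2 ^ i + 5 * C * real p ^ k * (real Q * real N) powr \<tau>)"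
proof -
  define H where "H = nat \<lfloor>real Q * real N / 2 ^ (i + 4)\<rfloor>"
  have big: "1 \<le> real Q * real N / 2 ^ (i + 4)"
  proof -
    have "16 * 2 ^ i \<le> Q * N" using i N mult_le_mono[of "16 * 2 ^ i" Q 1 N] by simp
    then have "real (16 * 2 ^ i) \<le> real (Q * N)" by (rule of_nat_mono)
    then show ?thesis by (simp add: power_add mult_ac)
  qed
  then have H1: "1 \<le> H" unfolding H_def by (simp add: le_nat_iff)
  have H_le: "real H \<le> real Q * real N / 2 ^ (i + 4)" unfolding H_def using big by simp
  have H_ge: "real Q * real N / 2 ^ (i + 5) \<le> real H"
  proof -
    have "real Q * real N / 2 ^ (i + 4) < 2 * real H"
      unfolding H_def by (rule less_twice_floor[OF big])
    then show ?thesis by (simp add: power_add)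
  qed
  have "(\<Sum>d\<in>{2^i..<2*2^i}. 2 * real Q / real d * measure (cm k w) (near d (real d / (real Q * real N))))
    \<le> (\<Sum>d\<in>{2^i..<2*2^i}. 2 * real Q / 2 ^ i * measure (cm k w) (near d (1 / (8 * real H))))"
  proof (rule sum_mono)
    fix d :: nat assume d: "d \<in> {2^i..<2*2^i}"
    then have "real (2 ^ i) \<le> real d" "real d \<le> real (2 * 2 ^ i)" by (auto intro!: of_nat_mono simp del: of_nat_power of_nat_mult)
    then have dr: "2 ^ i \<le> real d" "real d \<le> 2 * 2 ^ i" by simp_all
    have "8 * real H * (2 * 2 ^ i) \<le> real Q * real N" using H_le by (simp add: power_add field_simps)
    moreover have "8 * real H * real d \<le> 8 * real H * (2 * 2 ^ i)" using dr by (intro mult_left_mono) auto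
    ultimately have "8 * real H * real d \<le> real Q * real N" by (rule order_trans[rotated])
    then have "real d / (real Q * real N) \<le> 1 / (8 * real H)"
      using H1 Q N by (simp add: field_simps)
    then have "measure (cm k w) (near d (real d / (real Q * real N))) \<le> measure (cm k w) (near d (1 / (8 * real H)))"
      by (rule measure_near_mono)
    moreover have "0 < real d" using d by (auto intro: order.strict_trans2[of 0 "2 ^ i"])
    then have "2 * real Q / real d \<le> 2 * real Q / 2 ^ i" using dr by (intro divide_left_mono mult_pos_pos) auto
    ultimately show "2 * real Q / real d * measure (cm k w) (near d (real d / (real Q * real N)))
      \<le> 2 * real Q / 2 ^ i * measure (cm k w) (near d (1 / (8 * real H)))"
      by (intro mult_mono) auto
  qed
  also have "\<dots> = 2 * real Q / 2 ^ i * (\<Sum>d\<in>{2^i..<2*2^i}. measure (cm k w) (near d (1 / (8 * real H))))"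
    by (rule sum_distrib_left[symmetric])
  also have "\<dots> \<le> 2 * real Q / 2 ^ i * ((3 * real (2 ^ i) + 5 * Err k (2 ^ i) H) / real H)"
    by (intro mult_left_mono sum_measure_near_le H1) auto
  also have "\<dots> \<le> 2 * real Q / 2 ^ i * ((3 * real (2 ^ i) + 5 * (C * real p ^ k * (real Q * real N) powr \<tau>)) / real H)"
  proof (intro mult_left_mono divide_right_mono add_left_mono)
    have "Err k (2 ^ i) H \<le> C * real p ^ k * (real (2 ^ i) * real H) powr \<tau>" by (rule EB) (use H1 in auto)
    also have "\<dots> \<le> C * real p ^ k * (real Q * real N) powr \<tau>"
    proof (intro mult_left_mono powr_mono2)
      have "2 ^ i * real H \<le> real Q * real N / 16" using H_le by (simp add: power_add field_simps)
      also have "\<dots> \<le> real Q * real N" by simp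
      finally show "real (2 ^ i) * real H \<le> real Q * real N" by simp
    qed (use C in auto)
    finally show "Err k (2 ^ i) H \<le> C * real p ^ k * (real Q * real N) powr \<tau>" .
  qed auto
  also have "\<dots> = (2 * real Q / 2 ^ i) / real H * (3 * 2 ^ i + 5 * C * real p ^ k * (real Q * real N) powr \<tau>)"
    by (simp add: mult_ac)
  also have "\<dots> \<le> 64 / real N * (3 * 2 ^ i + 5 * C * real p ^ k * (real Q * real N) powr \<tau>)"
  proof (rule mult_right_mono)
    have "2 * real Q * real N \<le> 64 * 2 ^ i * real H" using H_ge by (simp add: power_add field_simps)
    then show "(2 * real Q / 2 ^ i) / real H \<le> 64 / real N" using H1 N by (simp add: field_simps)
  qed (use C in auto)
  finally show ?thesis .
qed

definition near_block :: "nat \<Rightarrow> real \<Rightarrow> real set" where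
  "near_block Q \<epsilon> = (\<Union>q\<in>{Q..<2*Q}. near q \<epsilon>)"

lemma near_block_borel [measurable, simp]: "near_block Q \<epsilon> \<in> sets borel"
  unfolding near_block_def by (intro sets.finite_UN) auto

text \<open>The sum of the measures is at least Q / (2 * N) minus an error. By
  \<open>count_near_le\<close> it is at most 2049 times the measure of the union, plus the charge
  for small reduced denominators. The assumption \<open>small\<close> keeps the errors, one for each
  dyadic block, below the remaining gap.\<close>

lemma measure_near_block_ge:
  assumes EB: "\<And>k Q H. 1 \<le> Q \<Longrightarrow> 1 \<le> H \<Longrightarrow> Err k Q H \<le> C * real p ^ k * (real Q * real H) powr \<tau>"
    and C: "0 \<le> C" "0 \<le> \<tau>" and Q: "1 \<le> Q" and N: "8 * Q < N"
    and small: "6400 * (1 + log 2 (real Q)) * C * real p ^ k * (real Q * real N) powr \<tau> \<le> real Q"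
  shows "real Q / (10000 * real N) \<le> measure (cm k w) (near_block Q (1 / real N))"
proof -
  interpret prob_space "cm k w" by (rule prob_cm)
  \<comment> \<open>With 2048 the main part of the charge, 64 * 3 * (2 * Q / 2048), is 3/16 of
    \<open>Q\<close>, to be compared with the main term \<open>Q / 2\<close>.\<close>
  define M where "M = (2048::nat)"
  define Z where "Z = C * real p ^ k * (real Q * real N) powr \<tau>"
  have Z0: "0 \<le> Z" using C by (simp add: Z_def)
  have N2: "2 \<le> N" using N Q by simp
  \<comment> \<open>\<open>L\<close> dyadic blocks cover the denominators up to
    \<open>Q div M\<close>; their number is the source of the logarithm in
    \<open>small\<close>.\<close>
  obtain L where L: "Q div M < 2 ^ L" "2048 * (2 ^ L - 1) \<le> 2 * real Q" "real L \<le> 1 + log 2 (real Q)"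
    "\<And>i. i < L \<Longrightarrow> 2048 * 2 ^ i \<le> Q"
  proof (cases "Q div M = 0")
    case True
    show ?thesis by (rule that[of 0]) (use True Q in auto)
  next
    case False
    then obtain l where l: "2 ^ l \<le> Q div M" "Q div M < 2 ^ (l + 1)" using ex_power_ivl1[of 2 "Q div M"] by auto
    have "2048 * 2 ^ l \<le> M * (Q div M)" using l(1) by (simp add: M_def)
    also have "\<dots> \<le> Q" by simp
    finally have lQ: "2048 * 2 ^ l \<le> Q" .
    then have lQr: "2048 * 2 ^ l \<le> real Q" by (metis of_nat_le_iff of_nat_mult of_nat_numeral of_nat_power)
    show ?thesis
    proof (rule that[of "l + 1"])
      show "real (l + 1) \<le> 1 + log 2 (real Q)"
      proof -
        have "2 ^ l \<le> real Q" using lQr zero_le_power[of "2::real" l] by linarith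
        then have "real l \<le> log 2 (real Q)" using Q by (simp add: le_log_iff powr_realpow)
        then show ?thesis by simp
      qed
      fix i assume "i < l + 1"
      then have "2 ^ i \<le> (2 ^ l :: nat)" by (intro power_increasing) auto
      then show "2048 * 2 ^ i \<le> Q" using lQ by linarith
    qed (use l lQr in auto)
  qed
  have "(\<Sum>q\<in>{Q..<2*Q}. measure (cm k w) (near q (1 / real N)))
    = (\<integral>x. (\<Sum>q\<in>{Q..<2*Q}. indicator (near q (1 / real N)) x) \<partial>cm k w)"
    by (subst Bochner_Integration.integral_sum) (auto simp: emeasure_eq_measure)
  also have "\<dots> \<le> (\<integral>x. (real M + 1) * indicator (near_block Q (1 / real N)) x
      + (\<Sum>d\<in>{1..Q div M}. 2 * real Q / real d * indicator (near d (real d / (real Q * real N))) x) \<partial>cm k w)"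
    unfolding near_block_def
    by (rule integral_mono[OF _ _ count_near_le[OF Q N]])
       (auto simp: emeasure_eq_measure M_def near_block_def[symmetric])
  also have "\<dots> = (real M + 1) * measure (cm k w) (near_block Q (1 / real N))
      + (\<Sum>d\<in>{1..Q div M}. 2 * real Q / real d * measure (cm k w) (near d (real d / (real Q * real N))))"
    by (subst Bochner_Integration.integral_add) (auto simp: emeasure_eq_measure Bochner_Integration.integral_sum)
  also have "(\<Sum>d\<in>{1..Q div M}. 2 * real Q / real d * measure (cm k w) (near d (real d / (real Q * real N))))
    \<le> (\<Sum>d\<in>{1..<2^L}. 2 * real Q / real d * measure (cm k w) (near d (real d / (real Q * real N))))"
    using L(1) by (intro sum_mono2) auto
  also have "\<dots> = (\<Sum>i<L. \<Sum>d\<in>{2^i..<2*2^i}. 2 * real Q / real d * measure (cm k w) (near d (real d / (real Q * real N))))"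
  proof (rule sym, induction L)
    case (Suc l)
    have "{1..<2 ^ Suc l} = {1..<2^l} \<union> {2^l..<2*2^l::nat}" by (auto simp: Suc_le_eq)
    then show ?case unfolding sum.lessThan_Suc Suc by (simp add: sum.union_disjoint)
  qed simp
  also have "\<dots> \<le> (\<Sum>i<L. 64 / real N * (3 * 2 ^ i + 5 * C * real p ^ k * (real Q * real N) powr \<tau>))"
    by (intro sum_mono dyadic_small_denominators[OF EB C Q]) (use L(4) N2 in auto)
  also have "\<dots> = 64 / real N * (3 * (2 ^ L - 1) + 5 * real L * Z)"
  proof -
    have "(\<Sum>i<L. (2::real) ^ i) = 2 ^ L - 1" by (induction L) auto
    then show ?thesis unfolding sum_distrib_left[symmetric] sum.distrib Z_def by (simp add: mult_ac)
  qed
  also have "\<dots> \<le> 64 / real N * (3 * (2 * real Q / 2048) + 5 * (1 + log 2 (real Q)) * Z)"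
    using L(2,3) Z0 by (intro mult_left_mono add_mono mult_right_mono) auto
  finally have up: "(\<Sum>q\<in>{Q..<2*Q}. measure (cm k w) (near q (1 / real N)))
    \<le> (real M + 1) * measure (cm k w) (near_block Q (1 / real N))
      + 64 / real N * (3 * (2 * real Q / 2048) + 5 * (1 + log 2 (real Q)) * Z)" by simp
  have "real Q / (2 * real (N - 1)) - 6 * Err k Q (N - 1) / real (N - 1) \<ge> real Q / (2 * real N) - 12 * Z / real N"
  proof -
    have "Err k Q (N - 1) \<le> C * real p ^ k * (real Q * real (N - 1)) powr \<tau>" by (rule EB) (use Q N2 in auto)
    also have "\<dots> \<le> Z" unfolding Z_def using C by (intro mult_left_mono powr_mono2) auto
    finally have E: "Err k Q (N - 1) \<le> Z" .
    have "6 * Err k Q (N - 1) / real (N - 1) \<le> 6 * Z / real (N - 1)" using E by (intro divide_right_mono) auto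
    moreover have "6 * Z / real (N - 1) \<le> 12 * Z / real N"
    proof -
      have "real N \<le> 2 * real (N - 1)" using N2 by simp
      then have "6 * Z * real N \<le> 6 * Z * (2 * real (N - 1))" using Z0 by (intro mult_left_mono) auto
      then show ?thesis using N2 by (simp add: field_simps)
    qed
    moreover have "real Q / (2 * real N) \<le> real Q / (2 * real (N - 1))" using N2 by (intro divide_left_mono) auto
    ultimately show ?thesis by (meson diff_mono order_trans)
  qed
  then have low: "real Q / (2 * real N) - 12 * Z / real N \<le> (\<Sum>q\<in>{Q..<2*Q}. measure (cm k w) (near q (1 / real N)))"
    using sum_measure_near_ge[OF N2] by (rule order_trans)
  define m where "m = measure (cm k w) (near_block Q (1 / real N))"
  define l where "l = 1 + log 2 (real Q)"
  have l1: "1 \<le> l" using Q by (simp add: l_def)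
  have "real Q / (2 * real N) - 12 * Z / real N \<le> 2049 * m + 64 / real N * (3 * (2 * real Q / 2048) + 5 * l * Z)"
  proof -
    have "real M + 1 = 2049" by (simp add: M_def)
    then show ?thesis using order_trans[OF low up] unfolding m_def l_def by (simp only:)
  qed
  then have "(real Q / (2 * real N) - 12 * Z / real N) * real N \<le> (2049 * m + 64 / real N * (3 * (2 * real Q / 2048) + 5 * l * Z)) * real N"
    by (intro mult_right_mono) auto
  moreover have "(real Q / (2 * real N) - 12 * Z / real N) * real N = real Q / 2 - 12 * Z"
    using N2 by (simp add: left_diff_distrib)
  moreover have "(2049 * m + 64 / real N * X) * real N = 2049 * m * real N + 64 * X" for X
    using N2 by (simp add: distrib_right)
  ultimately have A: "real Q / 2 - 12 * Z \<le> 2049 * m * real N + 64 * (3 * (2 * real Q / 2048) + 5 * l * Z)"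
    by (simp only:)
  have "6400 * (l * Z) \<le> real Q" using small unfolding l_def Z_def by (simp only: mult_ac)
  moreover have "Z \<le> l * Z" using l1 Z0 mult_right_mono[of 1 l Z] by simp
  ultimately have "real Q \<le> 10000 * (m * real N)" using A by simp
  then show ?thesis using N2 unfolding m_def[symmetric] by (simp add: field_simps)
qed

end

subsection \<open>Khintchine-type theorems\<close>

text \<open>The Fourier-analytic input of all metric results. For tolerances near 1 / Q the product
  Q * H is about Q^2, so \<tau> < 1 / 2 puts the error below the main term \<open>Q\<close> by a
  power of Q, part of which can be spent on the factor \<open>p ^ k\<close>.\<close>

locale missing_digit_l1 = missing_digit +
  fixes C \<tau> :: real
  assumes C_pos: "0 < C" and \<tau>: "0 < \<tau>" "\<tau> < 1 / 2"
    and Err_le: "\<And>k Q H. 1 \<le> Q \<Longrightarrow> 1 \<le> H \<Longrightarrow> Err k Q H \<le> C * real p ^ k * (real Q * real H) powr \<tau>"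
begin

lemma measure_near_block_le_sum:
  "measure (cm k w) (near_block Q \<epsilon>) \<le> (\<Sum>q\<in>{Q..<2*Q}. measure (cm k w) (near q \<epsilon>))"
proof -
  interpret prob_space "cm k w" by (rule prob_cm)
  show ?thesis unfolding near_block_def by (intro measure_UNION_le) auto
qed

lemma measure_near_block_mono:
  "\<epsilon> \<le> \<epsilon>' \<Longrightarrow> measure (cm k w) (near_block Q \<epsilon>) \<le> measure (cm k w) (near_block Q \<epsilon>')"
proof -
  assume "\<epsilon> \<le> \<epsilon>'"
  then have "near_block Q \<epsilon> \<subseteq> near_block Q \<epsilon>'" unfolding near_block_def using near_mono by blast
  then show ?thesis
    by (intro finite_measure.finite_measure_mono[OF prob_space.finite_measure[OF prob_cm]]) auto
qed

text \<open>Rounding \<open>1 / (8 * \<epsilon>)\<close> down to an integer costs a factor of at most two.\<close>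

lemma measure_near_block_le:
  assumes Q: "1 \<le> Q" and \<epsilon>: "0 < \<epsilon>" "\<epsilon> \<le> 1 / 8"
  shows "measure (cm k w) (near_block Q \<epsilon>) \<le> 16 * \<epsilon> * (3 * real Q + 5 * C * real p ^ k * (real Q / (8 * \<epsilon>)) powr \<tau>)"
proof -
  define r where "r = 1 / (8 * \<epsilon>)"
  define H where "H = nat \<lfloor>r\<rfloor>"
  have r1: "1 \<le> r" using \<epsilon> by (simp add: r_def field_simps)
  have H1: "1 \<le> H" using r1 by (simp add: H_def le_nat_iff)
  have Hr: "real H \<le> r" "r < 2 * real H" using r1 less_twice_floor[OF r1] by (simp_all add: H_def)
  have eH: "\<epsilon> \<le> 1 / (8 * real H)"
  proof -
    have "8 * real H * \<epsilon> \<le> 8 * r * \<epsilon>" using Hr(1) \<epsilon> by (intro mult_right_mono) auto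
    also have "\<dots> = 1" using \<epsilon> by (simp add: r_def)
    finally show ?thesis using H1 by (simp add: field_simps)
  qed
  have invH: "1 / real H \<le> 16 * \<epsilon>"
  proof -
    have "r * (16 * \<epsilon>) = 2" using \<epsilon> by (simp add: r_def)
    moreover have "r * (16 * \<epsilon>) \<le> 2 * real H * (16 * \<epsilon>)" using Hr(2) \<epsilon> by (intro mult_right_mono) auto
    ultimately show ?thesis using H1 by (simp add: field_simps)
  qed
  have E: "Err k Q H \<le> C * real p ^ k * (real Q / (8 * \<epsilon>)) powr \<tau>"
  proof -
    have "Err k Q H \<le> C * real p ^ k * (real Q * real H) powr \<tau>" by (rule Err_le[OF Q H1])
    also have "\<dots> \<le> C * real p ^ k * (real Q * r) powr \<tau>"
      using C_pos \<tau> Hr by (intro mult_left_mono powr_mono2 mult_nonneg_nonneg) auto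
    finally show ?thesis by (simp add: r_def)
  qed
  have "measure (cm k w) (near_block Q \<epsilon>) \<le> measure (cm k w) (near_block Q (1 / (8 * real H)))"
    by (rule measure_near_block_mono[OF eH])
  also have "\<dots> \<le> (\<Sum>q\<in>{Q..<2*Q}. measure (cm k w) (near q (1 / (8 * real H))))"
    by (rule measure_near_block_le_sum)
  also have "\<dots> \<le> (3 * real Q + 5 * Err k Q H) / real H" by (rule sum_measure_near_le[OF H1])
  also have "\<dots> = 1 / real H * (3 * real Q + 5 * Err k Q H)" by simp
  also have "\<dots> \<le> 16 * \<epsilon> * (3 * real Q + 5 * (C * real p ^ k * (real Q / (8 * \<epsilon>)) powr \<tau>))"
    using E Err_nonneg[of k Q H] by (intro mult_mono invH add_mono) (use \<epsilon> in auto)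
  finally show ?thesis by (simp add: mult_ac)
qed

text \<open>A solution q in the dyadic block from 2^j satisfies \<psi> q \<le> \<psi> (2^j), so
  infinitely many solutions meet infinitely many blocks.\<close>

lemma W_subset_near_blocks:
  assumes anti: "antimono_on {1..} \<psi>" and x: "x \<in> W \<psi>"
  shows "\<not> (\<forall>\<^sub>F j in sequentially. x \<notin> near_block (2 ^ j) (\<psi> (2 ^ j)))"
proof
  assume "\<forall>\<^sub>F j in sequentially. x \<notin> near_block (2 ^ j) (\<psi> (2 ^ j))"
  then obtain J where J: "\<And>j. J \<le> j \<Longrightarrow> x \<notin> near_block (2 ^ j) (\<psi> (2 ^ j))"
    by (auto simp: eventually_sequentially)
  have "q < 2 ^ J" if q: "0 < q" "infdist (real q * x) \<int> \<le> \<psi> q" for q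
  proof (rule ccontr)
    assume nq: "\<not> q < 2 ^ J"
    obtain j where j: "2 ^ j \<le> q" "q < 2 ^ (j + 1)" using ex_power_ivl1[of 2 q] q(1) by auto
    have "(2::nat) ^ J < 2 ^ (j + 1)" using nq j(2) by linarith
    then have "J \<le> j" using power_less_imp_less_exp[of "2::nat" J "j + 1"] by simp
    moreover have "\<psi> q \<le> \<psi> (2 ^ j)" using anti j(1) q(1) by (auto simp: monotone_on_def)
    then have "x \<in> near_block (2 ^ j) (\<psi> (2 ^ j))"
      using q j unfolding near_block_def near_def by (auto intro!: bexI[of _ q])
    ultimately show False using J by blast
  qed
  then have "{q. 0 < q \<and> infdist (real q * x) \<int> \<le> \<psi> q} \<subseteq> {..<2 ^ J}" by auto
  then have "finite {q. 0 < q \<and> infdist (real q * x) \<int> \<le> \<psi> q}" using finite_subset by blast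
  then show False using x by (simp add: W_def W_inhom_def)
qed

text \<open>Where \<psi> is too small for the counting bound it is raised to x powr (- 1 -
  \<theta>), x = 2^j. This adds only a geometric series to the block sums, and \<theta> is so small
  that (2 + \<theta>) * \<tau> \<le> 1, which bounds the error term by x.\<close>

theorem khintchine_convergence:
  assumes pos: "\<And>q. 1 \<le> q \<Longrightarrow> 0 < \<psi> q" and anti: "antimono_on {1..} \<psi>" and summ: "summable \<psi>"
  shows "emeasure mu (W \<psi>) = 0"
proof -
  interpret prob_space mu by (rule prob_mu)
  define \<theta> where "\<theta> = (1 / \<tau> - 2) / 2"
  have \<theta>0: "0 < \<theta>" using \<tau> by (simp add: \<theta>_def field_simps)
  have \<theta>\<tau>: "(2 + \<theta>) * \<tau> \<le> 1" using \<tau> by (simp add: \<theta>_def field_simps)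
  define K where "K = 16 * (3 + 5 * C)"
  define A where "A j = near_block (2 ^ j) (\<psi> (2 ^ j))" for j
  have cond: "summable (\<lambda>j. 2 ^ j * \<psi> (2 ^ j))"
  proof -
    \<comment> \<open>Condensation wants nonnegative values throughout, but \<open>\<psi> 0\<close>
      is arbitrary; it is replaced by 0.\<close>
    define \<psi>' where "\<psi>' q = (if q = 0 then 0 else \<psi> q)" for q
    have "summable (\<lambda>q. \<psi>' (Suc q))" using summ unfolding \<psi>'_def by (simp add: summable_Suc_iff)
    then have "summable \<psi>'" using summable_Suc_iff by blast
    moreover have "summable \<psi>' \<longleftrightarrow> summable (\<lambda>j. 2 ^ j * \<psi>' (2 ^ j))"
    proof (rule condensation_test)
      show "\<psi>' (Suc m) \<le> \<psi>' m" if "0 < m" for m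
        using that anti by (auto simp: \<psi>'_def monotone_on_def)
      show "0 \<le> \<psi>' n" for n using pos[of n] by (simp add: \<psi>'_def less_imp_le Suc_le_eq)
    qed
    ultimately show ?thesis by (simp add: \<psi>'_def)
  qed
  have geo: "summable (\<lambda>j. (1 / 2 powr \<theta>) ^ j)"
    using \<theta>0 by (intro summable_geometric) (simp add: gr_one_powr)
  have bound: "measure mu (A j) \<le> K * (2 ^ j * \<psi> (2 ^ j) + (1 / 2 powr \<theta>) ^ j)"
    if small: "\<psi> (2 ^ j) \<le> 1 / 8" and j: "3 \<le> j" for j
  proof -
    define x :: real where "x = 2 ^ j"
    define \<epsilon> where "\<epsilon> = max (\<psi> (2 ^ j)) (x powr (- 1 - \<theta>))"
    have x8: "8 \<le> x" using power_increasing[OF j, of "2::real"] by (simp add: x_def)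
    have e0: "0 < \<epsilon>" using x8 by (simp add: \<epsilon>_def less_max_iff_disj)
    have "x powr (- 1 - \<theta>) \<le> x powr (- 1)" using x8 \<theta>0 by (intro powr_mono) auto
    also have "\<dots> \<le> 1 / 8" using x8 by (simp add: powr_minus_divide)
    finally have e1: "\<epsilon> \<le> 1 / 8" using small by (simp add: \<epsilon>_def)
    have "measure (cm 0 0) (near_block (2 ^ j) (\<psi> (2 ^ j))) \<le> measure (cm 0 0) (near_block (2 ^ j) \<epsilon>)"
      by (rule measure_near_block_mono) (simp add: \<epsilon>_def)
    also have "\<dots> \<le> 16 * \<epsilon> * (3 * real (2 ^ j) + 5 * C * real p ^ 0 * (real (2 ^ j) / (8 * \<epsilon>)) powr \<tau>)"
      by (rule measure_near_block_le[OF _ e0 e1]) simp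
    also have "\<dots> = 16 * \<epsilon> * (3 * x + 5 * C * (x / (8 * \<epsilon>)) powr \<tau>)" by (simp add: x_def)
    also have "\<dots> \<le> 16 * \<epsilon> * (3 * x + 5 * C * x)"
    proof -
      have "x / (8 * \<epsilon>) \<le> x powr (2 + \<theta>)"
      proof -
        have "x powr (2 + \<theta>) * x powr (- 1 - \<theta>) = x" using x8 by (simp add: powr_add[symmetric])
        moreover have "x powr (2 + \<theta>) * x powr (- 1 - \<theta>) \<le> x powr (2 + \<theta>) * \<epsilon>"
          by (intro mult_left_mono) (auto simp: \<epsilon>_def)
        ultimately have "x \<le> x powr (2 + \<theta>) * (8 * \<epsilon>)" using e0 x8 by simp
        then show ?thesis using e0 by (simp add: field_simps)
      qed
      then have "(x / (8 * \<epsilon>)) powr \<tau> \<le> (x powr (2 + \<theta>)) powr \<tau>"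
        using \<tau> x8 e0 by (intro powr_mono2) auto
      also have "\<dots> \<le> x powr 1" unfolding powr_powr using \<theta>\<tau> x8 by (intro powr_mono) auto
      finally show ?thesis using e0 C_pos x8 by (intro mult_left_mono add_left_mono) auto
    qed
    also have "\<dots> = K * (x * \<epsilon>)" by (simp add: K_def algebra_simps)
    also have "\<dots> \<le> K * (x * \<psi> (2 ^ j) + x * x powr (- 1 - \<theta>))"
    proof -
      have "\<epsilon> \<le> \<psi> (2 ^ j) + x powr (- 1 - \<theta>)" using pos[of "2 ^ j"] by (simp add: \<epsilon>_def)
      then have "x * \<epsilon> \<le> x * (\<psi> (2 ^ j) + x powr (- 1 - \<theta>))" using x8 by (intro mult_left_mono) auto
      moreover have "0 \<le> K" using C_pos by (simp add: K_def)
      ultimately have "K * (x * \<epsilon>) \<le> K * (x * (\<psi> (2 ^ j) + x powr (- 1 - \<theta>)))" by (rule mult_left_mono)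
      then show ?thesis by (simp only: distrib_left)
    qed
    also have "x * x powr (- 1 - \<theta>) = (1 / 2 powr \<theta>) ^ j"
    proof -
      have "x * x powr (- 1 - \<theta>) = x powr (- \<theta>)" using x8 by (simp add: powr_mult_base)
      also have "\<dots> = (2 powr real j) powr (- \<theta>)" by (simp add: x_def powr_realpow)
      also have "\<dots> = (2 powr (- \<theta>)) powr real j" by (simp add: powr_powr mult.commute)
      also have "\<dots> = (1 / 2 powr \<theta>) ^ j" by (simp add: powr_realpow powr_minus_divide)
      finally show ?thesis .
    qed
    finally show ?thesis by (simp add: cm_0 A_def x_def)
  qed
  have "\<psi> \<longlonglongrightarrow> 0" by (rule summable_LIMSEQ_zero[OF summ])
  then have "(\<lambda>j. \<psi> (2 ^ j)) \<longlonglongrightarrow> 0"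
    by (rule filterlim_compose) (auto intro!: filterlim_subseq strict_monoI)
  then have "\<forall>\<^sub>F j in sequentially. \<psi> (2 ^ j) < 1 / 8" by (rule order_tendstoD) simp
  then have ev: "\<forall>\<^sub>F j in sequentially. norm (measure mu (A j)) \<le> K * (2 ^ j * \<psi> (2 ^ j) + (1 / 2 powr \<theta>) ^ j)"
    using eventually_ge_at_top[of 3] by eventually_elim (use bound in auto)
  have "summable (\<lambda>j. measure mu (A j))"
    by (rule summable_comparison_test_ev[OF ev]) (intro summable_mult summable_add cond geo)
  then have "AE x in mu. \<forall>\<^sub>F j in sequentially. x \<in> space mu - A j"
    by (intro borel_cantelli_AE1) (auto simp: A_def emeasure_eq_measure)
  then have "AE x in mu. x \<notin> W \<psi>"
  proof eventually_elim
    case (elim x)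
    then have "\<forall>\<^sub>F j in sequentially. x \<notin> near_block (2 ^ j) (\<psi> (2 ^ j))"
      by eventually_elim (simp add: A_def)
    then show ?case using W_subset_near_blocks[OF anti] by blast
  qed
  then show ?thesis using emeasure_eq_0_AE[of "\<lambda>x. x \<in> W \<psi>" mu] by simp
qed

end

section \<open>Divergence along nearly independent scales\<close>

context missing_digit
begin

text \<open>Conditioned on any cylinder of level \<open>K i\<close> the event \<open>G i\<close> has probability at least
  \<open>a i\<close>, already through cylinders of level \<open>K (Suc i)\<close>, so the conditional probabilities of the
  complements multiply.\<close>

lemma measure_avoid_le_prod:
  fixes K :: "nat \<Rightarrow> nat" and F G :: "nat \<Rightarrow> real set" and a :: "nat \<Rightarrow> real"
  assumes K: "\<And>i. K i \<le> K (Suc i)" and F: "\<And>i. F i \<in> sets borel" and G: "\<And>i. G i \<in> sets borel"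
    and a: "\<And>i. a i \<le> 1" "\<And>i w. I \<le> i \<Longrightarrow> a i \<le> measure (cm (K i) w) (F i)"
    and FG: "\<And>i v. I \<le> i \<Longrightarrow> cyl (K (Suc i)) v \<inter> F i \<noteq> {} \<Longrightarrow> cyl (K (Suc i)) v \<subseteq> G i"
    and i: "I \<le> i"
  shows "measure (cm (K i) w) (\<Inter>j\<in>{i..<i+n}. - G j) \<le> (\<Prod>j\<in>{i..<i+n}. 1 - a j)"
  using i
proof (induction n arbitrary: i w)
  case 0
  then show ?case by (simp add: measure_cm_le_1)
next
  case (Suc n)
  define m where "m = K (Suc i) - K i"
  have Km: "K i + m = K (Suc i)" using K[of i] by (simp add: m_def)
  define X where "X = (\<Inter>j\<in>{i..<i+Suc n}. - G j)"
  define \<pi> where "\<pi> = (\<Prod>j\<in>{Suc i..<Suc i+n}. 1 - a j)"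
  have \<pi>0: "0 \<le> \<pi>" unfolding \<pi>_def using a(1) by (intro prod_nonneg) auto
  have Xs: "X \<in> sets borel" unfolding X_def using G by (intro sets.finite_INT) auto
  define v where "v u = w * p ^ m + u" for u
  \<comment> \<open>The subcylinders in \<open>U\<close> lie inside \<open>G i\<close> and are lost
    to \<open>X\<close>. Since they carry all of \<open>F i\<close>, there are at least
    \<open>a i * P ^ m\<close> of them.\<close>
  define U where "U = {u \<in> Wd m. cyl (K (Suc i)) (v u) \<inter> F i \<noteq> {}}"
  have U: "U \<subseteq> Wd m" "finite U" by (auto simp: U_def)
  have Pm: "0 < real (P ^ m)" by simp
  have "a i \<le> measure (cm (K i) w) (F i)" by (rule a(2)[OF Suc.prems])
  also have "\<dots> = (\<Sum>u\<in>Wd m. measure (cm (K (Suc i)) (v u)) (F i)) / real (P ^ m)"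
    unfolding v_def Km[symmetric] by (rule measure_cm_split[OF F])
  also have "(\<Sum>u\<in>Wd m. measure (cm (K (Suc i)) (v u)) (F i)) \<le> (\<Sum>u\<in>Wd m. if u \<in> U then 1 else 0)"
    by (intro sum_mono) (auto simp: measure_cm_le_1 U_def measure_cm_disjoint[OF F])
  also have "\<dots> = real (card U)" using U by (simp add: sum.If_cases Int_absorb1)
  finally have "a i \<le> real (card U) / real (P ^ m)" using Pm by (simp add: divide_right_mono)
  then have cU: "a i * real (P ^ m) \<le> real (card U)" using Pm by (simp add: field_simps)
  have "measure (cm (K i) w) X = (\<Sum>u\<in>Wd m. measure (cm (K (Suc i)) (v u)) X) / real (P ^ m)"
    unfolding v_def Km[symmetric] by (rule measure_cm_split[OF Xs])
  also have "(\<Sum>u\<in>Wd m. measure (cm (K (Suc i)) (v u)) X) \<le> (\<Sum>u\<in>Wd m. if u \<in> U then 0 else \<pi>)"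
  proof (rule sum_mono)
    fix u assume u: "u \<in> Wd m"
    show "measure (cm (K (Suc i)) (v u)) X \<le> (if u \<in> U then 0 else \<pi>)"
    proof (cases "u \<in> U")
      case True
      then have "cyl (K (Suc i)) (v u) \<subseteq> G i" using FG[OF Suc.prems] by (auto simp: U_def)
      then have "cyl (K (Suc i)) (v u) \<inter> X = {}" by (auto simp: X_def)
      then show ?thesis using measure_cm_disjoint[OF Xs] True by simp
    next
      case False
      have sub: "X \<subseteq> (\<Inter>j\<in>{Suc i..<Suc i+n}. - G j)" by (auto simp: X_def)
      have "measure (cm (K (Suc i)) (v u)) X \<le> measure (cm (K (Suc i)) (v u)) (\<Inter>j\<in>{Suc i..<Suc i+n}. - G j)"
        using G by (intro finite_measure.finite_measure_mono[OF prob_space.finite_measure[OF prob_cm] sub])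
          (cases n, auto intro!: sets.finite_INT)
      also have "\<dots> \<le> \<pi>" unfolding \<pi>_def using Suc.prems by (intro Suc.IH) simp
      finally show ?thesis using False by simp
    qed
  qed
  also have "\<dots> = (real (P ^ m) - real (card U)) * \<pi>"
  proof -
    have "(\<Sum>u\<in>Wd m. if u \<in> U then 0 else \<pi>) = real (card (Wd m - U)) * \<pi>"
      by (simp add: sum.If_cases Diff_eq[symmetric] Collect_mem_eq Compl_eq[symmetric])
    also have "card (Wd m - U) = P ^ m - card U" using U by (simp add: card_Diff_subset)
    also have "real (P ^ m - card U) = real (P ^ m) - real (card U)"
      using card_mono[OF finite_Wd U(1)] by (simp add: of_nat_diff)
    finally show ?thesis .
  qed
  also have "(real (P ^ m) - real (card U)) * \<pi> \<le> (real (P ^ m) - a i * real (P ^ m)) * \<pi>"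
    using cU \<pi>0 by (intro mult_right_mono) auto
  finally have "measure (cm (K i) w) X \<le> (real (P ^ m) - a i * real (P ^ m)) * \<pi> / real (P ^ m)"
    using Pm by (simp add: divide_right_mono)
  also have "\<dots> = (1 - a i) * \<pi>"
  proof -
    have "(R - a i * R) * \<pi> / R = (1 - a i) * \<pi>" if "0 < R" for R
      using that by (simp add: left_diff_distrib diff_divide_distrib)
    then show ?thesis using Pm .
  qed
  also have "\<dots> = (\<Prod>j\<in>{i..<i+Suc n}. 1 - a j)"
    unfolding \<pi>_def by (subst prod.atLeast_Suc_lessThan[of i "i + Suc n"]) auto
  finally show ?case by (simp only: X_def)
qed

text \<open>By 1 - a \<le> exp (- a) the product bound tends to 0 when the sum of \<open>a\<close>
  diverges. Avoiding all \<open>G j\<close> from some index on is then a null event in every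
  cylinder, hence for \<open>mu\<close>.\<close>

lemma AE_infinitely_often:
  fixes K :: "nat \<Rightarrow> nat" and F G :: "nat \<Rightarrow> real set" and a :: "nat \<Rightarrow> real"
  assumes K: "\<And>i. K i \<le> K (Suc i)" and F: "\<And>i. F i \<in> sets borel" and G: "\<And>i. G i \<in> sets borel"
    and a: "\<And>i. 0 \<le> a i" "\<And>i. a i \<le> 1" "\<And>i w. I \<le> i \<Longrightarrow> a i \<le> measure (cm (K i) w) (F i)"
    and FG: "\<And>i v. I \<le> i \<Longrightarrow> cyl (K (Suc i)) v \<inter> F i \<noteq> {} \<Longrightarrow> cyl (K (Suc i)) v \<subseteq> G i"
    and div: "\<not> summable a"
  shows "AE x in mu. \<forall>i\<ge>I. \<exists>j\<ge>i. x \<in> G j"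
proof -
  have z: "AE x in mu. \<exists>j\<ge>i. x \<in> G j" if i: "I \<le> i" for i
  proof -
    define X where "X = (\<Inter>j\<in>{i..}. - G j)"
    have Xs: "X \<in> sets borel" unfolding X_def using G by (intro sets.countable_INT') auto
    have c0: "measure (cm (K i) w) X = 0" for w
    proof -
      have le: "measure (cm (K i) w) X \<le> exp (- (\<Sum>j\<in>{i..<i+n}. a j))" for n
      proof (cases "n = 0")
        case True
        then show ?thesis by (simp add: measure_cm_le_1)
      next
        case False
        have "measure (cm (K i) w) X \<le> measure (cm (K i) w) (\<Inter>j\<in>{i..<i+n}. - G j)"
          using G False by (intro finite_measure.finite_measure_mono[OF prob_space.finite_measure[OF prob_cm]])
            (auto simp: X_def intro!: sets.finite_INT)
        also have "\<dots> \<le> (\<Prod>j\<in>{i..<i+n}. 1 - a j)"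
          by (rule measure_avoid_le_prod[where K = K and F = F and G = G and a = a and I = I, OF K F G a(2) a(3) FG i])
        also have "\<dots> \<le> (\<Prod>j\<in>{i..<i+n}. exp (- a j))"
          using a(2) exp_ge_add_one_self[of "- a j" for j] by (intro prod_mono) auto
        also have "\<dots> = exp (- (\<Sum>j\<in>{i..<i+n}. a j))" by (simp add: exp_sum sum_negf[symmetric])
        finally show ?thesis .
      qed
      have "\<not> summable (\<lambda>n. a (n + i))" using div by (simp add: summable_iff_shift)
      then have unb: "\<exists>n. B < (\<Sum>j<n. a (j + i))" for B
        using a(1) summableI_nonneg_bounded[of "\<lambda>n. a (n + i)" B] by (meson not_le)
      have "measure (cm (K i) w) X \<le> e" if e: "0 < e" for e
      proof -
        obtain n where n: "- ln e < (\<Sum>j<n. a (j + i))" using unb by blast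
        have "(\<Sum>j<n. a (j + i)) = (\<Sum>j\<in>{i..<i+n}. a j)"
          using sum.shift_bounds_nat_ivl[of a 0 i n] by (simp add: lessThan_atLeast0 add.commute)
        then have "exp (- (\<Sum>j\<in>{i..<i+n}. a j)) \<le> exp (ln e)" using n by simp
        then show ?thesis using le[of n] e by simp
      qed
      then show ?thesis by (meson antisym dense_ge measure_nonneg)
    qed
    have "measure mu X = (\<Sum>u\<in>Wd (K i). measure (cm (0 + K i) (0 * p ^ K i + u)) X) / real (P ^ K i)"
      unfolding cm_0[symmetric] by (rule measure_cm_split[OF Xs])
    then have "measure mu X = 0" by (simp add: c0)
    then have "AE x in mu. x \<notin> X"
      using prob_space.prob_eq_0[OF prob_mu, of X] Xs by simp
    then show ?thesis by eventually_elim (auto simp: X_def)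
  qed
  have "AE x in mu. \<forall>i. I \<le> i \<longrightarrow> (\<exists>j\<ge>i. x \<in> G j)"
    unfolding AE_all_countable using z by auto
  then show ?thesis by eventually_elim auto
qed

end

context missing_digit_l1
begin

lemma infdist_mult_cyl:
  assumes "x \<in> cyl k v" "y \<in> cyl k v"
  shows "infdist (real q * y) \<int> \<le> infdist (real q * x) \<int> + real q / real p ^ k"
proof -
  have "\<bar>y - x\<bar> \<le> 1 / real p ^ k" by (rule cyl_dist[OF assms])
  then have "real q * \<bar>y - x\<bar> \<le> real q * (1 / real p ^ k)" by (intro mult_left_mono) auto
  moreover have "dist (real q * y) (real q * x) = real q * \<bar>y - x\<bar>"
    by (simp add: dist_real_def abs_mult flip: right_diff_distrib)
  ultimately show ?thesis using infdist_triangle[of "real q * y" \<int> "real q * x"] by simp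
qed

text \<open>\<open>\<psi> q = 1 / (q ln ln q)\<close> loses a factor \<open>1 / (i + 1)\<close> on the scales \<open>q \<approx> p ^ (B ^ i)\<close>. These are
  sparse enough to be nearly independent, yet the losses still sum to infinity.\<close>

theorem khintchine_divergence:
  "emeasure mu (W (\<lambda>q. 1 / (real q * ln (ln (real q))))) = 1"
proof -
  define \<psi> where "\<psi> q = 1 / (real q * ln (ln (real q)))" for q :: nat
  \<comment> \<open>Half of the room left in the exponent by 2 * \<tau> < 1: the factor
    \<open>p ^ K i\<close> of the error may be as large as Q powr a.\<close>
  define a where "a = (1 - 2 * \<tau>) / 2"
  have a0: "0 < a" "a + 2 * \<tau> < 1" using \<tau> by (auto simp: a_def field_simps)
  define B where "B = nat \<lceil>4 / a\<rceil> + 2"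
  have B: "4 \<le> a * real B" "2 \<le> B"
  proof -
    have "4 / a \<le> real B" unfolding B_def by linarith
    then show "4 \<le> a * real B" using a0 by (simp add: field_simps)
  qed (simp add: B_def)
  define Q where "Q i = p ^ (B ^ Suc i)" for i
  define L where "L x = ln (ln (2 * x))" for x :: real
  \<comment> \<open>The tolerance 1 / N is at most an eighth of 1 / (2 * Q * L), the lower bound for
    \<psi> on the block. The rest allows for moving within a cylinder.\<close>
  define N where "N i = nat \<lceil>16 * (real (Q i) * L (real (Q i)))\<rceil>" for i
  \<comment> \<open>Level \<open>K i\<close> is coarse for the scale \<open>Q i\<close>, because 4 *
    B^i \<le> a * B^(i + 1). Level \<open>K (Suc i)\<close> is fine for it, because
    \<open>p ^ K (Suc i)\<close> is the fourth power of \<open>Q i\<close>.\<close>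
  define K where "K i = 4 * B ^ i" for i
  define F where "F i = near_block (Q i) (1 / real (N i))" for i
  define G where "G i = (\<Union>q\<in>{Q i..<2 * Q i}. near q (\<psi> q))" for i
  have Q_ge: "i \<le> Q i" for i
  proof -
    have "i \<le> B ^ Suc i" using less_exp[of "Suc i"] power_mono[of 2 B "Suc i"] B(2) by linarith
    also have "\<dots> \<le> 2 ^ (B ^ Suc i)" using less_exp less_imp_le by blast
    also have "\<dots> \<le> Q i" unfolding Q_def using p2 by (intro power_mono) auto
    finally show ?thesis .
  qed
  have limQ: "filterlim (\<lambda>i. real (Q i)) at_top sequentially"
    by (rule filterlim_at_top_mono[OF filterlim_real_sequentially]) (simp add: Q_ge)
  have "\<forall>\<^sub>F x in at_top. 6400 * (1 + log 2 x) * C * x powr a * (x * (17 * (x * ln (ln (2 * x))))) powr \<tau> \<le> x"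
    using C_pos a0 \<tau> by real_asymp
  moreover have "\<forall>\<^sub>F x in at_top. (1::real) \<le> ln (ln (2 * x))" by real_asymp
  moreover have "\<forall>\<^sub>F x in at_top. (0::real) < ln (ln x)" by real_asymp
  moreover have "\<forall>\<^sub>F x in at_top. (8::real) * ln (ln (2 * x)) \<le> x ^ 2" by real_asymp
  ultimately have "\<forall>\<^sub>F x in at_top. 6400 * (1 + log 2 x) * C * x powr a * (x * (17 * (x * L x))) powr \<tau> \<le> x
    \<and> 1 \<le> L x \<and> 0 < ln (ln x) \<and> 8 * L x \<le> x\<^sup>2 \<and> 2 \<le> x"
    using eventually_ge_at_top[of 2] unfolding L_def by eventually_elim simp
  then have "\<forall>\<^sub>F i in sequentially. (\<lambda>x. 6400 * (1 + log 2 x) * C * x powr a * (x * (17 * (x * L x))) powr \<tau> \<le> x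
    \<and> 1 \<le> L x \<and> 0 < ln (ln x) \<and> 8 * L x \<le> x\<^sup>2 \<and> 2 \<le> x) (real (Q i))"
    using limQ by (rule eventually_compose_filterlim)
  then obtain I where I: "\<And>i. I \<le> i \<Longrightarrow> 6400 * (1 + log 2 (real (Q i))) * C * real (Q i) powr a * (real (Q i) * (17 * (real (Q i) * L (real (Q i))))) powr \<tau> \<le> real (Q i)"
    "\<And>i. I \<le> i \<Longrightarrow> 1 \<le> L (real (Q i))" "\<And>i. I \<le> i \<Longrightarrow> 0 < ln (ln (real (Q i)))"
    "\<And>i. I \<le> i \<Longrightarrow> 8 * L (real (Q i)) \<le> (real (Q i))\<^sup>2" "\<And>i. I \<le> i \<Longrightarrow> 2 \<le> real (Q i)"
    unfolding eventually_sequentially by blast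
  have N: "16 * (real (Q i) * L (real (Q i))) \<le> real (N i)" "real (N i) \<le> 17 * (real (Q i) * L (real (Q i)))"
    if "I \<le> i" for i
  proof -
    have "1 \<le> real (Q i) * L (real (Q i))"
      using I(2,5)[OF that] mult_mono[of 1 "real (Q i)" 1 "L (real (Q i))"] by simp
    then show "16 * (real (Q i) * L (real (Q i))) \<le> real (N i)" "real (N i) \<le> 17 * (real (Q i) * L (real (Q i)))"
      unfolding N_def by linarith+
  qed
  have Q1: "1 \<le> Q i" for i by (simp add: Q_def Suc_le_eq)
  have F_ge: "1 / (170000 * L (real (Q i))) \<le> measure (cm (K i) w) (F i)" if i: "I \<le> i" for i w
  proof -
    let ?x = "real (Q i)"
    have x: "2 \<le> ?x" "1 \<le> L ?x" using I i by auto
    have pK: "real p ^ K i \<le> ?x powr a"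
    proof -
      have "real (4 * B ^ i) \<le> a * real (B ^ Suc i)" using mult_right_mono[OF B(1), of "real (B ^ i)"] by (simp add: mult_ac)
      then have "real p powr real (K i) \<le> real p powr (real (B ^ Suc i) * a)"
        using p2 unfolding K_def by (intro powr_mono) (auto simp: mult.commute)
      also have "\<dots> = (real p powr real (B ^ Suc i)) powr a" by (rule powr_powr[symmetric])
      also have "real p powr real (B ^ Suc i) = ?x" using p_pos by (simp add: Q_def powr_realpow del: of_nat_power power_Suc flip: of_nat_power)
      finally show ?thesis using p_pos by (simp add: powr_realpow)
    qed
    have "?x * real (N i) \<le> ?x * (17 * (?x * L ?x))" using N(2)[OF i] by (intro mult_left_mono) auto
    then have "(?x * real (N i)) powr \<tau> \<le> (?x * (17 * (?x * L ?x))) powr \<tau>" using \<tau> by (intro powr_mono2) auto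
    moreover have "0 \<le> log 2 ?x" using x by simp
    ultimately have "6400 * (1 + log 2 ?x) * C * real p ^ K i * (?x * real (N i)) powr \<tau>
      \<le> 6400 * (1 + log 2 ?x) * C * ?x powr a * (?x * (17 * (?x * L ?x))) powr \<tau>"
      using pK C_pos by (intro mult_mono mult_left_mono mult_nonneg_nonneg) auto
    also have "\<dots> \<le> ?x" by (rule I(1)[OF i])
    finally have small: "6400 * (1 + log 2 ?x) * C * real p ^ K i * (?x * real (N i)) powr \<tau> \<le> ?x" .
    have "8 * ?x < real (N i)"
    proof -
      have "?x * 1 \<le> ?x * L ?x" using x by (intro mult_left_mono) auto
      then show ?thesis using N(1)[OF i] x by linarith
    qed
    then have N8: "8 * Q i < N i" by (simp flip: of_nat_less_iff[where 'a = real])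
    have "?x / (10000 * real (N i)) \<le> measure (cm (K i) w) (F i)"
      unfolding F_def by (rule measure_near_block_ge[OF Err_le _ _ Q1 N8 small]) (use C_pos \<tau> in auto)
    moreover have "1 / (170000 * L ?x) \<le> ?x / (10000 * real (N i))"
    proof -
      have "0 < real (N i)" using N8 by simp
      then show ?thesis using N(2)[OF i] x by (simp add: field_simps)
    qed
    ultimately show ?thesis by linarith
  qed
  have FG: "cyl (K (Suc i)) v \<subseteq> G i" if i: "I \<le> i" and ne: "cyl (K (Suc i)) v \<inter> F i \<noteq> {}" for i v
  proof
    fix y assume y: "y \<in> cyl (K (Suc i)) v"
    let ?x = "real (Q i)"
    have x: "2 \<le> ?x" "1 \<le> L ?x" using I i by auto
    obtain z q where z: "z \<in> cyl (K (Suc i)) v" "q \<in> {Q i..<2 * Q i}" "infdist (real q * z) \<int> \<le> 1 / real (N i)"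
    proof -
      obtain z where "z \<in> cyl (K (Suc i)) v" "z \<in> F i" using ne by blast
      then show ?thesis using that unfolding F_def near_block_def near_def by blast
    qed
    have q: "?x \<le> real q" "real q \<le> 2 * ?x" using z(2) by auto
    have pK: "real p ^ K (Suc i) = ?x ^ 4"
      by (simp add: K_def Q_def power_mult[symmetric] mult.commute)
    have lq: "0 < ln (ln (real q))" "ln (ln (real q)) \<le> L ?x"
    proof -
      have l0: "0 < ln ?x" using x by simp
      have "1 < ln ?x" using I(3)[OF i] l0 by (simp add: ln_gt_zero_iff)
      moreover have "ln ?x \<le> ln (real q)" "ln (real q) \<le> ln (2 * ?x)" using q x by auto
      ultimately show "0 < ln (ln (real q))" "ln (ln (real q)) \<le> L ?x" unfolding L_def by auto
    qed
    have \<psi>q: "1 / (2 * (?x * L ?x)) \<le> \<psi> q"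
    proof -
      have "real q * ln (ln (real q)) \<le> 2 * ?x * L ?x" using q lq x by (intro mult_mono) auto
      then show ?thesis unfolding \<psi>_def using lq q x by (intro divide_left_mono) (auto intro!: mult_pos_pos)
    qed
    have "infdist (real q * y) \<int> \<le> infdist (real q * z) \<int> + real q / real p ^ K (Suc i)"
      by (rule infdist_mult_cyl[OF z(1) y])
    also have "\<dots> \<le> 1 / (16 * (?x * L ?x)) + 2 * ?x / ?x ^ 4"
    proof (rule add_mono)
      have "1 / real (N i) \<le> 1 / (16 * (?x * L ?x))"
        using N(1)[OF i] x by (intro divide_left_mono) (auto intro!: mult_pos_pos order.strict_trans2[OF _ N(1)[OF i]])
      then show "infdist (real q * z) \<int> \<le> 1 / (16 * (?x * L ?x))" using z(3) by linarith
      show "real q / real p ^ K (Suc i) \<le> 2 * ?x / ?x ^ 4" unfolding pK using q by (intro divide_right_mono) auto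
    qed
    also have "2 * ?x / ?x ^ 4 \<le> 1 / (4 * (?x * L ?x))"
    proof -
      have "2 * ?x * (4 * (?x * L ?x)) = ?x\<^sup>2 * (8 * L ?x)" by (simp add: power2_eq_square)
      also have "\<dots> \<le> ?x\<^sup>2 * ?x\<^sup>2" using I(4)[OF i] by (intro mult_left_mono) auto
      also have "\<dots> = 1 * ?x ^ 4" by (simp flip: power_add)
      finally show ?thesis using x by (intro frac_le_eq[THEN iffD2] divide_le_0_iff[THEN iffD2]) (auto simp: mult_ac)
    qed
    also have "1 / (16 * (?x * L ?x)) + 1 / (4 * (?x * L ?x)) \<le> 1 / (2 * (?x * L ?x))"
      using x by (simp add: field_simps)
    also note \<psi>q
    finally show "y \<in> G i" using z(2) by (auto simp: G_def near_def)
  qed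
  \<comment> \<open>The iterated logarithm of \<open>p ^ (B ^ Suc i)\<close> grows linearly in i, so
    the probabilities dominate a harmonic series.\<close>
  define c where "c = \<bar>ln (ln (2 * real p))\<bar> + ln (real B) + 1"
  have c1: "1 \<le> c" using B(2) by (simp add: c_def)
  have L_le: "L (real (Q i)) \<le> c * real (Suc i)" if i: "I \<le> i" for i
  proof -
    have l2: "0 < ln (2 * real p)" using p2 by simp
    have "2 * real (Q i) \<le> (2 * real p) ^ (B ^ Suc i)"
    proof -
      have "(2::real) ^ 1 \<le> 2 ^ (B ^ Suc i)" using B(2) by (intro power_increasing) (auto simp: Suc_le_eq)
      then show ?thesis unfolding Q_def by (simp add: power_mult_distrib mult_right_mono del: power_Suc)
    qed
    then have "ln (2 * real (Q i)) \<le> ln ((2 * real p) ^ (B ^ Suc i))" using I(5)[OF i] p_pos by (subst ln_le_cancel_iff) auto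
    also have "\<dots> = real (B ^ Suc i) * ln (2 * real p)" by (rule ln_realpow)
    finally have le: "ln (2 * real (Q i)) \<le> real (B ^ Suc i) * ln (2 * real p)" .
    have "0 < ln (2 * real (Q i))" using I(5)[OF i] by simp
    then have "L (real (Q i)) \<le> ln (real (B ^ Suc i) * ln (2 * real p))"
      unfolding L_def using le B(2) l2 by (subst ln_le_cancel_iff) (auto intro!: mult_pos_pos)
    also have "\<dots> = real (Suc i) * ln (real B) + ln (ln (2 * real p))"
      using B(2) l2 by (subst ln_mult) (auto simp: ln_realpow simp del: power_Suc)
    also have "\<dots> \<le> real (Suc i) * ln (real B) + real (Suc i) * (\<bar>ln (ln (2 * real p))\<bar> + 1)"
    proof -
      have "1 * (\<bar>ln (ln (2 * real p))\<bar> + 1) \<le> real (Suc i) * (\<bar>ln (ln (2 * real p))\<bar> + 1)" by (intro mult_right_mono) auto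
      moreover have "ln (ln (2 * real p)) \<le> 1 * (\<bar>ln (ln (2 * real p))\<bar> + 1)" by simp
      ultimately have "ln (ln (2 * real p)) \<le> real (Suc i) * (\<bar>ln (ln (2 * real p))\<bar> + 1)" by (rule order_trans[rotated])
      then show ?thesis by (rule add_left_mono)
    qed
    also have "\<dots> = c * real (Suc i)" by (simp add: c_def algebra_simps)
    finally show ?thesis .
  qed
  define \<alpha> where "\<alpha> i = 1 / (170000 * c) * inverse (real (Suc i))" for i
  have \<alpha>: "0 \<le> \<alpha> i" "\<alpha> i \<le> 1" for i
  proof -
    have b: "0 \<le> 1 / (170000 * c)" "1 / (170000 * c) \<le> 1" using c1 by simp_all
    have s: "0 \<le> inverse (real (Suc i))" "inverse (real (Suc i)) \<le> 1" by (simp_all add: field_simps)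
    show "0 \<le> \<alpha> i" unfolding \<alpha>_def by (rule mult_nonneg_nonneg[OF b(1) s(1)])
    show "\<alpha> i \<le> 1" unfolding \<alpha>_def by (rule mult_le_one[OF b(2) s])
  qed
  have \<alpha>F: "\<alpha> i \<le> measure (cm (K i) w) (F i)" if i: "I \<le> i" for i w
  proof -
    have "1 / (170000 * c) * inverse s = 1 / (170000 * (c * s))" for s :: real
      by (simp add: field_simps)
    then have "\<alpha> i = 1 / (170000 * (c * real (Suc i)))" unfolding \<alpha>_def .
    also have "\<dots> \<le> 1 / (170000 * L (real (Q i)))"
    proof -
      have "170000 * L (real (Q i)) \<le> 170000 * (c * real (Suc i))" using L_le[OF i] by (intro mult_left_mono) auto
      moreover have "0 < 170000 * L (real (Q i))" using I(2)[OF i] by simp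
      ultimately show ?thesis by (intro frac_le) auto
    qed
    finally show ?thesis using F_ge[OF i, of w] by (rule order_trans)
  qed
  have "\<not> summable (\<lambda>i. inverse (real (Suc i)))"
    using not_summable_harmonic[where 'a = real] summable_Suc_iff[of "\<lambda>n. inverse (real n)"] by simp
  then have div: "\<not> summable \<alpha>" unfolding \<alpha>_def using c1 by (subst summable_cmult_iff) auto
  have "AE x in mu. \<forall>i\<ge>I. \<exists>j\<ge>i. x \<in> G j"
  proof (rule AE_infinitely_often[where K = K and F = F and G = G and a = \<alpha> and I = I])
    show "K i \<le> K (Suc i)" for i using B(2) by (simp add: K_def)
    show "G i \<in> sets borel" for i unfolding G_def by (intro sets.finite_UN) auto
  qed (use \<alpha> \<alpha>F FG div in \<open>auto simp: F_def\<close>)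
  then have "AE x in mu. x \<in> W \<psi>"
  proof eventually_elim
    case (elim x)
    have "\<exists>q>m. 0 < q \<and> infdist (real q * x) \<int> \<le> \<psi> q" for m
    proof -
      obtain j where j: "max I (Suc m) \<le> j" "x \<in> G j" using elim by (meson max.cobounded1)
      then obtain q where q: "Q j \<le> q" "infdist (real q * x) \<int> \<le> \<psi> q" by (auto simp: G_def near_def)
      have "m < q" using Q_ge[of j] q(1) j(1) by simp
      then show ?thesis using q(2) by (intro exI[of _ q]) auto
    qed
    then show ?case unfolding W_def W_inhom_def infinite_nat_iff_unbounded by auto
  qed
  then show ?thesis
    using prob_space.emeasure_eq_1_AE[OF prob_mu, of "W \<psi>"] unfolding \<psi>_def by simp
qed

end

subsection \<open>Hausdorff dimension and cylinders\<close>

lemma diam_powr_ge: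
  fixes U :: "'a::metric_space set"
  assumes "0 \<le> s" "s \<le> t" "0 < t" "bounded U" "diameter U \<le> 1"
  shows "ennreal (diameter U powr t) \<le> diam_powr s U"
proof (cases "U = {}")
  case True
  then show ?thesis using assms by (simp add: diam_powr_def)
next
  case False
  have d0: "0 \<le> diameter U" using diameter_ge_0 assms by blast
  show ?thesis
  proof (cases "s = 0")
    case True
    have "diameter U powr t \<le> 1 powr t" using d0 assms by (intro powr_mono2) auto
    then show ?thesis using True False by (simp add: diam_powr_def ennreal_leI flip: ennreal_1)
  next
    case s: False
    have "diameter U powr t \<le> diameter U powr s"
    proof (cases "diameter U = 0")
      case False
      then show ?thesis using d0 assms by (intro powr_mono') auto
    qed simp
    then show ?thesis using s False by (simp add: diam_powr_def ennreal_leI)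
  qed
qed

text \<open>If the s-dimensional measure vanishes for some s < t, there are covers of arbitrarily
  small s-content by sets of diameter at most 1, and their t-content is no larger. So a positive
  lower bound for the t-content of all bounded covers, fine or not, is enough.\<close>

lemma hausdorff_dim_geI:
  fixes A :: "'a::metric_space set"
  assumes t: "0 < t" and e: "0 < e"
    and no_cover: "\<And>U :: nat \<Rightarrow> 'a set. A \<subseteq> (\<Union>i. U i) \<Longrightarrow> (\<And>i. bounded (U i)) \<Longrightarrow>
      (\<Sum>i. ennreal (diameter (U i) powr t)) < ennreal e \<Longrightarrow> False"
  shows "ereal t \<le> hausdorff_dim A"
  unfolding hausdorff_dim_def
proof (rule Inf_greatest, clarify)
  fix s :: real assume s: "0 \<le> s" "hausdorff_measure s A = 0"
  show "ereal t \<le> ereal s"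
  proof (rule ccontr)
    assume "\<not> ereal t \<le> ereal s"
    then have st: "s < t" by simp
    have "hausdorff_premeasure s 1 A \<le> hausdorff_measure s A"
      unfolding hausdorff_measure_def by (intro SUP_upper) auto
    then have "hausdorff_premeasure s 1 A < ennreal e" using s(2) e by simp
    then obtain U :: "nat \<Rightarrow> 'a set" where U: "A \<subseteq> (\<Union>i. U i)" "\<And>i. bounded (U i)" "\<And>i. diameter (U i) \<le> 1"
      "(\<Sum>i. diam_powr s (U i)) < ennreal e"
      unfolding hausdorff_premeasure_def INF_less_iff by auto
    have "(\<Sum>i. ennreal (diameter (U i) powr t)) \<le> (\<Sum>i. diam_powr s (U i))"
      using s st t U by (intro suminf_le diam_powr_ge) auto
    then show False using no_cover[OF U(1,2)] U(4) by (meson le_less_trans)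
  qed
qed

lemma hausdorff_dim_mono: "A \<subseteq> B \<Longrightarrow> hausdorff_dim A \<le> hausdorff_dim B"
proof -
  assume AB: "A \<subseteq> B"
  have "hausdorff_measure s A \<le> hausdorff_measure s B" for s
    unfolding hausdorff_measure_def hausdorff_premeasure_def
    by (intro SUP_mono' INF_superset_mono) (use AB in auto)
  then have "hausdorff_measure s B = 0 \<Longrightarrow> hausdorff_measure s A = 0" for s
    by (metis le_zero_eq)
  then show ?thesis unfolding hausdorff_dim_def by (intro Inf_superset_mono) auto
qed

lemma hausdorff_dim_leI:
  assumes s: "0 \<le> s" and "\<And>t. s < t \<Longrightarrow> hausdorff_measure t A = 0"
  shows "hausdorff_dim A \<le> ereal s"
proof (rule ereal_le_epsilon2)
  fix e :: real assume "0 < e"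
  then have "ereal (s + e) \<in> {ereal s | s. 0 \<le> s \<and> hausdorff_measure s A = 0}"
    using assms by auto
  then show "hausdorff_dim A \<le> ereal s + ereal e"
    unfolding hausdorff_dim_def by (simp add: Inf_lower)
qed

lemma hausdorff_measure_0I:
  fixes A :: "'a::metric_space set"
  assumes "\<And>\<delta> e. 0 < \<delta> \<Longrightarrow> 0 < e \<Longrightarrow> \<exists>U :: nat \<Rightarrow> 'a set. A \<subseteq> (\<Union>i. U i) \<and>
    (\<forall>i. bounded (U i) \<and> diameter (U i) \<le> \<delta>) \<and> (\<Sum>i. diam_powr s (U i)) \<le> ennreal e"
  shows "hausdorff_measure s A = 0"
proof -
  have "hausdorff_premeasure s \<delta> A = 0" if \<delta>: "0 < \<delta>" for \<delta>
  proof -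
    have "hausdorff_premeasure s \<delta> A \<le> 0"
    proof (rule ennreal_le_epsilon)
      fix e :: real assume e: "0 < e"
      obtain U :: "nat \<Rightarrow> 'a set" where U: "A \<subseteq> (\<Union>i. U i)" "\<forall>i. bounded (U i) \<and> diameter (U i) \<le> \<delta>"
        "(\<Sum>i. diam_powr s (U i)) \<le> ennreal e"
        using assms[OF \<delta> e] by blast
      have "hausdorff_premeasure s \<delta> A \<le> (\<Sum>i. diam_powr s (U i))"
        unfolding hausdorff_premeasure_def by (intro INF_lower) (use U in auto)
      then show "hausdorff_premeasure s \<delta> A \<le> 0 + ennreal e" using U(3) by simp
    qed
    then show ?thesis by simp
  qed
  then show ?thesis unfolding hausdorff_measure_def by simp
qed

context missing_digit
begin

lemma diameter_cyl: "diameter (cyl k v) = 1 / real p ^ k"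
proof -
  have "(real v + 1) / real p ^ k - real v / real p ^ k = 1 / real p ^ k" by (simp add: diff_divide_distrib[symmetric])
  moreover have "real v / real p ^ k \<le> (real v + 1) / real p ^ k" by (intro divide_right_mono) auto
  ultimately show ?thesis by (auto simp: cyl_def)
qed

lemma diam_powr_cyl: "0 < t \<Longrightarrow> diam_powr t (cyl k v) = ennreal ((1 / real p ^ k) powr t)"
  using diameter_cyl[of k v] by (auto simp: diam_powr_def cyl_def divide_right_mono)

text \<open>Borel--Cantelli for Hausdorff measures: tails of a convergent series are the contents of
  covers of \<open>A\<close>. The pairs (j, v) are listed by \<open>prod_decode\<close>, with empty
  sets at the pairs that are left out.\<close>

lemma hausdorff_dim_le_cylinders:
  fixes V :: "nat \<Rightarrow> nat set" and K :: "nat \<Rightarrow> nat"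
  assumes s: "0 \<le> s" and fin: "\<And>j. finite (V j)" and K: "filterlim K at_top sequentially"
    and cover: "\<And>J. A \<subseteq> (\<Union>j\<in>{J..}. \<Union>v\<in>V j. cyl (K j) v)"
    and summ: "\<And>t. s < t \<Longrightarrow> summable (\<lambda>j. real (card (V j)) * (1 / real p ^ K j) powr t)"
  shows "hausdorff_dim A \<le> ereal s"
proof (rule hausdorff_dim_leI[OF s])
  fix t assume t: "s < t"
  then have t0: "0 < t" using s by simp
  define a where "a j = real (card (V j)) * (1 / real p ^ K j) powr t" for j
  have a0: "0 \<le> a j" for j by (simp add: a_def)
  have a: "summable a" unfolding a_def by (rule summ[OF t])
  show "hausdorff_measure t A = 0"
  proof (rule hausdorff_measure_0I)
    fix \<delta> e :: real assume \<delta>: "0 < \<delta>" and e: "0 < e"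
    obtain J1 where J1: "norm (\<Sum>i. a (i + J1)) < e"
      using suminf_exist_split[OF e a] by blast
    obtain k0 where k0: "(1 / real p) ^ k0 < \<delta>" using real_arch_pow_inv[OF \<delta>, of "1 / real p"] p2 by auto
    have "\<forall>\<^sub>F j in sequentially. k0 \<le> K j" using K by (simp add: filterlim_at_top)
    then obtain J2 where J2: "\<And>j. J2 \<le> j \<Longrightarrow> k0 \<le> K j" by (auto simp: eventually_sequentially)
    define J where "J = max J1 J2"
    have diam: "1 / real p ^ K j \<le> \<delta>" if "J \<le> j" for j
    proof -
      have "(1 / real p) ^ K j \<le> (1 / real p) ^ k0" using J2[of j] that p2 by (intro power_decreasing) (auto simp: J_def)
      then show ?thesis using k0 by (simp add: power_one_over)
    qed
    define U where "U x = (case x of (j, v) \<Rightarrow> if J \<le> j \<and> v \<in> V j then cyl (K j) v else {})" for x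
    define g where "g j = (if J \<le> j then ennreal (a j) else 0)" for j
    have g: "g j = (\<Sum>v. diam_powr t (U (j, v)))" for j
    proof -
      have "(\<Sum>v. diam_powr t (U (j, v))) = (\<Sum>v\<in>V j. diam_powr t (U (j, v)))"
        by (rule suminf_finite[OF fin]) (simp add: U_def diam_powr_def)
      also have "\<dots> = (\<Sum>v\<in>V j. if J \<le> j then ennreal ((1 / real p ^ K j) powr t) else 0)"
        by (intro sum.cong refl) (simp add: U_def diam_powr_cyl[OF t0], simp add: diam_powr_def)
      also have "\<dots> = g j" by (simp add: g_def a_def ennreal_mult' ennreal_of_nat_eq_real_of_nat)
      finally show ?thesis ..
    qed
    have "(\<Sum>i. diam_powr t (U (prod_decode i))) = suminf g"
      using suminf_ennreal_2dimen[of g "\<lambda>x. diam_powr t (U x)"] g by simp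
    also have "\<dots> \<le> ennreal e"
    proof -
      have g': "g = (\<lambda>j. ennreal (if J \<le> j then a j else 0))" by (auto simp: g_def)
      have s1: "summable (\<lambda>j. if J \<le> j then a j else 0)"
        by (rule summable_comparison_test'[OF a, of 0]) (use a0 in auto)
      have "suminf g = ennreal (\<Sum>j. if J \<le> j then a j else 0)"
        unfolding g' using s1 a0 by (intro suminf_ennreal2) auto
      also have "(\<Sum>j. if J \<le> j then a j else 0) = (\<Sum>j. if J \<le> j + J1 then a (j + J1) else 0)"
        using suminf_split_initial_segment[OF s1, of J1] by (simp add: J_def)
      also have "\<dots> \<le> (\<Sum>j. a (j + J1))"
        using s1 a a0 by (intro suminf_le summable_ignore_initial_segment) auto
      finally have "suminf g \<le> ennreal (\<Sum>j. a (j + J1))" by (simp add: ennreal_leI)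
      also have "\<dots> \<le> ennreal e" using J1 by (intro ennreal_leI) auto
      finally show ?thesis .
    qed
    finally have sum: "(\<Sum>i. diam_powr t (U (prod_decode i))) \<le> ennreal e" .
    have "A \<subseteq> (\<Union>i. U (prod_decode i))"
    proof
      fix x assume "x \<in> A"
      then obtain j v where "J \<le> j" "v \<in> V j" "x \<in> cyl (K j) v" using cover[of J] by auto
      then have "x \<in> U (prod_decode (prod_encode (j, v)))" by (simp add: U_def)
      then show "x \<in> (\<Union>i. U (prod_decode i))" by blast
    qed
    moreover have "bounded (U x) \<and> diameter (U x) \<le> \<delta>" for x
      using diam \<delta> by (auto simp: U_def diameter_cyl split: prod.split) (auto simp: cyl_def)
    ultimately show "\<exists>U :: nat \<Rightarrow> real set. A \<subseteq> (\<Union>i. U i) \<and> (\<forall>i. bounded (U i) \<and> diameter (U i) \<le> \<delta>) \<and> (\<Sum>i. diam_powr t (U i)) \<le> ennreal e"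
      using sum by (intro exI[of _ "\<lambda>i. U (prod_decode i)"]) auto
  qed
qed

abbreviation Kset :: "real set" where "Kset \<equiv> missing_digit_set p D"

lemma closed_cyl: "closed (cyl k v)"
  by (simp add: cyl_def)

lemma cyl_borel [simp]: "cyl k v \<in> sets borel"
  by (simp add: closed_cyl borel_closed)

lemma emeasure_mu_cyl_pos: "v \<in> Wd k \<Longrightarrow> 0 < emeasure mu (cyl k v)"
proof -
  assume v: "v \<in> Wd k"
  interpret prob_space mu by (rule prob_mu)
  have "measure mu (cyl k v) = (\<Sum>u\<in>Wd k. measure (cm k u) (cyl k v)) / real (P ^ k)"
    using measure_cm_split[of "cyl k v" 0 0 k] by (simp add: cm_0)
  moreover have "measure (cm k v) (cyl k v) \<le> (\<Sum>u\<in>Wd k. measure (cm k u) (cyl k v))"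
    using v by (intro member_le_sum) auto
  ultimately have "0 < measure mu (cyl k v)" by (simp add: measure_cm_cyl)
  then show ?thesis by (simp add: emeasure_eq_measure)
qed

text \<open>The finitely many closed cylinders of a level carry the whole measure, so their
  complement is an open null set and misses the support.\<close>

lemma Kset_subset_cyls: "Kset \<subseteq> (\<Union>v\<in>Wd k. cyl k v)"
proof
  fix x assume x: "x \<in> Kset"
  show "x \<in> (\<Union>v\<in>Wd k. cyl k v)"
  proof (rule ccontr)
    define U where "U = - (\<Union>v\<in>Wd k. cyl k v)"
    assume "x \<notin> (\<Union>v\<in>Wd k. cyl k v)"
    then have "x \<in> U" by (simp add: U_def)
    moreover have "open U" unfolding U_def by (intro open_Compl closed_UN) (auto simp: closed_cyl)
    ultimately have pos: "0 < emeasure mu U" using x by (auto simp: missing_digit_set_def measure_support_def)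
    have Us: "U \<in> sets borel" using \<open>open U\<close> by simp
    have "measure mu U = (\<Sum>u\<in>Wd k. measure (cm k u) U) / real (P ^ k)"
      using measure_cm_split[OF Us, of 0 0 k] by (simp add: cm_0)
    also have "(\<Sum>u\<in>Wd k. measure (cm k u) U) = 0"
      by (intro sum.neutral ballI measure_cm_disjoint[OF Us]) (auto simp: U_def)
    finally have "measure mu U = 0" by simp
    then show False using pos
      by (simp add: finite_measure.emeasure_eq_measure[OF prob_space.finite_measure[OF prob_mu]])
  qed
qed

lemma in_Kset_of_cyls:
  assumes "\<And>n. \<exists>k v. n \<le> k \<and> v \<in> Wd k \<and> x \<in> cyl k v"
  shows "x \<in> Kset"
  unfolding missing_digit_set_def measure_support_def
proof (clarify)
  fix U :: "real set" assume U: "open U" "x \<in> U"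
  then obtain e where e: "0 < e" "\<And>y. dist y x < e \<Longrightarrow> y \<in> U" unfolding open_dist by blast
  obtain n where n: "(1 / real p) ^ n < e" using real_arch_pow_inv[OF e(1), of "1 / real p"] p2 by auto
  obtain k v where kv: "n \<le> k" "v \<in> Wd k" "x \<in> cyl k v" using assms by blast
  have "(1 / real p) ^ k \<le> (1 / real p) ^ n" using kv(1) p2 by (intro power_decreasing) auto
  then have small: "1 / real p ^ k < e" using n by (simp add: power_one_over)
  have "cyl k v \<subseteq> U"
  proof
    fix y assume y: "y \<in> cyl k v"
    have "\<bar>y - x\<bar> \<le> 1 / real p ^ k" by (rule cyl_dist[OF kv(3) y])
    then show "y \<in> U" using small e(2) by (simp add: dist_real_def)
  qed
  then have "emeasure mu (cyl k v) \<le> emeasure mu U" using U(1) by (intro emeasure_mono) auto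
  then show "0 < emeasure mu U" using emeasure_mu_cyl_pos[OF kv(2)] by simp
qed

text \<open>The similarity dimension; \<open>hausdorff_dim_Kset\<close> identifies it with the
  Hausdorff dimension.\<close>

definition dimK :: real where "dimK = ln (real P) / ln (real p)"

lemma p_powr_dimK: "real p powr dimK = real P"
  using p2 by (simp add: dimK_def powr_def)

lemma P_power: "real P ^ k = real p powr (dimK * real k)"
  unfolding powr_powr[symmetric] p_powr_dimK by (rule powr_realpow[symmetric]) simp

lemma dimK_nonneg: "0 \<le> dimK"
  using p2 P_pos by (simp add: dimK_def Suc_le_eq)

lemma dimK_le_1: "dimK \<le> 1"
  using p2 P_le P_pos by (simp add: dimK_def divide_le_eq)

lemma hausdorff_dim_Kset_le: "hausdorff_dim Kset \<le> ereal dimK"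
proof (rule hausdorff_dim_le_cylinders[where V = Wd and K = id])
  show "Kset \<subseteq> (\<Union>j\<in>{J..}. \<Union>v\<in>Wd j. cyl (id j) v)" for J
    using Kset_subset_cyls[of J] by auto
  fix t assume t: "dimK < t"
  have "real (card (Wd j)) * (1 / real p ^ id j) powr t = (real p powr (dimK - t)) ^ j" for j
  proof -
    have "1 / real p ^ j = real p powr (- real j)"
      using p_pos by (simp add: powr_minus_divide powr_realpow)
    then have "(1 / real p ^ j) powr t = real p powr (- real j * t)" by (simp only: powr_powr)
    then have "real (card (Wd j)) * (1 / real p ^ j) powr t = real p powr (dimK * real j + - real j * t)"
      by (simp only: card_Wd of_nat_power P_power powr_add id_apply)
    also have "\<dots> = real p powr ((dimK - t) * real j)" by (simp add: algebra_simps)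
    also have "\<dots> = (real p powr (dimK - t)) ^ j"
      unfolding powr_powr[symmetric] by (rule powr_realpow) (use p_pos in simp)
    finally show ?thesis by simp
  qed
  moreover have "real p powr (dimK - t) < 1"
    using p2 t by (simp add: powr_less_one)
  ultimately show "summable (\<lambda>j. real (card (Wd j)) * (1 / real p ^ id j) powr t)"
    by (simp add: summable_geometric)
qed (auto simp: dimK_nonneg id_def filterlim_ident)

end

subsection \<open>Fractions near the Cantor set\<close>

lemma abs_diff_fraction: "0 < q \<Longrightarrow> q * \<bar>x - n / q\<bar> = \<bar>q * x - n\<bar>" for q x n :: real
proof -
  assume q: "0 < q"
  have "q * \<bar>x - n / q\<bar> = \<bar>q * (x - n / q)\<bar>" using q by (simp add: abs_mult)
  also have "q * (x - n / q) = q * x - n" using q by (simp add: right_diff_distrib)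
  finally show ?thesis .
qed

context missing_digit
begin

text \<open>All grid intervals of the level count here, whether or not their digits are admissible.
  They are closed, so an interval of the same length can meet three of them.\<close>

lemma card_cyl_meeting:
  assumes "b - a \<le> 1 / real p ^ l"
  shows "finite {v. cyl l v \<inter> {a..b} \<noteq> {}}" "card {v. cyl l v \<inter> {a..b} \<noteq> {}} \<le> 3"
proof -
  define A where "A = a * real p ^ l"
  define m where "m = nat \<lceil>A - 1\<rceil>"
  have sub: "{v. cyl l v \<inter> {a..b} \<noteq> {}} \<subseteq> {m..m + 2}"
  proof
    fix v assume "v \<in> {v. cyl l v \<inter> {a..b} \<noteq> {}}"
    then obtain x where "x \<in> cyl l v" "x \<in> {a..b}" by blast
    then have x: "real v / real p ^ l \<le> x" "x \<le> (real v + 1) / real p ^ l" "a \<le> x" "x \<le> b"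
      by (simp_all add: cyl_def)
    have "a \<le> (real v + 1) / real p ^ l" "real v / real p ^ l \<le> a + 1 / real p ^ l" using x assms by linarith+
    then have "A \<le> real v + 1" "real v \<le> A + 1" by (simp_all add: A_def field_simps)
    then show "v \<in> {m..m + 2}" unfolding m_def by (auto; linarith)
  qed
  then show "finite {v. cyl l v \<inter> {a..b} \<noteq> {}}" using finite_subset by blast
  have "card {v. cyl l v \<inter> {a..b} \<noteq> {}} \<le> card {m..m + 2}" by (rule card_mono[OF _ sub]) simp
  then show "card {v. cyl l v \<inter> {a..b} \<noteq> {}} \<le> 3" by simp
qed

lemma measure_cm_le_finer:
  assumes X: "X \<in> sets borel" and S: "\<And>v. measure (cm l v) X \<le> S" and kl: "k \<le> l"
  shows "measure (cm k w) X \<le> S"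
proof -
  define m where "m = l - k"
  have l: "l = k + m" using kl by (simp add: m_def)
  have "measure (cm k w) X = (\<Sum>u\<in>Wd m. measure (cm (k + m) (w * p ^ m + u)) X) / real (P ^ m)"
    by (rule measure_cm_split[OF X])
  also have "\<dots> \<le> (\<Sum>u\<in>Wd m. S) / real (P ^ m)"
    by (intro divide_right_mono sum_mono) (use S l in auto)
  also have "\<dots> = S" using D_ne by simp
  finally show ?thesis .
qed

text \<open>At most three of the P^(l - k) subcylinders meet the interval, and each contributes at
  most \<open>S\<close> to the average.\<close>

lemma measure_cm_interval_le:
  assumes X: "X \<in> sets borel" and S: "\<And>v. measure (cm l v) X \<le> S" and kl: "k \<le> l"
    and ab: "b - a \<le> 1 / real p ^ l"
  shows "measure (cm k w) (X \<inter> {a..b}) \<le> 3 * S / real P ^ (l - k)"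
proof -
  define m where "m = l - k"
  have l: "l = k + m" using kl by (simp add: m_def)
  define T where "T = {u \<in> Wd m. cyl l (w * p ^ m + u) \<inter> {a..b} \<noteq> {}}"
  have S0: "0 \<le> S" using S[of 0] measure_nonneg order_trans by blast
  have Xs: "X \<inter> {a..b} \<in> sets borel" using X by auto
  have "card T \<le> card {v. cyl l v \<inter> {a..b} \<noteq> {}}"
    by (rule card_inj_on_le[where f = "\<lambda>u. w * p ^ m + u"])
       (use card_cyl_meeting[OF ab] in \<open>auto simp: T_def inj_on_def\<close>)
  then have T3: "card T \<le> 3" using card_cyl_meeting(2)[OF ab] by linarith
  have "measure (cm k w) (X \<inter> {a..b}) = (\<Sum>u\<in>Wd m. measure (cm l (w * p ^ m + u)) (X \<inter> {a..b})) / real (P ^ m)"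
    unfolding l by (rule measure_cm_split[OF Xs])
  also have "(\<Sum>u\<in>Wd m. measure (cm l (w * p ^ m + u)) (X \<inter> {a..b})) \<le> (\<Sum>u\<in>Wd m. if u \<in> T then S else 0)"
  proof (rule sum_mono)
    fix u assume u: "u \<in> Wd m"
    show "measure (cm l (w * p ^ m + u)) (X \<inter> {a..b}) \<le> (if u \<in> T then S else 0)"
    proof (cases "u \<in> T")
      case True
      have "measure (cm l (w * p ^ m + u)) (X \<inter> {a..b}) \<le> measure (cm l (w * p ^ m + u)) X"
        by (intro finite_measure.finite_measure_mono[OF prob_space.finite_measure[OF prob_cm]]) (use X in auto)
      also have "\<dots> \<le> S" by (rule S)
      finally show ?thesis using True by simp
    next
      case False
      then have "cyl l (w * p ^ m + u) \<inter> (X \<inter> {a..b}) = {}" using u by (auto simp: T_def)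
      then show ?thesis using measure_cm_disjoint[OF Xs] False by simp
    qed
  qed
  also have "\<dots> = real (card T) * S"
    by (simp add: sum.If_cases T_def Int_def)
  also have "\<dots> \<le> 3 * S" using T3 S0 by (intro mult_right_mono) auto
  finally show ?thesis by (simp add: divide_right_mono m_def)
qed

text \<open>Different fractions with denominators below 2 * Q are at least 1 / (4 * Q^2) apart, so
  two closer points, tolerances included, approximate the same fraction.\<close>

lemma near_block_same_fraction:
  assumes Q: "1 \<le> Q" and x: "x \<in> near_block Q \<epsilon>" "x' \<in> near_block Q \<epsilon>"
    and close: "\<bar>x - x'\<bar> + 2 * \<epsilon> / real Q < 1 / (4 * (real Q)\<^sup>2)"
    and f: "\<bar>x - of_int n / real q\<bar> \<le> \<epsilon> / real Q" "q \<in> {Q..<2*Q}"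
  shows "\<bar>x' - of_int n / real q\<bar> \<le> \<epsilon> / real Q"
proof -
  obtain q' where q': "q' \<in> {Q..<2*Q}" "infdist (real q' * x') \<int> \<le> \<epsilon>"
    using x(2) by (auto simp: near_block_def near_def)
  then obtain n' where n': "\<bar>real q' * x' - of_int n'\<bar> \<le> \<epsilon>" using infdist_Ints_le_iff by blast
  have qs: "real Q \<le> real q" "real q < 2 * real Q" "real Q \<le> real q'" "real q' < 2 * real Q" "0 < real Q"
    using q' f(2) Q by auto
  have \<epsilon>0: "0 \<le> \<epsilon>" using n' by linarith
  have f': "\<bar>x' - of_int n' / real q'\<bar> \<le> \<epsilon> / real Q"
  proof -
    have "real q' * \<bar>x' - of_int n' / real q'\<bar> = \<bar>real q' * x' - of_int n'\<bar>"
      using qs by (intro abs_diff_fraction) linarith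
    moreover have "real Q * \<bar>x' - of_int n' / real q'\<bar> \<le> real q' * \<bar>x' - of_int n' / real q'\<bar>"
      using qs by (intro mult_right_mono) auto
    ultimately have "real Q * \<bar>x' - of_int n' / real q'\<bar> \<le> \<epsilon>" using n' by linarith
    then show ?thesis unfolding pos_le_divide_eq[OF qs(5)] by (simp only: mult.commute)
  qed
  have "of_int n / real q = of_int n' / real q'"
  proof (rule ccontr)
    assume ne: "of_int n / real q \<noteq> of_int n' / real q'"
    have "n * int q' \<noteq> n' * int q"
    proof
      assume "n * int q' = n' * int q"
      then have "real_of_int (n * int q') = real_of_int (n' * int q)" by (rule arg_cong)
      then have "of_int n * real q' = of_int n' * real q" by (simp only: of_int_mult of_int_of_nat_eq)
      then show False using ne qs by (subst (asm) frac_eq_eq) auto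
    qed
    then have "1 \<le> \<bar>n * int q' - n' * int q\<bar>" by linarith
    then have "1 \<le> \<bar>real_of_int (n * int q' - n' * int q)\<bar>" by linarith
    moreover have "of_int n / real q - of_int n' / real q' = real_of_int (n * int q' - n' * int q) / (real q * real q')"
      using qs by (subst diff_frac_eq) auto
    ultimately have "1 / (real q * real q') \<le> \<bar>of_int n / real q - of_int n' / real q'\<bar>"
      using qs by (simp add: abs_divide abs_mult divide_right_mono)
    moreover have "1 / (4 * (real Q)\<^sup>2) \<le> 1 / (real q * real q')"
    proof -
      have "real q * real q' \<le> (2 * real Q) * (2 * real Q)" using qs by (intro mult_mono) auto
      then show ?thesis using qs by (intro divide_left_mono) (auto simp: power2_eq_square)
    qed
    moreover have "\<bar>of_int n / real q - of_int n' / real q'\<bar> \<le> \<bar>x - x'\<bar> + 2 * (\<epsilon> / real Q)"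
      using f(1) f' by linarith
    ultimately show False using close by simp
  qed
  then show ?thesis using f' by simp
qed

text \<open>Fractions with denominators in \<open>{Q..<2 * Q}\<close> are \<open>1 / (4 * Q\<^sup>2)\<close>-separated, so a short cylinder
  sees at most one of them.\<close>

lemma measure_near_block_short_cyl:
  assumes Q: "1 \<le> Q" and \<epsilon>: "0 \<le> \<epsilon>"
    and short: "1 / real p ^ L + 2 * \<epsilon> / real Q < 1 / (4 * (real Q)\<^sup>2)"
    and n: "2 * \<epsilon> / real Q \<le> 1 / real p ^ (L + n)"
  shows "measure (cm L v) (near_block Q \<epsilon>) \<le> 3 / real P ^ n"
proof (cases "cyl L v \<inter> near_block Q \<epsilon> = {}")
  case True
  then show ?thesis using measure_cm_disjoint[of "near_block Q \<epsilon>" L v] by simp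
next
  case False
  then obtain x where x: "x \<in> cyl L v" "x \<in> near_block Q \<epsilon>" by blast
  then obtain q where q: "q \<in> {Q..<2*Q}" "infdist (real q * x) \<int> \<le> \<epsilon>"
    by (auto simp: near_block_def near_def)
  then obtain i where i: "\<bar>real q * x - of_int i\<bar> \<le> \<epsilon>" using infdist_Ints_le_iff by blast
  have qQ: "real Q \<le> real q" "0 < real Q" using q(1) Q by auto
  define f where "f = of_int i / real q"
  have f: "\<bar>x - f\<bar> \<le> \<epsilon> / real Q"
  proof -
    have "real q * \<bar>x - f\<bar> = \<bar>real q * x - of_int i\<bar>"
      unfolding f_def using qQ by (intro abs_diff_fraction) linarith
    moreover have "real Q * \<bar>x - f\<bar> \<le> real q * \<bar>x - f\<bar>" using qQ by (intro mult_right_mono) auto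
    ultimately have "real Q * \<bar>x - f\<bar> \<le> \<epsilon>" using i by linarith
    then show ?thesis unfolding pos_le_divide_eq[OF qQ(2)] by (simp only: mult.commute)
  qed
  have sub: "x' \<in> {f - \<epsilon> / real Q..f + \<epsilon> / real Q}" if "x' \<in> cyl L v" "x' \<in> near_block Q \<epsilon>" for x'
  proof -
    have "\<bar>x - x'\<bar> \<le> 1 / real p ^ L" by (rule cyl_dist[OF that(1) x(1)])
    then have "\<bar>x' - f\<bar> \<le> \<epsilon> / real Q"
      unfolding f_def using short f
      by (intro near_block_same_fraction[OF Q x(2) that(2) _ _ q(1)]) (auto simp: f_def)
    then show ?thesis by auto
  qed
  have "measure (cm L v) (near_block Q \<epsilon>) \<le> measure (cm L v) (UNIV \<inter> {f - \<epsilon> / real Q..f + \<epsilon> / real Q})"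
  proof (rule finite_measure.finite_measure_mono_AE[OF prob_space.finite_measure[OF prob_cm]])
    show "AE x in cm L v. x \<in> near_block Q \<epsilon> \<longrightarrow> x \<in> UNIV \<inter> {f - \<epsilon> / real Q..f + \<epsilon> / real Q}"
      using AE_cm_cyl by eventually_elim (use sub in auto)
  qed auto
  also have "\<dots> \<le> 3 * 1 / real P ^ (L + n - L)"
    by (rule measure_cm_interval_le[where l = "L + n"]) (use n measure_cm_le_1 in auto)
  finally show ?thesis by simp
qed

text \<open>Counting by measure: a cylinder of \<open>V\<close> that meets the interval lies in
  \<open>X\<close> and in the interval enlarged by one cylinder length at each end, so it adds a
  full 1 to the average over subcylinders. The enlargement turns \<open>r\<close> into
  \<open>3 * r\<close>.\<close>

lemma card_hits_le:
  assumes X: "X \<in> sets borel" and V: "V \<subseteq> Wd m" "\<And>u. u \<in> V \<Longrightarrow> cyl (k + m) (w * p ^ m + u) \<subseteq> X"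
    and kl: "k \<le> l" and S: "\<And>v. measure (cm l v) X \<le> S"
    and r: "1 / real p ^ (k + m) \<le> r" "3 * r \<le> 1 / real p ^ l" "b - a \<le> r"
  shows "real (card {u \<in> V. cyl (k + m) (w * p ^ m + u) \<inter> {a..b} \<noteq> {}}) \<le> 3 * S * real P ^ m / real P ^ (l - k)"
proof -
  define a' where "a' = a - 1 / real p ^ (k + m)"
  define b' where "b' = b + 1 / real p ^ (k + m)"
  define T where "T = {u \<in> V. cyl (k + m) (w * p ^ m + u) \<inter> {a..b} \<noteq> {}}"
  have T: "T \<subseteq> Wd m" using V(1) by (auto simp: T_def)
  have Xs: "X \<inter> {a'..b'} \<in> sets borel" using X by auto
  have one: "measure (cm (k + m) (w * p ^ m + u)) (X \<inter> {a'..b'}) = 1" if u: "u \<in> T" for u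
  proof (rule measure_cm_cyl[OF Xs])
    obtain z where z: "z \<in> cyl (k + m) (w * p ^ m + u)" "a \<le> z" "z \<le> b" using u by (auto simp: T_def)
    have "cyl (k + m) (w * p ^ m + u) \<subseteq> {a'..b'}"
    proof
      fix y assume y: "y \<in> cyl (k + m) (w * p ^ m + u)"
      have "\<bar>y - z\<bar> \<le> 1 / real p ^ (k + m)" by (rule cyl_dist[OF z(1) y])
      then show "y \<in> {a'..b'}" using z(2,3) by (auto simp: a'_def b'_def)
    qed
    moreover have "cyl (k + m) (w * p ^ m + u) \<subseteq> X" using V(2) u by (auto simp: T_def)
    ultimately show "cyl (k + m) (w * p ^ m + u) \<subseteq> X \<inter> {a'..b'}" by blast
  qed
  have "real (card T) = (\<Sum>u\<in>T. measure (cm (k + m) (w * p ^ m + u)) (X \<inter> {a'..b'}))" using one by simp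
  also have "\<dots> \<le> (\<Sum>u\<in>Wd m. measure (cm (k + m) (w * p ^ m + u)) (X \<inter> {a'..b'}))"
    by (intro sum_mono2 T) auto
  also have "\<dots> = measure (cm k w) (X \<inter> {a'..b'}) * real (P ^ m)"
    unfolding measure_cm_split[OF Xs, of k w m] using D_ne by simp
  also have "\<dots> \<le> 3 * S / real P ^ (l - k) * real (P ^ m)"
  proof (intro mult_right_mono measure_cm_interval_le[OF X S kl])
    show "b' - a' \<le> 1 / real p ^ l" using r by (simp add: a'_def b'_def)
  qed simp
  finally show ?thesis by (simp add: T_def)
qed

end

section \<open>Targets and child cylinders for a fixed exponent\<close>

lemma real_power_bracket:
  fixes p :: nat and X :: real
  assumes p: "2 \<le> p" and X: "1 \<le> X"
  obtains n where "real p ^ n \<le> X" "X < real p ^ (n + 1)"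
proof -
  have "1 \<le> nat \<lfloor>X\<rfloor>" using X by (simp add: le_nat_iff)
  then obtain n where n: "p ^ n \<le> nat \<lfloor>X\<rfloor>" "nat \<lfloor>X\<rfloor> < p ^ (n + 1)"
    using ex_power_ivl1[OF p] by blast
  have "real p ^ n \<le> real (nat \<lfloor>X\<rfloor>)" using n(1) by (metis of_nat_le_iff of_nat_power)
  moreover have "real (nat \<lfloor>X\<rfloor>) + 1 \<le> real p ^ (n + 1)" using n(2) by (metis Suc_leI of_nat_Suc of_nat_le_iff of_nat_power add.commute)
  moreover have "real (nat \<lfloor>X\<rfloor>) \<le> X" "X < real (nat \<lfloor>X\<rfloor>) + 1" using X by linarith+
  ultimately show thesis using that[of n] by linarith
qed

locale approximation_exponent = missing_digit_l1 +
  fixes \<nu> :: real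
  assumes p3: "3 \<le> p" and \<nu>: "1 < \<nu>" and \<nu>\<tau>: "(1 + \<nu>) * \<tau> < 1"
begin

text \<open>For tolerance Q powr (- \<nu>) in a cylinder of length Q powr (- s) the error has
  exponent s + (1 + \<nu>) * \<tau>, the main term exponent 1. Up to constants, \<rho> is the
  largest admissible s.\<close>

definition \<rho> :: real where "\<rho> = 1 - (1 + \<nu>) * \<tau>"

text \<open>Equal to 2 / (\<nu> + 1) + dimK - 1. The target has measure about Q powr (1 - \<nu>), so
  it should contain about Q powr ((\<nu> + 1) * dimK + 1 - \<nu>) cylinders of length Q powr (-
  (\<nu> + 1)), and \<open>dstar\<close> is the quotient of these exponents.\<close>

definition dstar :: real where "dstar = dimK - (\<nu> - 1) / (\<nu> + 1)"

definition den :: "nat \<Rightarrow> real" where "den j = real p ^ j"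

definition X\<^sub>\<nu> :: "nat \<Rightarrow> real" where "X\<^sub>\<nu> j = (2 * den j) powr (\<nu> + 1)"

text \<open>At this level a cylinder has length at most half of \<open>1 / X\<^sub>\<nu> j\<close>,
  which is eps j / (2 * den j). Moving within it therefore changes q * x by at most eps j / 2, for
  each q of the block.\<close>

definition lev :: "nat \<Rightarrow> nat" where
  "lev j = (SOME k. 2 * X\<^sub>\<nu> j \<le> real p ^ k \<and> real p ^ k \<le> 2 * real p * X\<^sub>\<nu> j)"

lemma \<rho>: "0 < \<rho>" "\<rho> < 1"
  using \<nu>\<tau> \<nu> \<tau> by (auto simp: \<rho>_def)

lemma den_ge_1: "1 \<le> den j" "0 < den j"
  using p2 by (auto simp: den_def)

lemma X1: "1 \<le> X\<^sub>\<nu> j"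
  unfolding X\<^sub>\<nu>_def using den_ge_1[of j] \<nu> by (intro ge_one_powr_ge_zero) auto

lemma lev: "2 * X\<^sub>\<nu> j \<le> real p ^ lev j" "real p ^ lev j \<le> 2 * real p * X\<^sub>\<nu> j"
proof -
  obtain n where n: "real p ^ n \<le> 2 * X\<^sub>\<nu> j" "2 * X\<^sub>\<nu> j < real p ^ (n + 1)"
    using real_power_bracket[OF p2, of "2 * X\<^sub>\<nu> j"] X1[of j] by auto
  have "2 * X\<^sub>\<nu> j \<le> real p ^ (n + 1) \<and> real p ^ (n + 1) \<le> 2 * real p * X\<^sub>\<nu> j"
    using n mult_left_mono[OF n(1), of "real p"] by simp
  then have "\<exists>k. 2 * X\<^sub>\<nu> j \<le> real p ^ k \<and> real p ^ k \<le> 2 * real p * X\<^sub>\<nu> j" by blast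
  from someI_ex[OF this] show "2 * X\<^sub>\<nu> j \<le> real p ^ lev j" "real p ^ lev j \<le> 2 * real p * X\<^sub>\<nu> j"
    unfolding lev_def by blast+
qed

text \<open>The value of q powr (- \<nu>) at the end 2 * den j of the block, hence a tolerance that
  suits all its denominators.\<close>

definition eps :: "nat \<Rightarrow> real" where "eps j = (2 * den j) powr (- \<nu>)"

lemma eps: "0 < eps j" "eps j = 2 * den j / X\<^sub>\<nu> j" "eps j \<le> den j powr (- \<nu>)"
proof -
  show "0 < eps j" using den_ge_1(2)[of j] by (simp add: eps_def)
  have "(2 * den j) powr (- \<nu>) = (2 * den j) powr 1 / (2 * den j) powr (\<nu> + 1)"
    unfolding powr_diff[symmetric] by simp
  then show "eps j = 2 * den j / X\<^sub>\<nu> j" using den_ge_1(2)[of j] by (simp add: eps_def X\<^sub>\<nu>_def)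
  show "eps j \<le> den j powr (- \<nu>)"
    unfolding eps_def using den_ge_1(2)[of j] \<nu> by (intro powr_mono2') auto
qed

abbreviation target :: "nat \<Rightarrow> real set" where "target j \<equiv> near_block (p ^ j) (eps j)"

text \<open>For such levels the error p^l * Q powr ((\<nu> + 1) * \<tau>) is of order at most Q, so
  the target has, up to a constant, no more than its expected share Q * eps in each
  cylinder.\<close>

lemma measure_target_le:
  assumes l: "real p ^ l \<le> den j powr \<rho>" and e8: "eps j \<le> 1 / 8"
  shows "measure (cm l v) (target j) \<le> 16 * (3 + 10 * C) * den j powr (1 - \<nu>)"
proof -
  have "measure (cm l v) (target j) \<le> 16 * eps j * (3 * real (p ^ j) + 5 * C * real p ^ l * (real (p ^ j) / (8 * eps j)) powr \<tau>)"
    by (rule measure_near_block_le) (use eps e8 p2 in \<open>auto simp: Suc_le_eq\<close>)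
  also have "\<dots> \<le> 16 * eps j * (3 * den j + 5 * C * (2 * den j))"
  proof -
    have "den j / (8 * eps j) = X\<^sub>\<nu> j / 16" using den_ge_1(2)[of j] X1[of j] by (simp add: eps(2))
    then have "den j / (8 * eps j) \<le> X\<^sub>\<nu> j" using X1[of j] by simp
    then have "(den j / (8 * eps j)) powr \<tau> \<le> X\<^sub>\<nu> j powr \<tau>"
      using den_ge_1(2)[of j] eps(1)[of j] \<tau> by (intro powr_mono2) auto
    also have "\<dots> = 2 powr ((\<nu> + 1) * \<tau>) * den j powr ((\<nu> + 1) * \<tau>)"
      using den_ge_1(2)[of j] by (simp add: X\<^sub>\<nu>_def powr_powr powr_mult)
    also have "\<dots> \<le> 2 * den j powr ((\<nu> + 1) * \<tau>)"
    proof (rule mult_right_mono)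
      have "2 powr ((\<nu> + 1) * \<tau>) \<le> 2 powr (1::real)" using \<nu>\<tau> by (intro powr_mono) (auto simp: add.commute)
      then show "2 powr ((\<nu> + 1) * \<tau>) \<le> (2::real)" by simp
    qed simp
    finally have A: "(den j / (8 * eps j)) powr \<tau> \<le> 2 * den j powr ((\<nu> + 1) * \<tau>)" .
    have "real p ^ l * (den j / (8 * eps j)) powr \<tau> \<le> den j powr \<rho> * (2 * den j powr ((\<nu> + 1) * \<tau>))"
      using A l by (intro mult_mono) auto
    also have "\<dots> = 2 * den j"
      using den_ge_1(2)[of j] by (simp add: powr_add[symmetric] \<rho>_def add.commute)
    finally have "C * (real p ^ l * (den j / (8 * eps j)) powr \<tau>) \<le> C * (2 * den j)"
      using C_pos by (intro mult_left_mono) auto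
    then show ?thesis using eps(1)[of j] by (intro mult_left_mono) (auto simp: den_def mult_ac)
  qed
  also have "\<dots> = 16 * (3 + 10 * C) * (eps j * den j)" by (simp add: algebra_simps)
  also have "\<dots> \<le> 16 * (3 + 10 * C) * den j powr (1 - \<nu>)"
  proof -
    have "eps j * den j \<le> den j powr (- \<nu>) * den j" using eps(3) den_ge_1(2)[of j] by (intro mult_right_mono) auto
    also have "\<dots> = den j powr (1 - \<nu>)" using den_ge_1(2)[of j] powr_mult_base[of "den j" "- \<nu>"] by (simp add: mult.commute)
    finally show ?thesis using C_pos by (intro mult_left_mono) auto
  qed
  finally show ?thesis .
qed

text \<open>A cylinder of level 2 * j + 2 has length at most 1 / (9 * den^2), and 1/9 + 1/8 < 1/4,
  so it sees a single fraction. Giving up three levels below \<open>lev j\<close> absorbs the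
  constants: the target around that fraction is no longer than a cylinder of level
  \<open>lev j - 3\<close>.\<close>

lemma measure_target_le_trivial:
  assumes big: "16 * den j \<le> (2 * den j) powr \<nu>" and lev_ge: "2 * j + 5 \<le> lev j" and l: "l \<le> 2 * j + 2"
  shows "measure (cm l v) (target j) \<le> 3 / real P ^ (lev j - 2 * j - 5)"
proof (rule measure_cm_le_finer[OF _ _ l])
  fix v
  define L where "L = 2 * j + 2"
  define n where "n = lev j - 2 * j - 5"
  have yy: "0 < den j" "0 < X\<^sub>\<nu> j" using den_ge_1(2)[of j] X1[of j] by auto
  have e: "2 * eps j / den j = 4 / X\<^sub>\<nu> j" using yy by (simp add: eps(2))
  have X: "X\<^sub>\<nu> j = (2 * den j) powr \<nu> * (2 * den j)"
    using yy by (simp add: X\<^sub>\<nu>_def powr_add)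
  have X32: "32 * (den j)\<^sup>2 \<le> X\<^sub>\<nu> j"
  proof -
    have "16 * den j * (2 * den j) \<le> (2 * den j) powr \<nu> * (2 * den j)" using big yy by (intro mult_right_mono) auto
    then show ?thesis unfolding X by (simp add: power2_eq_square)
  qed
  have pL: "real p ^ L = (real p)\<^sup>2 * (den j)\<^sup>2" by (simp add: L_def den_def power_add power_mult power2_eq_square power_mult_distrib)
  have p9: "9 \<le> (real p)\<^sup>2" using power_mono[of 3 "real p" 2] p3 by simp
  have Ln: "L + n = lev j - 3" using lev_ge by (simp add: L_def n_def)
  show "measure (cm (2 * j + 2) v) (target j) \<le> 3 / real P ^ (lev j - 2 * j - 5)"
    unfolding L_def[symmetric] n_def[symmetric]
  proof (rule measure_near_block_short_cyl)
    have "1 / real p ^ L \<le> 1 / (9 * (den j)\<^sup>2)"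
      unfolding pL using p9 yy by (intro divide_left_mono mult_right_mono) auto
    moreover have "2 * eps j / den j \<le> 1 / (8 * (den j)\<^sup>2)"
    proof -
      have "4 / X\<^sub>\<nu> j \<le> 4 / (32 * (den j)\<^sup>2)" using X32 yy by (intro divide_left_mono) auto
      then show ?thesis unfolding e by simp
    qed
    moreover have "1 / (9 * (den j)\<^sup>2) + 1 / (8 * (den j)\<^sup>2) < 1 / (4 * (den j)\<^sup>2)" using yy by (simp add: field_simps)
    ultimately show "1 / real p ^ L + 2 * eps j / real (p ^ j) < 1 / (4 * (real (p ^ j))\<^sup>2)"
      by (simp add: den_def)
    have "real p ^ (lev j - 3) * real p ^ 3 = real p ^ lev j" using lev_ge by (simp flip: power_add)
    also have "\<dots> \<le> 2 * real p * X\<^sub>\<nu> j" by (rule lev(2))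
    finally have "(real p ^ (lev j - 3) * (real p)\<^sup>2) * real p \<le> (2 * X\<^sub>\<nu> j) * real p"
      by (simp add: power2_eq_square power3_eq_cube mult_ac)
    then have "real p ^ (lev j - 3) * (real p)\<^sup>2 \<le> 2 * X\<^sub>\<nu> j" using p_pos by simp
    moreover have "real p ^ (lev j - 3) * 9 \<le> real p ^ (lev j - 3) * (real p)\<^sup>2" using p9 by (intro mult_left_mono) auto
    moreover have "0 < real p ^ (lev j - 3)" using p_pos by simp
    ultimately have "4 * real p ^ (lev j - 3) \<le> X\<^sub>\<nu> j" by linarith
    then have "4 / X\<^sub>\<nu> j \<le> 1 / real p ^ (lev j - 3)" using yy p_pos by (simp add: field_simps)
    then show "2 * eps j / real (p ^ j) \<le> 1 / real p ^ (L + n)" using e unfolding Ln by (simp add: den_def)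
  qed (use eps(1)[of j] p2 in \<open>auto simp: Suc_le_eq\<close>)
qed simp

text \<open>Fractions are first approximated with half the tolerance, 1 / N \<le> eps / 2. The other
  half covers the passage from a point to its whole cylinder.\<close>

definition N :: "nat \<Rightarrow> nat" where "N j = nat \<lceil>2 * (2 * den j) powr \<nu>\<rceil>"

lemma N: "2 * (2 * den j) powr \<nu> \<le> real (N j)" "real (N j) \<le> 3 * (2 * den j) powr \<nu>"
proof -
  have "1 \<le> (2 * den j) powr \<nu>" using den_ge_1[of j] \<nu> by (intro ge_one_powr_ge_zero) auto
  then show "2 * (2 * den j) powr \<nu> \<le> real (N j)" "real (N j) \<le> 3 * (2 * den j) powr \<nu>"
    unfolding N_def by linarith+
qed

definition children :: "nat \<Rightarrow> nat \<Rightarrow> nat \<Rightarrow> nat set" where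
  "children k w j = {u \<in> Wd (lev j - k). cyl (lev j) (w * p ^ (lev j - k) + u) \<inter> near_block (p ^ j) (1 / real (N j)) \<noteq> {}}"

lemma children_subset: "children k w j \<subseteq> Wd (lev j - k)" "finite (children k w j)"
  by (auto simp: children_def)

lemma children_near:
  assumes u: "u \<in> children k w j"
  obtains q where "q \<in> {p^j..<2*p^j}" "cyl (lev j) (w * p ^ (lev j - k) + u) \<subseteq> near q (eps j)"
proof -
  obtain x where x: "x \<in> cyl (lev j) (w * p ^ (lev j - k) + u)" "x \<in> near_block (p ^ j) (1 / real (N j))"
    using u by (auto simp: children_def)
  then obtain q where q: "q \<in> {p^j..<2*p^j}" "infdist (real q * x) \<int> \<le> 1 / real (N j)"
    by (auto simp: near_block_def near_def)
  have yy: "0 < den j" "0 < X\<^sub>\<nu> j" using den_ge_1(2)[of j] X1[of j] by auto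
  have qy: "real q \<le> 2 * den j" using q(1) unfolding den_def
    by (metis atLeastLessThan_iff less_imp_le of_nat_le_iff of_nat_mult of_nat_numeral of_nat_power)
  have 1: "1 / real (N j) \<le> eps j / 2"
  proof -
    have "1 / real (N j) \<le> 1 / (2 * (2 * den j) powr \<nu>)" using N(1)[of j] yy by (intro divide_left_mono) (auto intro!: mult_pos_pos order.strict_trans2[OF _ N(1)])
    then show ?thesis using yy by (simp add: eps_def powr_minus_divide)
  qed
  have 2: "real q / real p ^ lev j \<le> eps j / 2"
  proof -
    have "real q / real p ^ lev j \<le> 2 * den j / (2 * X\<^sub>\<nu> j)" using qy lev(1)[of j] yy by (intro frac_le) auto
    then show ?thesis by (simp add: eps(2))
  qed
  have "cyl (lev j) (w * p ^ (lev j - k) + u) \<subseteq> near q (eps j)"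
  proof
    fix z assume z: "z \<in> cyl (lev j) (w * p ^ (lev j - k) + u)"
    have "infdist (real q * z) \<int> \<le> infdist (real q * x) \<int> + real q / real p ^ lev j"
      by (rule infdist_mult_cyl[OF x(1) z])
    then show "z \<in> near q (eps j)" unfolding near_def mem_Collect_eq using 1 2 q(2) by linarith
  qed
  then show thesis using that q(1) by blast
qed

lemma children_subset_target: "u \<in> children k w j \<Longrightarrow> cyl (lev j) (w * p ^ (lev j - k) + u) \<subseteq> target j"
  using children_near unfolding near_block_def by (metis UN_upper order_trans)

text \<open>The children cover all that \<open>cm k w\<close> gives to the target of half tolerance,
  and each has only the share 1 / P^(lev j - k). A lower bound for the measure thus becomes one for
  their number.\<close>

lemma card_children_ge:
  assumes kl: "k \<le> lev j" and N8: "16 * den j \<le> (2 * den j) powr \<nu>"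
    and small: "6400 * (1 + log 2 (den j)) * C * real p ^ k * (den j * (3 * (2 * den j) powr \<nu>)) powr \<tau> \<le> den j"
  shows "real P ^ (lev j - k) * den j powr (1 - \<nu>) / (30000 * 2 powr \<nu>) \<le> real (card (children k w j))"
proof -
  define m where "m = lev j - k"
  have lm: "lev j = k + m" using kl by (simp add: m_def)
  define E where "E = near_block (p ^ j) (1 / real (N j))"
  have yy: "0 < den j" "1 \<le> den j" using den_ge_1[of j] by auto
  have "real (8 * p ^ j) < real (N j)" using N(1)[of j] N8 yy by (simp add: den_def)
  then have N8': "8 * p ^ j < N j" by (simp only: of_nat_less_iff)
  have "real (p ^ j) / (10000 * real (N j)) \<le> measure (cm k w) E"
    unfolding E_def
  proof (rule measure_near_block_ge[OF Err_le _ _ _ N8'])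
    have "(den j * real (N j)) powr \<tau> \<le> (den j * (3 * (2 * den j) powr \<nu>)) powr \<tau>"
      using N(2)[of j] yy \<tau> by (intro powr_mono2 mult_left_mono) auto
    moreover have "0 \<le> log 2 (den j)" using yy by simp
    ultimately have "6400 * (1 + log 2 (den j)) * C * real p ^ k * (den j * real (N j)) powr \<tau>
      \<le> 6400 * (1 + log 2 (den j)) * C * real p ^ k * (den j * (3 * (2 * den j) powr \<nu>)) powr \<tau>"
      using C_pos by (intro mult_left_mono) auto
    then show "6400 * (1 + log 2 (real (p ^ j))) * C * real p ^ k * (real (p ^ j) * real (N j)) powr \<tau> \<le> real (p ^ j)"
      using small by (simp add: den_def)
  qed (use C_pos \<tau> p2 in \<open>auto simp: Suc_le_eq\<close>)
  also have "measure (cm k w) E = (\<Sum>u\<in>Wd m. measure (cm (lev j) (w * p ^ m + u)) E) / real (P ^ m)"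
    unfolding lm by (rule measure_cm_split) (simp add: E_def)
  also have "(\<Sum>u\<in>Wd m. measure (cm (lev j) (w * p ^ m + u)) E) \<le> (\<Sum>u\<in>Wd m. if u \<in> children k w j then 1 else 0)"
  proof (rule sum_mono)
    fix u assume u: "u \<in> Wd m"
    show "measure (cm (lev j) (w * p ^ m + u)) E \<le> (if u \<in> children k w j then 1 else 0)"
    proof (cases "u \<in> children k w j")
      case False
      then have "cyl (lev j) (w * p ^ m + u) \<inter> E = {}" using u by (auto simp: children_def E_def m_def)
      then show ?thesis using measure_cm_disjoint[of E] False by (simp add: E_def)
    qed (simp add: measure_cm_le_1)
  qed
  also have "(\<Sum>u\<in>Wd m. if u \<in> children k w j then 1 else (0::real)) = real (card (children k w j))"
    using children_subset[of k w j] by (simp add: sum.If_cases Int_absorb1 m_def)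
  finally have "real (p ^ j) / (10000 * real (N j)) \<le> real (card (children k w j)) / real (P ^ m)"
    using P_pos by (simp add: divide_right_mono)
  then have le: "den j / (10000 * real (N j)) * real P ^ m \<le> real (card (children k w j))"
    using P_pos by (simp add: den_def pos_le_divide_eq)
  have "den j powr (1 - \<nu>) / (30000 * 2 powr \<nu>) \<le> den j / (10000 * real (N j))"
  proof -
    have "den j powr (1 - \<nu>) / (30000 * 2 powr \<nu>) = den j / (10000 * (3 * (2 * den j) powr \<nu>))"
      using yy by (simp add: powr_diff powr_mult)
    also have "\<dots> \<le> den j / (10000 * real (N j))"
      using N(2)[of j] N8' yy by (intro divide_left_mono mult_left_mono) auto
    finally show ?thesis .
  qed
  then have "den j powr (1 - \<nu>) / (30000 * 2 powr \<nu>) * real P ^ m \<le> den j / (10000 * real (N j)) * real P ^ m"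
    by (intro mult_right_mono) auto
  then show ?thesis using le by (simp add: m_def mult_ac)
qed

end

context missing_digit
begin

lemma power_powr_dimK: "(real p ^ n) powr dimK = real P ^ n"
proof -
  have "(real p ^ n) powr dimK = (real p powr real n) powr dimK" using p_pos by (simp add: powr_realpow)
  also have "\<dots> = real P ^ n" unfolding P_power powr_powr by (simp add: mult.commute)
  finally show ?thesis .
qed

end

lemma powr_le_self: "1 \<le> x \<Longrightarrow> a \<le> 1 \<Longrightarrow> x powr a \<le> (x::real)"
  using powr_mono[of a 1 x] by simp

section \<open>How many children an interval can meet\<close>

context approximation_exponent
begin

definition hits :: "nat \<Rightarrow> nat \<Rightarrow> nat \<Rightarrow> real \<Rightarrow> real \<Rightarrow> nat" where
  "hits k w j a b = card {u \<in> children k w j. cyl (lev j) (w * p ^ (lev j - k) + u) \<inter> {a..b} \<noteq> {}}"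

lemma hits_le_3: "b - a \<le> 1 / real p ^ lev j \<Longrightarrow> hits k w j a b \<le> 3"
proof -
  assume ab: "b - a \<le> 1 / real p ^ lev j"
  have "hits k w j a b \<le> card {v. cyl (lev j) v \<inter> {a..b} \<noteq> {}}"
    unfolding hits_def
    by (rule card_inj_on_le[where f = "\<lambda>u. w * p ^ (lev j - k) + u"])
       (use card_cyl_meeting[OF ab] in \<open>auto simp: inj_on_def\<close>)
  then show ?thesis using card_cyl_meeting(2)[OF ab] by linarith
qed

lemma hits_le_card: "hits k w j a b \<le> card (children k w j)"
  unfolding hits_def by (intro card_mono children_subset) auto

lemma hits_le:
  assumes kl: "k \<le> l" "k \<le> lev j" and S: "\<And>v. measure (cm l v) (target j) \<le> S"
    and r: "1 / real p ^ lev j \<le> r" "3 * r \<le> 1 / real p ^ l" "b - a \<le> r"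
  shows "real (hits k w j a b) \<le> 3 * S * real P ^ (lev j - k) / real P ^ (l - k)"
proof -
  have lm: "k + (lev j - k) = lev j" using kl by simp
  have "real (card {u \<in> children k w j. cyl (k + (lev j - k)) (w * p ^ (lev j - k) + u) \<inter> {a..b} \<noteq> {}})
    \<le> 3 * S * real P ^ (lev j - k) / real P ^ (l - k)"
    by (rule card_hits_le[OF _ children_subset(1) _ kl(1) S])
       (use r children_subset_target in \<open>simp_all add: lm\<close>)
  then show ?thesis by (simp add: hits_def lm)
qed

definition l1 :: "nat \<Rightarrow> nat" where "l1 j = nat \<lfloor>\<rho> * real j\<rfloor>"

lemma den_powr: "den j powr a = real p powr (a * real j)"
proof -
  have "den j powr a = (real p powr real j) powr a" using p_pos by (simp add: den_def powr_realpow)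
  then show ?thesis by (simp add: powr_powr mult.commute)
qed

lemma l1: "real p ^ l1 j \<le> den j powr \<rho>" "den j powr \<rho> \<le> real p * real p ^ l1 j" "l1 j \<le> j"
proof -
  have r: "real (l1 j) \<le> \<rho> * real j" "\<rho> * real j \<le> 1 + real (l1 j)"
    unfolding l1_def using \<rho> by (simp_all, linarith)
  have "real p powr real (l1 j) \<le> real p powr (\<rho> * real j)" using r p2 by (intro powr_mono) auto
  then show "real p ^ l1 j \<le> den j powr \<rho>" using p_pos by (simp add: den_powr powr_realpow)
  have "real p powr (\<rho> * real j) \<le> real p powr (1 + real (l1 j))" using r p2 by (intro powr_mono) auto
  then show "den j powr \<rho> \<le> real p * real p ^ l1 j" using p_pos by (simp add: den_powr powr_realpow powr_add)
  have "\<rho> * real j \<le> 1 * real j" using \<rho> by (intro mult_right_mono) auto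
  then show "l1 j \<le> j" using r(1) by simp
qed

definition c0 :: real where "c0 = 30000 * 2 powr \<nu>"

text \<open>Collects the requirements on a large \<open>j\<close> for a given level
  \<open>k\<close>; by \<open>eventually_good\<close> they hold from some j on. The third gives 2 *
  j + 5 \<le> lev j, the fourth k + 2 \<le> l1 j.\<close>

definition good :: "nat \<Rightarrow> nat \<Rightarrow> bool" where
  "good k j \<longleftrightarrow> 16 * den j \<le> (2 * den j) powr \<nu> \<and>
    6400 * (1 + log 2 (den j)) * C * real p ^ k * (den j * (3 * (2 * den j) powr \<nu>)) powr \<tau> \<le> den j \<and>
    real p ^ 5 * (den j)\<^sup>2 \<le> 2 * X\<^sub>\<nu> j \<and> real p ^ (k + 3) \<le> den j powr \<rho> \<and> eps j \<le> 1 / 8"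

lemma goodD:
  assumes "good k j"
  shows "16 * den j \<le> (2 * den j) powr \<nu>" "eps j \<le> 1 / 8" "2 * j + 5 \<le> lev j" "k + 2 \<le> l1 j" "k \<le> lev j"
    "real P ^ (lev j - k) * den j powr (1 - \<nu>) \<le> c0 * real (card (children k w j))"
proof -
  show 1: "16 * den j \<le> (2 * den j) powr \<nu>" and "eps j \<le> 1 / 8" using assms by (auto simp: good_def)
  have "real p ^ (2 * j + 5) = real p ^ 5 * (den j)\<^sup>2"
    by (simp add: den_def power_add power_mult mult.commute)
  also have "\<dots> \<le> real p ^ lev j" using assms lev(1)[of j] by (simp add: good_def)
  finally show l: "2 * j + 5 \<le> lev j" using p2 by simp
  have "real p ^ (k + 3) \<le> real p * real p ^ l1 j" using assms l1(2)[of j] by (simp add: good_def)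
  also have "\<dots> = real p ^ (l1 j + 1)" by simp
  finally have "k + 3 \<le> l1 j + 1" using p2 by (subst (asm) power_increasing_iff) auto
  then show k: "k + 2 \<le> l1 j" by simp
  show kl: "k \<le> lev j" using k l1(3)[of j] l by linarith
  have "real P ^ (lev j - k) * den j powr (1 - \<nu>) / c0 \<le> real (card (children k w j))"
    unfolding c0_def by (rule card_children_ge[OF kl 1]) (use assms in \<open>simp add: good_def\<close>)
  moreover have "0 < c0" by (simp add: c0_def)
  ultimately show "real P ^ (lev j - k) * den j powr (1 - \<nu>) \<le> c0 * real (card (children k w j))"
    by (simp add: pos_divide_le_eq mult.commute)
qed

text \<open>Two readings of the number of children: as a fraction den powr (1 - \<nu>) of all
  cylinders of level \<open>lev j\<close>, and relative to the den powr (2 * dimK) cylinders of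
  length den powr (-2). The second shows the loss that \<open>hits_fine\<close> has to make
  good.\<close>

lemma dstar_eq: "(\<nu> + 1) * dstar = (\<nu> + 1) * dimK + (1 - \<nu>)" "(\<nu> + 1) * dstar = 2 * dimK - (1 - dimK) * (\<nu> - 1)"
  using \<nu> by (simp_all add: dstar_def field_simps)

text \<open>Children have length of order den powr (- (\<nu> + 1)); for a fixed parent their number
  is at least a constant times this length to the power \<open>- dstar\<close>. This is the source
  of the dimension.\<close>

lemma card_children_ge_powr:
  assumes "good k j"
  shows "den j powr ((\<nu> + 1) * dstar) \<le> c0 * real P ^ k * real (card (children k w j))"
proof -
  have yX: "den j powr (\<nu> + 1) \<le> real p ^ lev j"
  proof -
    have "den j powr (\<nu> + 1) \<le> X\<^sub>\<nu> j" unfolding X\<^sub>\<nu>_def using den_ge_1(2)[of j] \<nu> by (intro powr_mono2) auto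
    then show ?thesis using lev(1)[of j] X1[of j] by linarith
  qed
  have "den j powr ((\<nu> + 1) * dstar) = (den j powr (\<nu> + 1)) powr dimK * den j powr (1 - \<nu>)"
    by (simp only: dstar_eq(1) powr_powr powr_add[of _ "(\<nu> + 1) * dimK" "1 - \<nu>"])
  also have "\<dots> \<le> (real p ^ lev j) powr dimK * den j powr (1 - \<nu>)"
    using yX dimK_nonneg by (intro mult_right_mono powr_mono2) auto
  also have "\<dots> = real P ^ k * (real P ^ (lev j - k) * den j powr (1 - \<nu>))"
    unfolding power_powr_dimK using goodD(5)[OF assms] by (simp flip: power_add mult.assoc)
  also have "\<dots> \<le> real P ^ k * (c0 * real (card (children k w j)))"
    by (intro mult_left_mono goodD(6)[OF assms]) simp
  finally show ?thesis by (simp add: mult_ac)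
qed

text \<open>At scales \<open>r \<ge> p ^ (- l1 j)\<close> the children are distributed as the measure itself.\<close>

lemma hits_coarse:
  assumes g: "good k j" and r: "1 / real p ^ lev j \<le> r" "1 / real p ^ l1 j \<le> r" "b - a \<le> r"
  shows "real (hits k w j a b)
    \<le> (3 + 144 * (3 + 10 * C) * c0 * real p) * real (card (children k w j)) * (r * real p ^ k) powr dimK"
proof -
  define V where "V = real (card (children k w j))"
  define K where "K = 144 * (3 + 10 * C) * c0 * real p"
  have K0: "0 \<le> K" using C_pos by (simp add: K_def c0_def)
  have V0: "0 \<le> V" by (simp add: V_def)
  have r0: "0 < r" using r(1) p_pos by (meson divide_pos_pos less_le_trans of_nat_0_less_iff zero_less_one zero_less_power)
  define R where "R = (r * real p ^ k) powr dimK"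
  have R0: "0 \<le> R" by (simp add: R_def)
  show ?thesis
  proof (cases "3 * r \<le> 1 / real p ^ k")
    case False
    \<comment> \<open>An interval comparable to the parent may meet all children; then (r * p^k)
      powr dimK is at least 1/3 and the trivial bound suffices.\<close>
    then have "1 / 3 \<le> r * real p ^ k" using p_pos by (simp add: field_simps)
    then have "(1 / 3) powr dimK \<le> R" unfolding R_def using dimK_nonneg by (intro powr_mono2) auto
    moreover have "(1 / 3 :: real) powr 1 \<le> (1 / 3) powr dimK" using dimK_le_1 by (intro powr_mono') auto
    ultimately have "1 \<le> 3 * R" by simp
    then have "V * 1 \<le> V * (3 * R)" using V0 by (intro mult_left_mono) auto
    moreover have "real (hits k w j a b) \<le> V" using hits_le_card[of k w j a b] by (simp add: V_def)
    moreover have "0 \<le> K * V * R" using K0 V0 R0 by simp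
    ultimately have "real (hits k w j a b) \<le> (3 + K) * V * R" by (simp add: algebra_simps)
    then show ?thesis by (simp add: V_def K_def R_def)
  next
    case True
    have pk: "real p ^ k \<le> 1 / (3 * r)" using True r0 p_pos by (simp add: field_simps)
    moreover have "1 \<le> real p ^ k" using p2 by (intro one_le_power) auto
    ultimately have "1 \<le> 1 / (3 * r)" by linarith
    then obtain n where n: "real p ^ n \<le> 1 / (3 * r)" "1 / (3 * r) < real p ^ (n + 1)"
      using real_power_bracket[OF p2] by blast
    have "real p ^ k < real p ^ (n + 1)" using pk n(2) by linarith
    then have kn: "k \<le> n" using p2 power_less_imp_less_exp[of "real p" k "n + 1"] by simp
    have rn: "3 * r \<le> 1 / real p ^ n" using n(1) r0 p_pos by (simp add: field_simps)
    have "real p ^ n \<le> den j powr \<rho>"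
    proof -
      have "1 / (3 * r) \<le> 1 / r" using r0 by (simp add: field_simps)
      also have "\<dots> \<le> real p ^ l1 j" using r(2) r0 p_pos by (simp add: field_simps)
      finally show ?thesis using n(1) l1(1)[of j] by linarith
    qed
    then have "real (hits k w j a b) \<le> 3 * (16 * (3 + 10 * C) * den j powr (1 - \<nu>)) * real P ^ (lev j - k) / real P ^ (n - k)"
      by (intro hits_le[where r = r] kn goodD(5)[OF g] measure_target_le goodD(2)[OF g] r rn)
    also have "\<dots> = 48 * (3 + 10 * C) * (real P ^ (lev j - k) * den j powr (1 - \<nu>)) * (1 / real P ^ (n - k))"
      by simp
    also have "\<dots> \<le> 48 * (3 + 10 * C) * (c0 * V) * (3 * real p * R)"
    proof -
      have A: "real P ^ (lev j - k) * den j powr (1 - \<nu>) \<le> c0 * V" unfolding V_def by (rule goodD(6)[OF g])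
      have "1 / real P ^ (n - k) = real P ^ k / real P ^ n"
        using kn D_ne by (simp add: power_diff)
      also have "\<dots> = (real p ^ k / real p ^ n) powr dimK"
        by (simp add: power_powr_dimK powr_divide)
      also have "\<dots> \<le> (3 * real p * (r * real p ^ k)) powr dimK"
      proof (rule powr_mono2[OF dimK_nonneg])
        have "1 \<le> 3 * real p * r * real p ^ n" using n(2) r0 by (simp add: field_simps)
        then have "real p ^ k * 1 \<le> real p ^ k * (3 * real p * r * real p ^ n)" by (intro mult_left_mono) auto
        then show "real p ^ k / real p ^ n \<le> 3 * real p * (r * real p ^ k)" using p_pos by (simp add: field_simps)
      qed (use p_pos in simp)
      also have "\<dots> = (3 * real p) powr dimK * R" using r0 by (simp add: R_def powr_mult)
      also have "\<dots> \<le> 3 * real p * R"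
        using p2 dimK_le_1 R0 by (intro mult_right_mono powr_le_self) auto
      finally have B: "1 / real P ^ (n - k) \<le> 3 * real p * R" .
      show ?thesis using C_pos V0 by (intro mult_mono[OF mult_left_mono[OF A] B]) (auto simp: c0_def)
    qed
    also have "\<dots> = K * V * R" by (simp add: K_def)
    also have "\<dots> \<le> (3 + K) * V * R" using V0 R0 by (intro mult_right_mono) auto
    finally show ?thesis by (simp add: V_def K_def R_def)
  qed
qed

text \<open>Below that scale nothing is known about the distribution; it suffices that an interval of length
  \<open>den j powr (-2)\<close> sees at most one fraction.\<close>

lemma hits_fine:
  assumes g: "good k j" and r: "1 / real p ^ lev j \<le> r" "r < 1 / real p ^ l1 j" "b - a \<le> r"
    and t: "0 \<le> t" "t \<le> dstar" "(1 - dimK) * (\<nu> - 1) \<le> \<rho> * (dimK - t)"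
  shows "real (hits k w j a b) \<le> 9 * (3 * real p ^ 7 + real P ^ 3 * (2 * real p * 2 powr (\<nu> + 1))) * c0
     * real P ^ k * real (card (children k w j)) * r powr t"
proof -
  define V where "V = real (card (children k w j))"
  define Y where "Y = den j powr ((\<nu> + 1) * dstar)"
  have yy: "0 < den j" "1 \<le> den j" using den_ge_1[of j] by auto
  have r0: "0 < r" using r(1) p_pos by (meson divide_pos_pos less_le_trans of_nat_0_less_iff zero_less_one zero_less_power)
  have "0 \<le> (\<nu> - 1) / (\<nu> + 1)" using \<nu> by simp
  then have td: "t \<le> dimK" using t(2) unfolding dstar_def by linarith
  have pl1: "real p ^ l1 j < 1 / r" using r(2) r0 p_pos by (simp add: field_simps)
  have "real p ^ (k + 1) \<le> 1 / (3 * r)"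
  proof -
    have "real p ^ (k + 2) \<le> real p ^ l1 j" using goodD(4)[OF g] p2 by (intro power_increasing) auto
    moreover have "3 * real p ^ (k + 1) \<le> real p * real p ^ (k + 1)" using p3 by (intro mult_right_mono) auto
    moreover have "real p ^ (k + 2) = real p * real p ^ (k + 1)" by simp
    ultimately have "3 * real p ^ (k + 1) \<le> 1 / r" using pl1 by linarith
    then show ?thesis using r0 by (simp add: field_simps)
  qed
  moreover have "1 \<le> real p ^ (k + 1)" using p2 by (intro one_le_power) auto
  ultimately have pk: "real p ^ (k + 1) \<le> 1 / (3 * r)" "1 \<le> 1 / (3 * r)" by linarith+
  obtain n where n: "real p ^ n \<le> 1 / (3 * r)" "1 / (3 * r) < real p ^ (n + 1)"
    using real_power_bracket[OF p2 pk(2)] by blast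
  have "real p ^ (k + 1) < real p ^ (n + 1)" using pk(1) n(2) by linarith
  then have kn: "k \<le> n" using p2 power_less_imp_less_exp[of "real p" "k + 1" "n + 1"] by simp
  \<comment> \<open>The finest level adapted to \<open>r\<close>, capped at 2 * j + 2, where single
    fractions are already isolated.\<close>
  define l where "l = min n (2 * j + 2)"
  have kL: "k \<le> l" using kn goodD(4)[OF g] l1(3)[of j] by (simp add: l_def)
  have rl: "3 * r \<le> 1 / real p ^ l"
  proof -
    have "real p ^ l \<le> real p ^ n" using p2 by (intro power_increasing) (auto simp: l_def)
    then have "real p ^ l \<le> 1 / (3 * r)" using n(1) by linarith
    then show ?thesis using r0 p_pos by (simp add: field_simps)
  qed
  have lL: "l \<le> 2 * j + 2" by (simp add: l_def)
  have "real (hits k w j a b) \<le> 3 * (3 / real P ^ (lev j - 2 * j - 5)) * real P ^ (lev j - k) / real P ^ (l - k)"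
    by (intro hits_le[where r = r] kL goodD(5)[OF g] measure_target_le_trivial goodD(1)[OF g] goodD(3)[OF g] lL r rl)
  also have "\<dots> = 9 * real P ^ (2 * j + 5 - l)"
  proof -
    have e: "lev j - k = (lev j - 2 * j - 5) + (2 * j + 5 - l) + (l - k)"
      using lL kL goodD(3)[OF g] by linarith
    show ?thesis unfolding e power_add using D_ne by simp
  qed
  also have "real P ^ (2 * j + 5 - l) \<le> (3 * real p ^ 7 + real P ^ 3 * (2 * real p * 2 powr (\<nu> + 1))) * Y * r powr t"
  proof (cases "n \<le> 2 * j + 2")
    case True
    then have ln: "l = n" by (simp add: l_def)
    have "real P ^ (2 * j + 5 - l) = (real p ^ (2 * j + 5 - n)) powr dimK" unfolding ln power_powr_dimK ..
    also have "\<dots> \<le> (3 * real p ^ 6 * ((den j)\<^sup>2 * r)) powr dimK"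
    proof (rule powr_mono2[OF dimK_nonneg])
      have "real p ^ (2 * j + 5 - n) * real p ^ n = real p ^ 5 * (den j)\<^sup>2"
        using True by (simp add: den_def power_mult[symmetric] mult.commute add.commute flip: power_add)
      moreover have "real p ^ (2 * j + 5 - n) * 1 \<le> real p ^ (2 * j + 5 - n) * (3 * real p * r * real p ^ n)"
        using n(2) r0 by (intro mult_left_mono) (simp_all add: field_simps)
      ultimately have "real p ^ (2 * j + 5 - n) \<le> 3 * real p * r * (real p ^ 5 * (den j)\<^sup>2)" by (simp add: mult_ac)
      then show "real p ^ (2 * j + 5 - n) \<le> 3 * real p ^ 6 * ((den j)\<^sup>2 * r)" by (simp add: eval_nat_numeral mult_ac)
    qed simp
    also have "\<dots> = (3 * real p ^ 6) powr dimK * ((den j)\<^sup>2 powr dimK * (r powr t * r powr (dimK - t)))"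
      using r0 by (simp add: powr_mult powr_add[symmetric])
    also have "\<dots> \<le> (3 * real p ^ 6) * ((den j)\<^sup>2 powr dimK * (r powr t * (real p * den j powr (- ((1 - dimK) * (\<nu> - 1))))))"
    proof (intro mult_mono mult_left_mono powr_le_self dimK_le_1)
      have "1 \<le> real p ^ 6" using p2 by (intro one_le_power) auto
      then show "1 \<le> 3 * real p ^ 6" by linarith
      \<comment> \<open>Here r is at most p * den powr (- \<rho>), and the assumption on
        \<open>t\<close> turns the surplus exponent dimK - t into exactly the loss in
        \<open>dstar_eq(2)\<close>.\<close>
      have "r powr (dimK - t) \<le> (real p * den j powr (- \<rho>)) powr (dimK - t)"
      proof (intro powr_mono2)
        have "den j powr \<rho> * r \<le> real p * real p ^ l1 j * r" using l1(2)[of j] r0 by (intro mult_right_mono) auto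
        also have "\<dots> \<le> real p * 1" using pl1 r0 p_pos by (simp add: field_simps)
        finally show "r \<le> real p * den j powr (- \<rho>)" using yy by (simp add: powr_minus field_simps)
      qed (use td r0 in auto)
      also have "\<dots> = real p powr (dimK - t) * den j powr (- (\<rho> * (dimK - t)))"
        using yy by (simp add: powr_mult powr_powr)
      also have "\<dots> \<le> real p * den j powr (- ((1 - dimK) * (\<nu> - 1)))"
        using t p2 dimK_le_1 yy by (intro mult_mono powr_le_self powr_mono) auto
      finally show "r powr (dimK - t) \<le> real p * den j powr (- ((1 - dimK) * (\<nu> - 1)))" .
    qed (use r0 in auto)
    also have "\<dots> = 3 * real p ^ 7 * ((den j)\<^sup>2 powr dimK * den j powr (- ((1 - dimK) * (\<nu> - 1)))) * r powr t"
      by (simp add: eval_nat_numeral mult_ac)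
    also have "(den j)\<^sup>2 powr dimK * den j powr (- ((1 - dimK) * (\<nu> - 1))) = Y"
    proof -
      have "(den j)\<^sup>2 powr dimK = den j powr (2 * dimK)" using yy by (simp add: powr_powr flip: powr_numeral)
      then show ?thesis by (simp add: Y_def dstar_eq(2) powr_add[symmetric])
    qed
    finally have "real P ^ (2 * j + 5 - l) \<le> 3 * real p ^ 7 * Y * r powr t" .
    moreover have "0 \<le> real P ^ 3 * (2 * real p * 2 powr (\<nu> + 1)) * Y * r powr t" by (simp add: Y_def)
    ultimately show ?thesis unfolding distrib_right by linarith
  next
    case False
    \<comment> \<open>Below the spacing of the fractions the hits are bounded by a constant. Since
      \<open>r\<close> is not shorter than a child, \<open>Y * r powr t\<close> is bounded below,
      which is enough.\<close>
    then have l: "2 * j + 5 - l = 3" by (simp add: l_def)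
    define Z where "Z = 2 * real p * 2 powr (\<nu> + 1)"
    have Z1: "1 \<le> Z"
    proof -
      have "1 * 1 \<le> (2 * real p) * 2 powr (\<nu> + 1)" using p2 \<nu> by (intro mult_mono ge_one_powr_ge_zero) auto
      then show ?thesis by (simp add: Z_def)
    qed
    have "1 / (Z * den j powr (\<nu> + 1)) \<le> r"
    proof -
      have "2 * real p * X\<^sub>\<nu> j = Z * den j powr (\<nu> + 1)" using yy by (simp add: X\<^sub>\<nu>_def Z_def powr_mult)
      then have "real p ^ lev j \<le> Z * den j powr (\<nu> + 1)" using lev(2)[of j] by simp
      then have "1 / (Z * den j powr (\<nu> + 1)) \<le> 1 / real p ^ lev j" using p_pos by (intro frac_le) auto
      then show ?thesis using r(1) by linarith
    qed
    then have "(1 / (Z * den j powr (\<nu> + 1))) powr t \<le> r powr t" using Z1 t by (intro powr_mono2) auto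
    then have A: "1 / (Z powr t * den j powr ((\<nu> + 1) * t)) \<le> r powr t"
      using Z1 by (simp add: powr_divide powr_mult powr_powr)
    have "1 \<le> (Z powr t * den j powr ((\<nu> + 1) * t)) * r powr t"
      using A Z1 yy by (simp add: field_simps)
    also have "\<dots> \<le> (Z * Y) * r powr t"
    proof (intro mult_right_mono mult_mono)
      have "t \<le> 1" using td dimK_le_1 by linarith
      then show "Z powr t \<le> Z" by (rule powr_le_self[OF Z1])
      show "den j powr ((\<nu> + 1) * t) \<le> Y" unfolding Y_def using yy t \<nu> by (intro powr_mono mult_left_mono) auto
    qed (use Z1 in auto)
    finally have "real P ^ 3 * 1 \<le> real P ^ 3 * ((Z * Y) * r powr t)" by (intro mult_left_mono) auto
    moreover have "0 \<le> 3 * real p ^ 7 * Y * r powr t" by (simp add: Y_def)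
    moreover have "(3 * real p ^ 7 + real P ^ 3 * Z) * Y * r powr t = 3 * real p ^ 7 * Y * r powr t + real P ^ 3 * ((Z * Y) * r powr t)"
      by (simp only: distrib_right mult.assoc)
    ultimately show ?thesis unfolding l Z_def[symmetric] by linarith
  qed
  also have "\<dots> = (3 * real p ^ 7 + real P ^ 3 * (2 * real p * 2 powr (\<nu> + 1))) * r powr t * Y" by (simp only: mult_ac)
  also have "\<dots> \<le> (3 * real p ^ 7 + real P ^ 3 * (2 * real p * 2 powr (\<nu> + 1))) * r powr t * (c0 * real P ^ k * V)"
    unfolding Y_def V_def by (intro mult_left_mono card_children_ge_powr[OF g]) auto
  finally show ?thesis unfolding V_def by (simp only: mult_ac)
qed

end

subsection \<open>Nested cylinders evading a cover\<close>

context approximation_exponent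
begin

text \<open>The t-content of that part of the cover which still meets \<open>S\<close>;
  \<open>r i\<close> will be the length of an interval containing \<open>U i\<close>.\<close>

definition load :: "(nat \<Rightarrow> real set) \<Rightarrow> (nat \<Rightarrow> real) \<Rightarrow> real \<Rightarrow> real set \<Rightarrow> real" where
  "load U r t S = (\<Sum>i. if U i \<inter> S = {} then 0 else r i powr t)"

lemma summable_load:
  fixes r :: "nat \<Rightarrow> real"
  assumes "summable (\<lambda>i. r i powr t)"
  shows "summable (\<lambda>i. if U i \<inter> S = {} then 0 else r i powr t)"
  by (rule summable_comparison_test'[OF assms, of 0]) auto

lemma filterlim_den: "filterlim den at_top sequentially"
proof (rule filterlim_at_top_mono[OF filterlim_real_sequentially])
  show "\<forall>\<^sub>F j in sequentially. real j \<le> den j"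
  proof (rule always_eventually, rule allI)
    fix j
    have "j \<le> 2 ^ j" using less_exp[of j] by simp
    also have "\<dots> \<le> p ^ j" using p2 by (intro power_mono) auto
    finally show "real j \<le> den j" unfolding den_def by (metis of_nat_le_iff of_nat_power)
  qed
qed

lemma eventually_good: "\<forall>\<^sub>F j in sequentially. good k j"
proof -
  have p0: "0 < real p ^ k" "0 < real p ^ 5" "0 < real p ^ (k + 3)" by simp_all
  have "\<forall>\<^sub>F x in at_top. 16 * x \<le> (2 * x) powr \<nu>" using \<nu> by real_asymp
  moreover have "\<forall>\<^sub>F x in at_top. 6400 * (1 + log 2 x) * C * A * (x * (3 * (2 * x) powr \<nu>)) powr \<tau> \<le> x"
    if "0 < A" for A :: real
  proof -
    define \<sigma> where "\<sigma> = (1 + \<nu>) * \<tau>"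
    define B where "B = (3 * 2 powr \<nu>) powr \<tau>"
    have "\<sigma> < 1" "0 < B" using \<nu>\<tau> by (simp_all add: \<sigma>_def B_def)
    then have "\<forall>\<^sub>F x in at_top. 6400 * (1 + log 2 x) * C * A * (B * x powr \<sigma>) \<le> x"
      using that C_pos by real_asymp
    then show ?thesis using eventually_gt_at_top[of 0]
    proof eventually_elim
      case (elim x)
      have "x * (3 * (2 * x) powr \<nu>) = (3 * 2 powr \<nu>) * x powr (1 + \<nu>)"
        using elim by (simp add: powr_mult powr_add)
      then have "(x * (3 * (2 * x) powr \<nu>)) powr \<tau> = B * x powr \<sigma>"
        using elim by (simp only: powr_mult[of "3 * 2 powr \<nu>"] powr_powr B_def \<sigma>_def)
      then show ?case using elim by simp
    qed
  qed
  moreover have "\<forall>\<^sub>F x in at_top. A * x\<^sup>2 \<le> 2 * (2 * x) powr (\<nu> + 1)" if "0 < A" for A :: real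
    using \<nu> that by real_asymp
  moreover have "\<forall>\<^sub>F x in at_top. A \<le> x powr \<rho>" if "0 < A" for A :: real using \<rho> that by real_asymp
  moreover have "\<forall>\<^sub>F x in at_top. (2 * x) powr (- \<nu>) \<le> 1 / 8" using \<nu> by real_asymp
  ultimately have "\<forall>\<^sub>F x in at_top. 16 * x \<le> (2 * x) powr \<nu> \<and>
     6400 * (1 + log 2 x) * C * real p ^ k * (x * (3 * (2 * x) powr \<nu>)) powr \<tau> \<le> x \<and>
     real p ^ 5 * x\<^sup>2 \<le> 2 * (2 * x) powr (\<nu> + 1) \<and> real p ^ (k + 3) \<le> x powr \<rho> \<and> (2 * x) powr (- \<nu>) \<le> 1 / 8"
    using p0 by (intro eventually_conj) blast+
  from eventually_compose_filterlim[OF this filterlim_den] show ?thesis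
    by (simp add: good_def X\<^sub>\<nu>_def eps_def)
qed

text \<open>An interval that uses some share of the admissible load
  \<open>(1 / p ^ k) powr t'\<close> spoils at most half that share of the children, so all long
  intervals together spoil at most half. In the coarse range the load bound forces \<open>r\<close>
  to be much shorter than the parent, and the gain with exponent dimK * (t' / t - 1) beats the
  constants for large \<open>k\<close> (\<open>K1\<close>). In the fine range the reserve t'' - t
  does so for large \<open>j\<close> (\<open>K2\<close>).\<close>

lemma big_intervals_hit_few:
  assumes t: "0 < t" "t < t'" "t' < t''" "t'' \<le> dstar" "(1 - dimK) * (\<nu> - 1) \<le> \<rho> * (dimK - t'')"
    and g: "good k j"
    and K1: "(3 + 144 * (3 + 10 * C) * c0 * real p) * (1 / real p ^ k) powr (dimK * (t' / t - 1)) \<le> 1 / 2"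
    and K2: "9 * (3 * real p ^ 7 + real P ^ 3 * (2 * real p * 2 powr (\<nu> + 1))) * c0 * real P ^ k * (real p * den j powr (- \<rho>)) powr (t'' - t) \<le> 1 / 2"
    and r: "1 / real p ^ lev j \<le> r" "r powr t \<le> (1 / real p ^ k) powr t'"
  shows "real (hits k w j a (a + r)) \<le> real (card (children k w j)) / 2 * (r powr t / (1 / real p ^ k) powr t')"
proof -
  define V where "V = real (card (children k w j))"
  define d where "d = 1 / real p ^ k"
  have d: "0 < d" "d \<le> 1" using p2 by (auto simp: d_def)
  have V0: "0 \<le> V" by (simp add: V_def)
  have r0: "0 < r" using r(1) p_pos by (meson divide_pos_pos less_le_trans of_nat_0_less_iff zero_less_one zero_less_power)
  have "0 \<le> (\<nu> - 1) / (\<nu> + 1)" using \<nu> by simp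
  then have td: "t'' \<le> dimK" using t(4) unfolding dstar_def by linarith
  have split: "r powr b = r powr t * r powr (b - t)" for b using r0 by (simp add: powr_add[symmetric])
  show ?thesis
  proof (cases "1 / real p ^ l1 j \<le> r")
    case True
    define K where "K = 3 + 144 * (3 + 10 * C) * c0 * real p"
    have K0: "0 \<le> K" using C_pos by (simp add: K_def c0_def)
    have rd: "r powr (dimK - t) \<le> d powr (t' / t * (dimK - t))"
    proof -
      have "(r powr t) powr (1 / t) \<le> (d powr t') powr (1 / t)" using r(2) t by (intro powr_mono2) (auto simp: d_def)
      then have "r \<le> d powr (t' / t)" using r0 t by (simp add: powr_powr)
      then have "r powr (dimK - t) \<le> (d powr (t' / t)) powr (dimK - t)" using r0 td t by (intro powr_mono2) auto
      then show ?thesis by (simp add: powr_powr)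
    qed
    have "real (hits k w j a (a + r)) \<le> K * V * (r * real p ^ k) powr dimK"
      unfolding K_def V_def by (rule hits_coarse[OF g r(1) True]) simp
    also have "(r * real p ^ k) powr dimK = r powr t * (r powr (dimK - t) * d powr (- dimK))"
    proof -
      have "r * real p ^ k = r / d" by (simp add: d_def)
      then show ?thesis using r0 d by (simp add: powr_divide powr_minus_divide split[of dimK])
    qed
    also have "K * V * (r powr t * (r powr (dimK - t) * d powr (- dimK)))
      \<le> K * V * (r powr t * (d powr (t' / t * (dimK - t)) * d powr (- dimK)))"
      using K0 V0 by (intro mult_left_mono mult_right_mono rd mult_nonneg_nonneg) auto
    also have "d powr (t' / t * (dimK - t)) * d powr (- dimK) = d powr (dimK * (t' / t - 1)) * d powr (- t')"
      using t by (simp add: powr_add[symmetric] field_simps)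
    also have "K * V * (r powr t * (d powr (dimK * (t' / t - 1)) * d powr (- t')))
      = (K * d powr (dimK * (t' / t - 1))) * (V * (r powr t * d powr (- t')))" by (simp only: mult_ac)
    also have "\<dots> \<le> 1 / 2 * (V * (r powr t * d powr (- t')))"
      using K1 V0 unfolding K_def d_def by (intro mult_right_mono) auto
    also have "\<dots> = V / 2 * (r powr t / d powr t')" by (simp add: powr_minus_divide)
    finally show ?thesis by (simp add: V_def d_def)
  next
    case False
    define K where "K = 9 * (3 * real p ^ 7 + real P ^ 3 * (2 * real p * 2 powr (\<nu> + 1))) * c0 * real P ^ k"
    have K0: "0 \<le> K" by (simp add: K_def c0_def)
    have rl: "r \<le> real p * den j powr (- \<rho>)"
    proof -
      have "1 / real p ^ l1 j \<le> real p * den j powr (- \<rho>)"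
        using l1(2)[of j] p_pos den_ge_1(2)[of j] by (simp add: powr_minus field_simps)
      then show ?thesis using False by linarith
    qed
    have "real (hits k w j a (a + r)) \<le> K * V * r powr t''"
      unfolding K_def V_def by (rule hits_fine[OF g r(1)]) (use False t in auto)
    also have "\<dots> = K * V * (r powr t * r powr (t'' - t))" by (simp only: split[of t''])
    also have "\<dots> \<le> K * V * (r powr t * (real p * den j powr (- \<rho>)) powr (t'' - t))"
      using K0 V0 r0 rl t by (intro mult_left_mono powr_mono2 mult_nonneg_nonneg) auto
    also have "\<dots> = (K * (real p * den j powr (- \<rho>)) powr (t'' - t)) * (V * r powr t)" by (simp only: mult_ac)
    also have "\<dots> \<le> 1 / 2 * (V * r powr t)" using K2 V0 unfolding K_def by (intro mult_right_mono) auto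
    also have "\<dots> \<le> 1 / 2 * (V * (r powr t / d powr t'))"
    proof (intro mult_left_mono)
      have "d powr t' \<le> 1" using d t by (intro powr_le1) auto
      then show "r powr t \<le> r powr t / d powr t'" using d by (simp add: pos_le_divide_eq mult_left_le)
    qed (use V0 in auto)
    finally show ?thesis by (simp add: V_def d_def)
  qed
qed

text \<open>Long covering sets spoil at most half of the children. The others are met only by sets
  no longer than a child, each of which meets at most three children, so their loads add up to at
  most 3. By averaging, one child has load at most 6 / card V. This is below its length to the power
  t', because there are about length powr (- dstar) children and t' < dstar.\<close>

lemma cylinder_step:
  assumes t: "0 < t" "t < t'" "t' < t''" "t'' \<le> dstar" "(1 - dimK) * (\<nu> - 1) \<le> \<rho> * (dimK - t'')"
    and K1: "(3 + 144 * (3 + 10 * C) * c0 * real p) * (1 / real p ^ k) powr (dimK * (t' / t - 1)) \<le> 1 / 2"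
    and w: "w \<in> Wd k" and U: "\<And>i. U i \<subseteq> {a i..a i + r i}" and r: "\<And>i. 0 < r i"
    and summ: "summable (\<lambda>i. r i powr t)" and load: "load U r t (cyl k w) \<le> (1 / real p ^ k) powr t'"
  shows "\<exists>k' w' q. k < k' \<and> w' \<in> Wd k' \<and> cyl k' w' \<subseteq> cyl k w \<and> n \<le> q \<and> cyl k' w' \<subseteq> near q (real q powr (- \<nu>))
    \<and> load U r t (cyl k' w') \<le> (1 / real p ^ k') powr t'"
proof -
  define KK where "KK = 9 * (3 * real p ^ 7 + real P ^ 3 * (2 * real p * 2 powr (\<nu> + 1))) * c0 * real P ^ k"
  have KK0: "0 < KK" using p_pos P_pos by (simp add: KK_def c0_def add_pos_pos)
  \<comment> \<open>The 6 is 2 * 3: half of the children remain, and a short set is counted at most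
    three times.\<close>
  define K3 where "K3 = 6 * (c0 * real P ^ k) * (2 * real p * 2 powr (\<nu> + 1)) powr t'"
  have c00: "0 < c0 * real P ^ k" using D_ne by (simp add: c0_def card_gt_0_iff)
  have K30: "0 < K3" using c00 p_pos by (simp add: K3_def)
  have "\<forall>\<^sub>F x in at_top. KK * (real p * x powr (- \<rho>)) powr (t'' - t) \<le> 1 / 2"
  proof -
    have "0 < t'' - t" "0 < real p" using t by simp_all
    then show ?thesis using KK0 \<rho> by real_asymp
  qed
  moreover have "\<forall>\<^sub>F x in at_top. K3 * x powr ((\<nu> + 1) * t') \<le> x powr ((\<nu> + 1) * dstar)"
  proof -
    have "(\<nu> + 1) * t' < (\<nu> + 1) * dstar" using t \<nu> by simp
    then show ?thesis using K30 by real_asymp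
  qed
  moreover have "\<forall>\<^sub>F x in at_top. real n \<le> x" by (rule eventually_ge_at_top)
  ultimately have "\<forall>\<^sub>F x in at_top. KK * (real p * x powr (- \<rho>)) powr (t'' - t) \<le> 1 / 2 \<and>
      K3 * x powr ((\<nu> + 1) * t') \<le> x powr ((\<nu> + 1) * dstar) \<and> real n \<le> x"
    by eventually_elim simp
  from eventually_conj[OF eventually_compose_filterlim[OF this filterlim_den] eventually_good[of k]]
  obtain j where j: "KK * (real p * den j powr (- \<rho>)) powr (t'' - t) \<le> 1 / 2"
      "K3 * den j powr ((\<nu> + 1) * t') \<le> den j powr ((\<nu> + 1) * dstar)" "real n \<le> den j" "good k j"
    using eventually_happens'[OF sequentially_bot] by auto
  define V where "V = children k w j"
  define m where "m = lev j - k"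
  define v where "v u = w * p ^ m + u" for u
  define \<delta> where "\<delta> = 1 / real p ^ lev j"
  define D0 where "D0 = (1 / real p ^ k) powr t'"
  have lm: "lev j = k + m" using goodD(5)[OF j(4)] by (simp add: m_def)
  have V: "V \<subseteq> Wd m" "finite V" using children_subset[of k w j] by (auto simp: V_def m_def)
  have D0: "0 < D0" "D0 \<le> 1"
  proof -
    show "0 < D0" using p_pos by (simp add: D0_def)
    show "D0 \<le> 1" unfolding D0_def using p2 t by (intro powr_le1) (auto simp: divide_le_eq)
  qed
  have \<delta>0: "0 < \<delta>" by (simp add: \<delta>_def)
  have nV: "6 / \<delta> powr t' \<le> real (card V)"
  proof -
    have "den j powr ((\<nu> + 1) * dstar) \<le> c0 * real P ^ k * real (card V)"
      unfolding V_def by (rule card_children_ge_powr[OF j(4)])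
    then have "K3 * den j powr ((\<nu> + 1) * t') \<le> c0 * real P ^ k * real (card V)" using j(2) by linarith
    moreover have "6 * (c0 * real P ^ k) * (1 / \<delta>) powr t' \<le> K3 * den j powr ((\<nu> + 1) * t')"
    proof -
      have "1 / \<delta> \<le> (2 * real p * 2 powr (\<nu> + 1)) * den j powr (\<nu> + 1)"
        using lev(2)[of j] den_ge_1(2)[of j] by (simp add: \<delta>_def X\<^sub>\<nu>_def powr_mult)
      then have "(1 / \<delta>) powr t' \<le> ((2 * real p * 2 powr (\<nu> + 1)) * den j powr (\<nu> + 1)) powr t'"
        using t \<delta>0 by (intro powr_mono2) auto
      also have "\<dots> = (2 * real p * 2 powr (\<nu> + 1)) powr t' * den j powr ((\<nu> + 1) * t')"
        using p_pos by (simp only: powr_mult powr_powr)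
      finally show ?thesis unfolding K3_def mult.assoc using c00 by (intro mult_left_mono) (auto simp: c0_def)
    qed
    ultimately have "(c0 * real P ^ k) * (6 * (1 / \<delta>) powr t') \<le> (c0 * real P ^ k) * real (card V)" by (simp add: mult_ac)
    then have "6 * (1 / \<delta>) powr t' \<le> real (card V)" using c00 by (simp only: mult_le_cancel_left_pos)
    then show ?thesis using \<delta>0 by (simp add: powr_divide)
  qed
  have nV0: "0 < real (card V)"
    using nV \<delta>0 by (intro less_le_trans[OF _ nV]) simp
  have sub: "cyl (lev j) (v u) \<subseteq> cyl k w" if "u \<in> V" for u
    unfolding v_def lm by (rule cyl_child) (use V that Wd_less in auto)
  define e where "e i = (if U i \<inter> cyl k w = {} then 0 else r i powr t)" for i
  have se: "summable e" unfolding e_def by (rule summable_load[OF summ])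
  have e0: "0 \<le> e i" for i by (simp add: e_def)
  have S: "suminf e \<le> D0" using load unfolding load_def e_def D0_def .
  define H where "H i = {u \<in> V. cyl (lev j) (v u) \<inter> {a i..a i + r i} \<noteq> {}}" for i
  have H: "H i \<subseteq> V" "finite (H i)" "card (H i) = hits k w j (a i) (a i + r i)" for i
    using V by (auto simp: H_def hits_def V_def v_def m_def)
  have inH: "u \<in> H i" if "u \<in> V" "U i \<inter> cyl (lev j) (v u) \<noteq> {}" for i u
    using that U[of i] by (auto simp: H_def)
  define B where "B = {i. U i \<inter> cyl k w \<noteq> {} \<and> \<delta> < r i}"
  have Be: "\<delta> powr t < e i" if "i \<in> B" for i
    using that t \<delta>0 by (auto simp: B_def e_def intro!: powr_less_mono2)
  have finB: "finite B"
  proof -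
    have "e \<longlonglongrightarrow> 0" by (rule summable_LIMSEQ_zero[OF se])
    then have "\<forall>\<^sub>F i in sequentially. e i < \<delta> powr t" using \<delta>0 by (intro order_tendstoD) auto
    then obtain I where "\<And>i. I \<le> i \<Longrightarrow> e i < \<delta> powr t" by (auto simp: eventually_sequentially)
    then have "B \<subseteq> {..<I}" using Be by (meson lessThan_iff not_le order.asym subsetI)
    then show ?thesis using finite_subset by blast
  qed
  define Bad where "Bad = (\<Union>i\<in>B. H i)"
  have Bad: "Bad \<subseteq> V" using H by (auto simp: Bad_def)
  have "real (card Bad) \<le> (\<Sum>i\<in>B. real (card (H i)))"
    unfolding Bad_def using card_UN_le[OF finB, of H] by (simp flip: of_nat_sum)
  also have "\<dots> \<le> (\<Sum>i\<in>B. real (card V) / 2 * (e i / D0))"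
  proof (rule sum_mono)
    fix i assume i: "i \<in> B"
    then have ei: "e i = r i powr t" and ri: "\<delta> < r i" by (auto simp: B_def e_def)
    have "e i \<le> suminf e" using sum_le_suminf[OF se, of "{i}"] e0 by simp
    then have "r i powr t \<le> D0" using S ei by simp
    then show "real (card (H i)) \<le> real (card V) / 2 * (e i / D0)"
      unfolding H(3) ei V_def D0_def
      by (intro big_intervals_hit_few[OF t j(4) K1]) (use j(1) ri in \<open>auto simp: KK_def \<delta>_def D0_def\<close>)
  qed
  also have "\<dots> = real (card V) / 2 * ((\<Sum>i\<in>B. e i) / D0)"
    by (simp add: sum_distrib_left sum_divide_distrib)
  also have "\<dots> \<le> real (card V) / 2 * 1"
  proof (rule mult_left_mono)
    have "(\<Sum>i\<in>B. e i) \<le> suminf e" using finB e0 by (intro sum_le_suminf[OF se]) auto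
    then show "(\<Sum>i\<in>B. e i) / D0 \<le> 1" using S D0 by simp
  qed simp
  finally have cBad: "real (card Bad) \<le> real (card V) / 2" by simp
  define Gd where "Gd = V - Bad"
  have finG: "finite Gd" using V by (simp add: Gd_def)
  have cG: "real (card V) / 2 \<le> real (card Gd)"
    using cBad card_Diff_subset[of Bad V] Bad V finite_subset[OF Bad V(2)] card_mono[OF V(2) Bad]
    by (simp add: Gd_def of_nat_diff)
  define ld where "ld u = load U r t (cyl (lev j) (v u))" for u
  have "(\<Sum>u\<in>Gd. ld u) = (\<Sum>i. \<Sum>u\<in>Gd. if U i \<inter> cyl (lev j) (v u) = {} then 0 else r i powr t)"
    unfolding ld_def load_def by (rule suminf_sum[symmetric]) (rule summable_load[OF summ])
  also have "\<dots> \<le> (\<Sum>i. 3 * e i)"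
  proof (rule suminf_le)
    fix i
    define T where "T = {u \<in> Gd. U i \<inter> cyl (lev j) (v u) \<noteq> {}}"
    have "(\<Sum>u\<in>Gd. if U i \<inter> cyl (lev j) (v u) = {} then 0 else r i powr t) = (\<Sum>u\<in>T. r i powr t)"
      unfolding T_def by (subst sum.inter_filter[OF finG]) (intro sum.cong, auto)
    also have "\<dots> = real (card T) * r i powr t" by simp
    also have "\<dots> \<le> 3 * e i"
    proof (cases "T = {}")
      case False
      then obtain u where u: "u \<in> Gd" "U i \<inter> cyl (lev j) (v u) \<noteq> {}" by (auto simp: T_def)
      have ne: "U i \<inter> cyl k w \<noteq> {}" using u sub[of u] by (auto simp: Gd_def)
      have "i \<notin> B" using u inH[of u i] by (auto simp: Gd_def Bad_def)
      then have ri: "r i \<le> \<delta>" using ne by (simp add: B_def)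
      have "T \<subseteq> H i" using inH by (auto simp: T_def Gd_def)
      then have "card T \<le> card (H i)" by (intro card_mono H)
      also have "\<dots> \<le> 3" unfolding H(3) by (rule hits_le_3) (use ri in \<open>simp add: \<delta>_def\<close>)
      finally have "real (card T) \<le> 3" by simp
      then have "real (card T) * r i powr t \<le> 3 * r i powr t" by (intro mult_right_mono) auto
      then show ?thesis using ne by (simp add: e_def)
    qed (simp add: e0)
    finally show "(\<Sum>u\<in>Gd. if U i \<inter> cyl (lev j) (v u) = {} then 0 else r i powr t) \<le> 3 * e i" .
  qed (intro summable_sum summable_load summ, intro summable_mult se)
  also have "\<dots> = 3 * suminf e" by (rule suminf_mult[OF se])
  also have "\<dots> \<le> 3" using S D0 by simp
  finally have sum3: "(\<Sum>u\<in>Gd. ld u) \<le> 3" .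
  have "\<exists>u\<in>Gd. ld u \<le> 6 / real (card V)"
  proof (rule ccontr)
    assume "\<not> (\<exists>u\<in>Gd. ld u \<le> 6 / real (card V))"
    then have gt: "\<And>u. u \<in> Gd \<Longrightarrow> 6 / real (card V) < ld u" by auto
    have "Gd \<noteq> {}" using cG nV0 by auto
    then have "(\<Sum>u\<in>Gd. 6 / real (card V)) < (\<Sum>u\<in>Gd. ld u)" using finG gt by (intro sum_strict_mono) auto
    moreover have "3 \<le> (\<Sum>u\<in>Gd. 6 / real (card V))"
    proof -
      have "real (card V) / 2 * (6 / real (card V)) \<le> real (card Gd) * (6 / real (card V))"
        using cG by (intro mult_right_mono) auto
      then show ?thesis using nV0 by simp
    qed
    ultimately show False using sum3 by linarith
  qed
  then obtain u where u: "u \<in> V" "ld u \<le> 6 / real (card V)" by (auto simp: Gd_def)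
  have "6 / real (card V) \<le> \<delta> powr t'"
    using nV nV0 \<delta>0 by (simp add: field_simps)
  then have ldu: "load U r t (cyl (lev j) (v u)) \<le> (1 / real p ^ lev j) powr t'" using u(2) by (simp add: ld_def \<delta>_def)
  obtain q where q: "q \<in> {p^j..<2*p^j}" "cyl (lev j) (v u) \<subseteq> near q (eps j)"
    using children_near[of u k w j] u(1) unfolding V_def v_def m_def by blast
  have "p ^ j \<le> q" "q < 2 * p ^ j" using q(1) by auto
  then have "real (p ^ j) \<le> real q" "real q \<le> real (2 * p ^ j)" by (simp_all only: of_nat_le_iff)
  then have qy: "den j \<le> real q" "real q \<le> 2 * den j" by (simp_all add: den_def)
  have "eps j \<le> real q powr (- \<nu>)" unfolding eps_def using qy den_ge_1(2)[of j] \<nu> by (intro powr_mono2') auto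
  then have "cyl (lev j) (v u) \<subseteq> near q (real q powr (- \<nu>))" using q(2) near_mono by blast
  moreover have "v u \<in> Wd (lev j)" unfolding v_def lm by (rule Wd_add[OF w]) (use V u in auto)
  moreover have "k < lev j" using goodD(3,4)[OF j(4)] l1(3)[of j] by linarith
  moreover have "n \<le> q" using qy j(3) by simp
  ultimately show ?thesis using sub[OF u(1)] ldu by blast
qed

end

subsection \<open>Dimension of well approximable numbers in the Cantor set\<close>

text \<open>Adding e / 2^(i + 1) to the t-th powers makes every length positive, even for single
  points, at a total cost of \<open>e\<close>. It is this positivity that the limit argument
  contradicts.\<close>

lemma exists_interval_powr_eq:
  fixes U :: "nat \<Rightarrow> real set"
  assumes t: "0 < t" and e: "0 < e" and bd: "\<And>i. bounded (U i)"
    and fin: "(\<Sum>i. ennreal (diameter (U i) powr t)) < ennreal e"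
  obtains a r where "\<And>i. U i \<subseteq> {a i..a i + r i}" "\<And>i. 0 < r i" "summable (\<lambda>i. r i powr t)"
    "(\<Sum>i. r i powr t) \<le> 2 * e"
proof -
  define d where "d i = diameter (U i)" for i
  define b where "b i = d i powr t + e * (1 / 2) ^ Suc i" for i
  define r where "r i = b i powr (1 / t)" for i
  define a where "a i = (if U i = {} then 0 else Inf (U i))" for i
  have d0: "0 \<le> d i" for i unfolding d_def by (rule diameter_ge_0[OF bd])
  have b0: "0 < b i" for i using e by (simp add: b_def add_nonneg_pos)
  have rt: "r i powr t = b i" for i using t b0[of i] by (simp add: r_def powr_powr)
  have dr: "d i \<le> r i" for i
  proof -
    have "(d i powr t) powr (1 / t) \<le> b i powr (1 / t)" using t e by (intro powr_mono2) (auto simp: b_def)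
    then show ?thesis using t d0[of i] by (cases "d i = 0") (auto simp: r_def powr_powr)
  qed
  have sd: "summable (\<lambda>i. d i powr t)" "(\<Sum>i. d i powr t) \<le> e"
  proof -
    show s: "summable (\<lambda>i. d i powr t)" using fin by (intro summable_suminf_not_top) (auto simp: d_def)
    have "ennreal (\<Sum>i. d i powr t) = (\<Sum>i. ennreal (d i powr t))" using s by (intro suminf_ennreal2[symmetric]) auto
    then have "ennreal (\<Sum>i. d i powr t) < ennreal e" using fin unfolding d_def by (simp only:)
    then have "ennreal (\<Sum>i. d i powr t) \<le> ennreal e" by (rule less_imp_le)
    then show "(\<Sum>i. d i powr t) \<le> e" by (rule ennreal_le_iff[THEN iffD1, rotated]) (use e in simp)
  qed
  have sg: "(\<lambda>i. e * (1 / 2) ^ Suc i) sums (e * 1)" by (intro sums_mult power_half_series)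
  have sr: "(\<lambda>i. r i powr t) sums ((\<Sum>i. d i powr t) + e * 1)"
    unfolding rt b_def by (intro sums_add sg summable_sums sd)
  show thesis
  proof (rule that[of a r])
    show "U i \<subseteq> {a i..a i + r i}" for i
    proof
      fix x assume x: "x \<in> U i"
      have bb: "bdd_below (U i)" by (rule bounded_imp_bdd_below[OF bd])
      have "a i \<le> x" using x bb by (auto simp: a_def intro: cInf_lower)
      moreover have "x - d i \<le> Inf (U i)"
      proof (rule cInf_greatest)
        fix z assume "z \<in> U i"
        then have "dist x z \<le> d i" unfolding d_def using x by (intro diameter_bounded_bound bd)
        then show "x - d i \<le> z" by (simp add: dist_real_def)
      qed (use x in auto)
      ultimately show "x \<in> {a i..a i + r i}" using dr[of i] x by (auto simp: a_def)
    qed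
    show "0 < r i" for i using b0[of i] by (simp add: r_def)
    show "summable (\<lambda>i. r i powr t)" by (rule sums_summable[OF sr])
    show "(\<Sum>i. r i powr t) \<le> 2 * e" using sums_unique[OF sr] sd(2) by simp
  qed
qed

lemma le_hausdorff_dim_of_lt:
  assumes "0 < s" and le: "\<And>t. 0 < t \<Longrightarrow> t < s \<Longrightarrow> ereal t \<le> X"
  shows "ereal s \<le> X"
proof (rule dense_le_bounded[where x = 0])
  show "(0::ereal) < ereal s" using assms by simp
  fix w assume w: "0 < w" "w < ereal s"
  then obtain t where "w = ereal t" by (cases w) auto
  then show "w \<le> X" using le w by simp
qed

context approximation_exponent
begin

lemma in_W_expI:
  assumes "\<And>n. \<exists>q\<ge>n. x \<in> near q (real q powr (- \<nu>))"
  shows "x \<in> W_exp \<nu>"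
proof -
  have "\<exists>q>n. 0 < q \<and> infdist (real q * x) \<int> \<le> real q powr (- \<nu>)" for n
    using assms[of "Suc n"] by (auto simp: near_def Suc_le_eq intro: order.strict_trans1)
  then show ?thesis unfolding W_exp_def W_def W_inhom_def infinite_nat_iff_unbounded by auto
qed

text \<open>Instead of constructing a Frostman measure, a cover of small \<open>t\<close>-content is defeated directly: along
  a sequence of nested cylinders the content of the covering sets that still meet the cylinder decays
  faster than \<open>t\<close>-th powers of its length, so that in the limit no set is left.\<close>

theorem hausdorff_dim_W_exp_ge:
  assumes t: "0 < t" "t < t'" "t' < t''" "t'' \<le> dstar" "(1 - dimK) * (\<nu> - 1) \<le> \<rho> * (dimK - t'')"
  shows "ereal t \<le> hausdorff_dim (Kset \<inter> W_exp \<nu>)"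
proof -
  define K where "K = 3 + 144 * (3 + 10 * C) * c0 * real p"
  define \<beta> where "\<beta> = dimK * (t' / t - 1)"
  have "0 \<le> (\<nu> - 1) / (\<nu> + 1)" using \<nu> by simp
  then have td: "t'' \<le> dimK" using t(4) unfolding dstar_def by linarith
  have \<beta>: "0 < \<beta>" using t td by (simp add: \<beta>_def)
  have K0: "0 < K" using C_pos p_pos by (simp add: K_def c0_def add_pos_nonneg)
  have "\<forall>\<^sub>F x in at_top. K * (1 / x) powr \<beta> \<le> 1 / 2" using K0 \<beta> by real_asymp
  from eventually_compose_filterlim[OF this filterlim_den]
  obtain k0 where k0: "\<And>k. k0 \<le> k \<Longrightarrow> K * (1 / real p ^ k) powr \<beta> \<le> 1 / 2"
    by (auto simp: eventually_sequentially den_def)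
  \<comment> \<open>With this \<open>e\<close> the enlarged cover has t-content at most
    \<open>(1 / p ^ k0) powr t'\<close>, so any cylinder of level \<open>k0\<close> can start the
    construction.\<close>
  define e where "e = (1 / real p ^ k0) powr t' / 2"
  have e0: "0 < e" using p_pos by (simp add: e_def)
  show ?thesis
  proof (rule hausdorff_dim_geI[OF t(1) e0])
    fix U :: "nat \<Rightarrow> real set"
    assume cover: "Kset \<inter> W_exp \<nu> \<subseteq> (\<Union>i. U i)" and bd: "\<And>i. bounded (U i)"
      and fin: "(\<Sum>i. ennreal (diameter (U i) powr t)) < ennreal e"
    obtain a r where U: "\<And>i. U i \<subseteq> {a i..a i + r i}" and r: "\<And>i. 0 < r i"
      and summ: "summable (\<lambda>i. r i powr t)" and tot: "(\<Sum>i. r i powr t) \<le> 2 * e"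
      using exists_interval_powr_eq[OF t(1) e0 bd fin] by blast
    obtain w0 where w0: "w0 \<in> Wd k0"
      using card_Wd[of k0] D_ne by (metis card.empty card_gt_0_iff ex_in_conv finite_D power_eq_0_iff)
    define ok where "ok x \<longleftrightarrow> k0 \<le> fst x \<and> snd x \<in> Wd (fst x) \<and> load U r t (cyl (fst x) (snd x)) \<le> (1 / real p ^ fst x) powr t'" for x
    define st where "st n x x' \<longleftrightarrow> fst x < fst x' \<and> cyl (fst x') (snd x') \<subseteq> cyl (fst x) (snd x) \<and>
      (\<exists>q\<ge>n. cyl (fst x') (snd x') \<subseteq> near q (real q powr (- \<nu>)))" for n :: nat and x x' :: "nat \<times> nat"
    have "\<exists>f. \<forall>n. ok (f n) \<and> st n (f n) (f (Suc n))"
    proof (rule dependent_nat_choice)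
      have "load U r t (cyl k0 w0) \<le> (\<Sum>i. r i powr t)"
        unfolding load_def by (intro suminf_le summable_load summ) auto
      then have "load U r t (cyl k0 w0) \<le> (1 / real p ^ k0) powr t'" using tot by (simp add: e_def)
      then show "\<exists>x. ok x" using w0 by (intro exI[of _ "(k0, w0)"]) (simp add: ok_def)
    next
      fix x n assume x: "ok x"
      have "\<exists>k' w' q. fst x < k' \<and> w' \<in> Wd k' \<and> cyl k' w' \<subseteq> cyl (fst x) (snd x) \<and> n \<le> q \<and>
        cyl k' w' \<subseteq> near q (real q powr (- \<nu>)) \<and> load U r t (cyl k' w') \<le> (1 / real p ^ k') powr t'"
      proof (rule cylinder_step[OF t])
        show "(3 + 144 * (3 + 10 * C) * c0 * real p) * (1 / real p ^ fst x) powr (dimK * (t' / t - 1)) \<le> 1 / 2"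
          using k0[of "fst x"] x by (simp add: ok_def K_def \<beta>_def)
      qed (use U r summ x in \<open>auto simp: ok_def\<close>)
      then obtain k' w' q where "fst x < k'" "w' \<in> Wd k'" "cyl k' w' \<subseteq> cyl (fst x) (snd x)" "n \<le> q"
        "cyl k' w' \<subseteq> near q (real q powr (- \<nu>))" "load U r t (cyl k' w') \<le> (1 / real p ^ k') powr t'" by blast
      then show "\<exists>x'. ok x' \<and> st n x x'"
        using x by (intro exI[of _ "(k', w')"]) (auto simp: ok_def st_def)
    qed
    then obtain f where f: "\<And>n. ok (f n)" "\<And>n. st n (f n) (f (Suc n))" by blast
    define S where "S n = cyl (fst (f n)) (snd (f n))" for n
    have anti: "S n \<subseteq> S m" if "m \<le> n" for m n
      by (rule lift_Suc_antimono_le[OF _ that]) (use f(2) in \<open>simp add: S_def st_def\<close>)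
    have kn: "n \<le> fst (f n)" for n
    proof (induction n)
      case (Suc n)
      then show ?case using f(2)[of n] by (simp add: st_def)
    qed simp
    have "\<Inter>(range S) \<noteq> {}"
    proof (rule compact_nest)
      show "compact (S n)" for n by (simp add: S_def cyl_def)
      show "S n \<noteq> {}" for n by (simp add: S_def cyl_def divide_right_mono)
    qed (rule anti)
    then obtain x where x: "\<And>n. x \<in> S n" by blast
    have "x \<in> Kset"
    proof (rule in_Kset_of_cyls)
      fix n
      show "\<exists>k v. n \<le> k \<and> v \<in> Wd k \<and> x \<in> cyl k v"
        using kn[of n] x[of n] f(1)[of n] by (auto simp: S_def ok_def)
    qed
    moreover have "x \<in> W_exp \<nu>"
    proof (rule in_W_expI)
      fix n
      show "\<exists>q\<ge>n. x \<in> near q (real q powr (- \<nu>))"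
        using f(2)[of n] x[of "Suc n"] by (auto simp: st_def S_def)
    qed
    ultimately obtain i where i: "x \<in> U i" using cover by blast
    \<comment> \<open>A covering set that contains the limit point meets all nested cylinders, so it
      is counted in every load.\<close>
    have le: "r i powr t \<le> (1 / real p ^ fst (f n)) powr t'" for n
    proof -
      have "U i \<inter> S n \<noteq> {}" using i x by blast
      then have "r i powr t = (\<Sum>i\<in>{i}. if U i \<inter> S n = {} then 0 else r i powr t)" by simp
      also have "\<dots> \<le> load U r t (S n)"
        unfolding load_def by (intro sum_le_suminf summable_load summ) auto
      also have "\<dots> \<le> (1 / real p ^ fst (f n)) powr t'" using f(1)[of n] by (simp add: ok_def S_def)
      finally show ?thesis .
    qed
    have "\<forall>\<^sub>F x in at_top. (1 / x) powr t' < r i powr t"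
    proof -
      have "0 < t'" "0 < r i powr t" using t r[of i] by simp_all
      then show ?thesis by real_asymp
    qed
    from eventually_compose_filterlim[OF this filterlim_den]
    obtain k where k: "\<And>j. k \<le> j \<Longrightarrow> (1 / real p ^ j) powr t' < r i powr t"
      by (auto simp: eventually_sequentially den_def)
    show False using k[OF kn[of k]] le[of k] by linarith
  qed
qed

text \<open>The natural cover by the cylinders close to fractions with denominators in \<open>{2 ^ j..<2 * 2 ^ j}\<close>.\<close>

theorem hausdorff_dim_W_exp_le:
  assumes ds: "0 \<le> dstar"
  shows "hausdorff_dim (Kset \<inter> W_exp \<nu>) \<le> ereal dstar"
proof -
  define x where "x j = (2::real) ^ j" for j :: nat
  have x1: "1 \<le> x j" "0 < x j" for j by (auto simp: x_def)
  define X where "X j = x j powr (\<nu> + 1)" for j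
  have X1: "1 \<le> X j" for j unfolding X_def using x1[of j] \<nu> by (intro ge_one_powr_ge_zero) auto
  have "\<exists>k. X j \<le> real p ^ k \<and> real p ^ k \<le> real p * X j" for j
  proof -
    obtain n where "real p ^ n \<le> X j" "X j < real p ^ (n + 1)" using real_power_bracket[OF p2 X1[of j]] by blast
    then show ?thesis using mult_left_mono[of "real p ^ n" "X j" "real p"] by (intro exI[of _ "n + 1"]) auto
  qed
  then obtain K where K: "\<And>j. X j \<le> real p ^ K j" "\<And>j. real p ^ K j \<le> real p * X j" by metis
  define E where "E j = near_block (2 ^ j) (x j powr (- \<nu>))" for j
  define V where "V j = {v \<in> Wd (K j). cyl (K j) v \<inter> E j \<noteq> {}}" for j
  define B where "B = 48 * (3 + 5 * C)"
  have B0: "0 \<le> B" using C_pos by (simp add: B_def)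
  have cV: "real (card (V j)) \<le> B * x j powr (1 - \<nu>) * real P ^ K j" if small: "3 * x j powr (- \<nu>) \<le> 1 / 8" for j
  proof -
    \<comment> \<open>Moving within a cylinder changes q * z by at most 2 * x j powr (- \<nu>),
      whence the factor 3.\<close>
    define E' where "E' = near_block (2 ^ j) (3 * x j powr (- \<nu>))"
    have sub: "cyl (K j) v \<subseteq> E'" if v: "v \<in> V j" for v
    proof
      fix z assume z: "z \<in> cyl (K j) v"
      obtain z' where z': "z' \<in> cyl (K j) v" "z' \<in> E j" using v by (auto simp: V_def)
      then obtain q where q: "q \<in> {2^j..<2*2^j}" "infdist (real q * z') \<int> \<le> x j powr (- \<nu>)"
        by (auto simp: E_def near_block_def near_def)
      have "real q \<le> real (2 * 2 ^ j)" using q(1) by (intro of_nat_mono) auto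
      then have qx: "real q \<le> 2 * x j" by (simp add: x_def)
      have "infdist (real q * z) \<int> \<le> infdist (real q * z') \<int> + real q / real p ^ K j"
        by (rule infdist_mult_cyl[OF z'(1) z])
      also have "real q / real p ^ K j \<le> 2 * x j / X j" using qx K(1)[of j] X1[of j] x1[of j] by (intro frac_le) auto
      also have "2 * x j / X j = 2 * x j powr (- \<nu>)"
        using x1(2)[of j] by (simp add: X_def powr_add powr_minus_divide)
      finally have "infdist (real q * z) \<int> \<le> 3 * x j powr (- \<nu>)" using q(2) by simp
      then show "z \<in> E'" using q(1) by (auto simp: E'_def near_block_def near_def)
    qed
    have "real (card (V j)) = (\<Sum>v\<in>V j. measure (cm (K j) v) E')"
      using measure_cm_cyl[of E'] sub by (simp add: E'_def)
    also have "\<dots> \<le> (\<Sum>v\<in>Wd (K j). measure (cm (K j) v) E')" by (intro sum_mono2) (auto simp: V_def)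
    also have "\<dots> = measure (cm 0 0) E' * real P ^ K j"
      using measure_cm_split[of E' 0 0 "K j"] D_ne by (simp add: E'_def)
    also have "measure (cm 0 0) E' \<le> B * x j powr (1 - \<nu>)"
    proof -
      have "measure (cm 0 0) E' \<le> 16 * (3 * x j powr (- \<nu>)) * (3 * real (2 ^ j) + 5 * C * real p ^ 0 * (real (2 ^ j) / (8 * (3 * x j powr (- \<nu>)))) powr \<tau>)"
        unfolding E'_def by (rule measure_near_block_le) (use small x1(2)[of j] in auto)
      also have "\<dots> \<le> 16 * (3 * x j powr (- \<nu>)) * (3 * x j + 5 * C * x j)"
      proof -
        have "x j / (8 * (3 * x j powr (- \<nu>))) = X j / 24"
          using x1(2)[of j] by (simp add: X_def powr_add powr_minus_divide)
        then have "(x j / (8 * (3 * x j powr (- \<nu>)))) powr \<tau> \<le> X j powr \<tau>"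
          using X1[of j] \<tau> by (intro powr_mono2) auto
        also have "\<dots> = x j powr ((\<nu> + 1) * \<tau>)" by (simp add: X_def powr_powr)
        also have "\<dots> \<le> x j" using x1(1)[of j] \<nu>\<tau> by (intro powr_le_self) (auto simp: add.commute)
        finally show ?thesis using C_pos by (intro mult_left_mono add_mono) (auto simp: x_def)
      qed
      also have "\<dots> = B * (x j * x j powr (- \<nu>))" by (simp add: B_def algebra_simps)
      also have "x j * x j powr (- \<nu>) = x j powr (1 - \<nu>)" using x1(2)[of j] by (simp add: powr_mult_base)
      finally show ?thesis .
    qed
    finally show ?thesis by (simp add: mult_right_mono)
  qed
  show ?thesis
  proof (rule hausdorff_dim_le_cylinders[OF ds, where V = V and K = K])
    show "finite (V j)" for j by (simp add: V_def)
    show "filterlim K at_top sequentially"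
      unfolding filterlim_at_top
    proof
      fix k
      have "\<forall>\<^sub>F j in sequentially. real p ^ k < X j"
        unfolding X_def x_def using \<nu> by real_asymp
      then show "\<forall>\<^sub>F j in sequentially. k \<le> K j"
      proof eventually_elim
        case (elim j)
        then have "real p ^ k < real p ^ K j" using K(1)[of j] by linarith
        then show ?case using p2 power_less_imp_less_exp[of "real p" k "K j"] by simp
      qed
    qed
    show "Kset \<inter> W_exp \<nu> \<subseteq> (\<Union>j\<in>{J..}. \<Union>v\<in>V j. cyl (K j) v)" for J
    proof
      fix z assume z: "z \<in> Kset \<inter> W_exp \<nu>"
      have "antimono_on {1..} (\<lambda>q. real q powr (- \<nu>))"
        using \<nu> by (intro monotone_onI powr_mono2') auto
      then have "\<not> (\<forall>\<^sub>F j in sequentially. z \<notin> near_block (2 ^ j) (real (2 ^ j) powr (- \<nu>)))"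
        using W_subset_near_blocks z unfolding W_exp_def by blast
      then obtain j where j: "J \<le> j" "z \<in> E j"
        unfolding eventually_sequentially E_def x_def by auto
      obtain v where "v \<in> Wd (K j)" "z \<in> cyl (K j) v" using z Kset_subset_cyls[of "K j"] by blast
      then show "z \<in> (\<Union>j\<in>{J..}. \<Union>v\<in>V j. cyl (K j) v)" using j by (auto simp: V_def)
    qed
    fix t assume t: "dstar < t"
    define \<gamma> where "\<gamma> = (\<nu> + 1) * (dstar - t)"
    have \<gamma>: "\<gamma> < 0" using t \<nu> by (simp add: \<gamma>_def mult_pos_neg)
    have "norm (real (card (V j)) * (1 / real p ^ K j) powr t) \<le> B * real p * (2 powr \<gamma>) ^ j"
      if small: "3 * x j powr (- \<nu>) \<le> 1 / 8" for j
    proof -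
      define Z where "Z = real p ^ K j"
      have Z: "0 < Z" "X j \<le> Z" "Z \<le> real p * X j" using K[of j] p_pos by (auto simp: Z_def)
      have "real (card (V j)) * (1 / Z) powr t \<le> (B * x j powr (1 - \<nu>) * real P ^ K j) * (1 / Z) powr t"
        by (intro mult_right_mono cV[OF small]) auto
      also have "\<dots> = B * x j powr (1 - \<nu>) * Z powr (dimK - t)"
        using Z(1) by (simp add: power_powr_dimK[symmetric] Z_def[symmetric] powr_diff powr_divide)
      also have "\<dots> \<le> B * x j powr (1 - \<nu>) * (real p * X j powr (dimK - t))"
      proof (intro mult_left_mono)
        show "Z powr (dimK - t) \<le> real p * X j powr (dimK - t)"
        proof (cases "dimK \<le> t")
          case True
          then have "Z powr (dimK - t) \<le> X j powr (dimK - t)" using Z X1[of j] by (intro powr_mono2') auto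
          also have "\<dots> \<le> real p * X j powr (dimK - t)" using p2 mult_right_mono[of 1 "real p" "X j powr (dimK - t)"] by simp
          finally show ?thesis .
        next
          case False
          then have "Z powr (dimK - t) \<le> (real p * X j) powr (dimK - t)" using Z by (intro powr_mono2) auto
          also have "\<dots> = real p powr (dimK - t) * X j powr (dimK - t)" by (simp add: powr_mult)
          also have "\<dots> \<le> real p * X j powr (dimK - t)"
            using p2 dimK_le_1 t ds by (intro mult_right_mono powr_le_self) auto
          finally show ?thesis .
        qed
      qed (use B0 in auto)
      also have "\<dots> = B * real p * (x j powr (1 - \<nu>) * X j powr (dimK - t))" by (simp only: mult_ac)
      also have "x j powr (1 - \<nu>) * X j powr (dimK - t) = x j powr \<gamma>"
      proof -
        have "(1 - \<nu>) + (\<nu> + 1) * (dimK - t) = \<gamma>" using dstar_eq(1) by (simp add: \<gamma>_def algebra_simps)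
        then show ?thesis unfolding X_def powr_powr powr_add[symmetric] by simp
      qed
      also have "x j powr \<gamma> = (2 powr \<gamma>) ^ j"
        unfolding x_def by (simp add: powr_realpow[symmetric] powr_powr mult.commute)
      finally show ?thesis by (simp add: Z_def)
    qed
    moreover have "\<forall>\<^sub>F j in sequentially. 3 * x j powr (- \<nu>) \<le> 1 / 8"
      unfolding x_def using \<nu> by real_asymp
    ultimately have "\<forall>\<^sub>F j in sequentially. norm (real (card (V j)) * (1 / real p ^ K j) powr t) \<le> B * real p * (2 powr \<gamma>) ^ j"
      by (auto elim: eventually_mono)
    moreover have "summable (\<lambda>j. B * real p * (2 powr \<gamma>) ^ j)"
      using \<gamma> by (intro summable_mult summable_geometric) (simp add: powr_less_one)
    ultimately show "summable (\<lambda>j. real (card (V j)) * (1 / real p ^ K j) powr t)"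
      by (rule summable_comparison_test_ev)
  qed
qed

text \<open>Since dimK - dstar = (\<nu> - 1) / (\<nu> + 1), the condition of the lower bound at t''
  = dstar reads (1 - dimK) * (\<nu> - 1) \<le> \<rho> * (\<nu> - 1) / (\<nu> + 1). Cancelling \<nu>
  - 1 leaves \<open>cond\<close>.\<close>

theorem hausdorff_dim_W_exp:
  assumes ds: "0 < dstar" and cond: "(\<nu> + 1) * (1 - dimK + \<tau>) \<le> 1"
  shows "hausdorff_dim (Kset \<inter> W_exp \<nu>) = ereal dstar"
proof (rule antisym[OF hausdorff_dim_W_exp_le])
  show "ereal dstar \<le> hausdorff_dim (Kset \<inter> W_exp \<nu>)"
  proof (rule le_hausdorff_dim_of_lt[OF ds])
    fix t assume t: "0 < t" "t < dstar"
    define t' where "t' = (t + dstar) / 2"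
    show "ereal t \<le> hausdorff_dim (Kset \<inter> W_exp \<nu>)"
    proof (rule hausdorff_dim_W_exp_ge[where t' = t' and t'' = dstar])
      have "(\<nu> - 1) * ((1 - dimK) * (\<nu> + 1)) \<le> (\<nu> - 1) * \<rho>"
        using cond \<nu> by (intro mult_left_mono) (auto simp: \<rho>_def algebra_simps)
      moreover have "dimK - dstar = (\<nu> - 1) / (\<nu> + 1)" by (simp add: dstar_def)
      ultimately show "(1 - dimK) * (\<nu> - 1) \<le> \<rho> * (dimK - dstar)"
        using \<nu> by (simp add: pos_le_divide_eq mult_ac)
    qed (use t in \<open>auto simp: t'_def\<close>)
  qed
qed (use ds in simp)

end

context missing_digit_l1
begin

text \<open>As \<open>\<nu>\<close> tends to 1 every exponent below \<open>dimK\<close> becomes admissible.\<close>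

lemma hausdorff_dim_W_exp_near_1:
  assumes p3: "3 \<le> p" and t: "0 < t" "t < dimK"
  shows "\<exists>\<nu>>1. ereal t \<le> hausdorff_dim (Kset \<inter> W_exp \<nu>)"
proof -
  define t' where "t' = (2 * t + dimK) / 3"
  define t'' where "t'' = (t + 2 * dimK) / 3"
  define h where "h = (1 - 2 * \<tau>) / 2"
  \<comment> \<open>The excess \<nu> - 1. As it is at most dimK - t'', it keeps t'' below
    \<open>dstar\<close>; as it is at most h, it keeps \<rho> \<ge> h; as their product, it
    satisfies the condition that links \<rho> and t''.\<close>
  define \<eta> where "\<eta> = (dimK - t'') * h"
  have tt: "t < t'" "t' < t''" "t'' < dimK" using t by (auto simp: t'_def t''_def)
  have h: "0 < h" "h \<le> 1 / 2" "2 * \<tau> = 1 - 2 * h" using \<tau> by (auto simp: h_def field_simps)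
  have \<eta>0: "0 < \<eta>" unfolding \<eta>_def using h tt by (intro mult_pos_pos) auto
  have \<eta>1: "\<eta> \<le> (dimK - t'') * 1" unfolding \<eta>_def using h tt by (intro mult_left_mono) auto
  have \<eta>2: "\<eta> \<le> 1 * h" unfolding \<eta>_def using h tt dimK_le_1 t by (intro mult_right_mono) auto
  have \<eta>\<tau>: "\<eta> * \<tau> \<le> h" using \<eta>2 \<tau> h \<eta>0 mult_mono[of \<eta> h \<tau> 1] by simp
  interpret approximation_exponent p D C \<tau> "1 + \<eta>"
  proof
    have "(1 + (1 + \<eta>)) * \<tau> = 2 * \<tau> + \<eta> * \<tau>" by (simp add: algebra_simps)
    also have "\<dots> < 1" using \<eta>\<tau> h by linarith
    finally show "(1 + (1 + \<eta>)) * \<tau> < 1" .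
  qed (use p3 \<eta>0 in auto)
  have "\<rho> = 1 - 2 * \<tau> - \<eta> * \<tau>" by (simp add: \<rho>_def algebra_simps)
  then have \<rho>h: "h \<le> \<rho>" using \<eta>\<tau> h by linarith
  have "ereal t \<le> hausdorff_dim (Kset \<inter> W_exp (1 + \<eta>))"
  proof (rule hausdorff_dim_W_exp_ge[OF t(1) tt(1,2)])
    have "\<eta> / (2 + \<eta>) \<le> \<eta> / 1" using \<eta>0 by (intro divide_left_mono) auto
    then show "t'' \<le> dstar" using \<eta>1 by (simp add: dstar_def add.commute)
    have "(1 - dimK) * \<eta> \<le> 1 * \<eta>" using dimK_nonneg \<eta>0 by (intro mult_right_mono) auto
    also have "\<dots> = (dimK - t'') * h" by (simp only: mult_1 \<eta>_def)
    also have "\<dots> \<le> (dimK - t'') * \<rho>" using \<rho>h tt by (intro mult_left_mono) auto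
    finally show "(1 - dimK) * (1 + \<eta> - 1) \<le> \<rho> * (dimK - t'')" by (simp add: mult.commute)
  qed
  then show ?thesis using \<eta>0 by (intro exI[of _ "1 + \<eta>"]) auto
qed

text \<open>One squeeze gives both values: exponents near 1 yield the lower bound on the subset,
  which \<open>Kset\<close> inherits, and the cylinder covers yield the upper bound.\<close>

lemma
  assumes "3 \<le> p" "0 < dimK"
  shows hausdorff_dim_Kset: "hausdorff_dim Kset = ereal dimK"
    and hausdorff_dim_Kset_W_gt1: "hausdorff_dim (Kset \<inter> W_gt1) = ereal dimK"
proof -
  have "ereal dimK \<le> hausdorff_dim (Kset \<inter> W_gt1)"
  proof (rule le_hausdorff_dim_of_lt[OF assms(2)])
    fix t assume "0 < t" "t < dimK"
    then obtain \<nu> where \<nu>: "1 < \<nu>" "ereal t \<le> hausdorff_dim (Kset \<inter> W_exp \<nu>)"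
      using hausdorff_dim_W_exp_near_1[OF assms(1)] by blast
    have "Kset \<inter> W_exp \<nu> \<subseteq> Kset \<inter> W_gt1" using \<nu>(1) by (auto simp: W_gt1_def)
    then show "ereal t \<le> hausdorff_dim (Kset \<inter> W_gt1)" using \<nu>(2) hausdorff_dim_mono order_trans by blast
  qed
  moreover have "hausdorff_dim (Kset \<inter> W_gt1) \<le> hausdorff_dim Kset" by (intro hausdorff_dim_mono) auto
  ultimately show "hausdorff_dim Kset = ereal dimK" "hausdorff_dim (Kset \<inter> W_gt1) = ereal dimK"
    using hausdorff_dim_Kset_le by (auto intro: antisym order_trans)
qed

end

text \<open>\<open>ln lam / ln p\<close> is the exponent of the coefficient sums; \<tau> lies
  strictly above it to leave room for the divisor bound.\<close>

lemma missing_digit_l1_middle: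
  assumes p: "3 \<le> p" and lam: "\<And>t. (\<Sum>i<p. norm (missing_digit.phi (middle_digits p) (t + real i / real p))) \<le> lam"
    and \<tau>: "1 \<le> lam" "ln lam / ln (real p) < \<tau>" "\<tau> < 1 / 2"
  shows "\<exists>C. missing_digit_l1 p (middle_digits p) C \<tau>"
proof -
  interpret missing_digit p "middle_digits p" by (rule missing_digit_middle[OF p])
  have "lam \<le> real p powr (ln lam / ln (real p))" using p \<tau>(1) by (simp add: powr_def)
  moreover have "0 \<le> ln lam / ln (real p)" using p \<tau>(1) by simp
  ultimately obtain C where C: "0 < C"
    "\<And>k Q H. 1 \<le> Q \<Longrightarrow> 1 \<le> H \<Longrightarrow> Err k Q H \<le> C * real p ^ k * (real Q * real H) powr \<tau>"
    using Err_bound[OF lam _ _ \<tau>(2)] by blast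
  have "0 < \<tau>" using \<tau>(2) \<open>0 \<le> ln lam / ln (real p)\<close> by linarith
  then have "missing_digit_l1 p (middle_digits p) C \<tau>" using C \<tau>(3) by unfold_locales auto
  then show ?thesis ..
qed

lemma ln_div_ln_less_half:
  assumes "1 < p" "0 < x" "x\<^sup>2 < (p::real)"
  shows "ln x / ln p < 1 / 2"
proof -
  have "2 * ln x = ln (x\<^sup>2)" using assms(2) by (simp add: ln_realpow)
  also have "\<dots> < ln p" using assms by (subst ln_less_cancel_iff) auto
  finally show ?thesis using assms(1) by (simp add: divide_less_eq)
qed

theorem theoremA:
  shows "hausdorff_dim (middle_cantor_set 15 \<inter> W_gt1) = hausdorff_dim (middle_cantor_set 15)
    \<and> (\<forall>\<psi> :: nat \<Rightarrow> real.
          (\<forall>q\<ge>1. 0 < \<psi> q \<and> \<psi> q \<le> 1) \<longrightarrow> antimono_on {1..} \<psi> \<longrightarrow> summable \<psi> \<longrightarrow>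
          emeasure (middle_cantor_measure 15) (W \<psi>) = 0)
    \<and> emeasure (middle_cantor_measure 15) (W (\<lambda>q. 1 / (real q * ln (ln (real q))))) = 1
    \<and> (\<exists>c>0. \<forall>\<nu>::real. 1 < \<nu> \<and> \<nu> < 1 + c \<longrightarrow>
          (let K = middle_cantor_set (10 ^ 7 + 1) in
           hausdorff_dim (K \<inter> W_exp \<nu>) =
             max (hausdorff_dim K / ereal (\<nu> + 1))
                 (ereal (2 / (\<nu> + 1)) + hausdorff_dim K - 1)))"
proof -
  have "ln 3.83 / ln (real 15) < 1 / 2" by (rule ln_div_ln_less_half) (simp_all add: power2_eq_square)
  then obtain \<tau> where \<tau>: "ln 3.83 / ln (real 15) < \<tau>" "\<tau> < 1 / 2" using dense by blast
  obtain C where "missing_digit_l1 15 (middle_digits 15) C \<tau>"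
    using missing_digit_l1_middle[OF _ sum_norm_phi_middle_15 _ \<tau>] by auto
  then interpret A: missing_digit_l1 15 "middle_digits 15" C \<tau> .
  have "A.dimK = ln 14 / ln 15" by (simp add: A.dimK_def card_middle_digits)
  then have dA: "0 < A.dimK" by simp
  define p :: nat where "p = 10 ^ 7 + 1"
  have p: "3 \<le> p" "odd p" "real p = 10000001" by (simp_all add: p_def)
  interpret B0: missing_digit p "middle_digits p" by (rule missing_digit_middle[OF p(1)])
  define s where "s = B0.dimK"
  have s: "s = ln 10000000 / ln 10000001" unfolding s_def B0.dimK_def by (simp add: card_middle_digits p_def)
  have lnp: "0 < ln (10000001::real)" by simp
  \<comment> \<open>At \<nu> = 1 the condition of \<open>hausdorff_dim_W_exp\<close> becomes 2 * (1
    - s + \<tau>) \<le> 1. It leaves room for some \<tau>' because 2740^2 * p < (p - 1)^2.\<close>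
  have "ln 2740 / ln (real p) < s - 1 / 2"
  proof -
    have "ln ((2740::real)\<^sup>2 * 10000001) = ln (2740\<^sup>2) + ln 10000001" by (rule ln_mult_pos) simp_all
    then have "2 * ln 2740 + ln 10000001 = ln (2740\<^sup>2 * (10000001::real))" using ln_realpow[of "2740::real" 2] by (simp only: of_nat_numeral)
    also have "\<dots> < ln (10000000\<^sup>2)" by (subst ln_less_cancel_iff) (simp_all add: power2_eq_square)
    also have "\<dots> = 2 * ln 10000000" using ln_realpow[of "10000000::real" 2] by (simp only: of_nat_numeral)
    finally show ?thesis unfolding s p(3) using lnp by (simp add: field_simps)
  qed
  then obtain \<tau>' where \<tau>': "ln 2740 / ln (real p) < \<tau>'" "\<tau>' < s - 1 / 2" using dense by blast
  have s1: "s \<le> 1" unfolding s_def by (rule B0.dimK_le_1)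
  have "\<tau>' < 1 / 2" using \<tau>' s1 by linarith
  then obtain C' where C': "missing_digit_l1 p (middle_digits p) C' \<tau>'"
    using missing_digit_l1_middle[OF p(1) sum_norm_phi_middle_large[folded p_def] _ \<tau>'(1)] by auto
  interpret B: missing_digit_l1 p "middle_digits p" C' \<tau>' by (rule C')
  have \<tau>'0: "0 < \<tau>'" by (rule B.\<tau>(1))
  have s2: "1 / 2 < s" using \<tau>'0 \<tau>' by linarith
  \<comment> \<open>The first bound gives (\<nu> + 1) * (1 - s + \<tau>') < 1. The second, \<nu> <
    3/2, serves to compare the two terms of the maximum.\<close>
  define c where "c = min (1 / (1 - s + \<tau>') - 2) (1 / 2)"
  have st: "0 < 1 - s + \<tau>'" "1 - s + \<tau>' < 1 / 2" using \<tau>' \<tau>'0 s1 by linarith+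
  have c0: "0 < c" using st by (simp add: c_def field_simps)
  have dim: "hausdorff_dim (middle_cantor_set p) = ereal s"
    using B.hausdorff_dim_Kset[OF p(1)] s2 by (simp add: middle_cantor_set_def s_def)
  have part3: "hausdorff_dim (middle_cantor_set p \<inter> W_exp \<nu>) =
      max (hausdorff_dim (middle_cantor_set p) / ereal (\<nu> + 1)) (ereal (2 / (\<nu> + 1)) + hausdorff_dim (middle_cantor_set p) - 1)"
    if \<nu>: "1 < \<nu>" "\<nu> < 1 + c" for \<nu>
  proof -
    have n1: "\<nu> + 1 < 1 / (1 - s + \<tau>')" and n2: "\<nu> + 1 < 5 / 2" using \<nu> by (auto simp: c_def)
    have cond: "(\<nu> + 1) * (1 - s + \<tau>') < 1" using n1 st by (simp add: pos_less_divide_eq)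
    interpret E: approximation_exponent p "middle_digits p" C' \<tau>' \<nu>
    proof
      have "(1 + \<nu>) * \<tau>' \<le> (\<nu> + 1) * (1 - s + \<tau>')" using \<nu> s1 by (simp add: add.commute mult_left_mono)
      then show "(1 + \<nu>) * \<tau>' < 1" using cond by linarith
    qed (use p \<nu> in auto)
    have ds: "E.dstar = 2 / (\<nu> + 1) + s - 1" using \<nu> by (simp add: E.dstar_def s_def field_simps)
    \<comment> \<open>For these \<nu> the second term of the maximum is the larger: the comparison
      amounts to (1 - s) * \<nu> \<le> 1.\<close>
    have ge: "s / (\<nu> + 1) \<le> E.dstar"
    proof -
      have "s + (1 - s) * (\<nu> + 1) = 1 + (1 - s) * \<nu>" by (simp add: algebra_simps)
      moreover have "(1 - s) * \<nu> \<le> 1 / 2 * 2" using s1 s2 n2 \<nu> by (intro mult_mono) auto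
      ultimately have "s + (1 - s) * (\<nu> + 1) \<le> 2" by linarith
      then have "s / (\<nu> + 1) \<le> (2 - (1 - s) * (\<nu> + 1)) / (\<nu> + 1)" using \<nu> by (intro divide_right_mono) auto
      also have "\<dots> = 2 / (\<nu> + 1) - (1 - s)" using \<nu> by (simp add: diff_divide_distrib)
      finally show ?thesis unfolding ds by simp
    qed
    have "0 < s / (\<nu> + 1)" using s2 \<nu> by simp
    then have "hausdorff_dim (missing_digit_set p (middle_digits p) \<inter> W_exp \<nu>) = ereal E.dstar"
      using ge cond by (intro E.hausdorff_dim_W_exp) (auto simp: s_def)
    moreover have "max (ereal s / ereal (\<nu> + 1)) (ereal (2 / (\<nu> + 1)) + ereal s - 1) = ereal E.dstar"
      using ge \<nu> unfolding ds by (simp add: one_ereal_def max_def)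
    ultimately show ?thesis unfolding dim by (simp add: middle_cantor_set_def)
  qed
  show ?thesis
    unfolding p_def[symmetric] Let_def
  proof (intro conjI allI impI exI[of _ c])
    show "hausdorff_dim (middle_cantor_set 15 \<inter> W_gt1) = hausdorff_dim (middle_cantor_set 15)"
      using A.hausdorff_dim_Kset A.hausdorff_dim_Kset_W_gt1 dA by (simp add: middle_cantor_set_def)
    show "emeasure (middle_cantor_measure 15) (W (\<lambda>q. 1 / (real q * ln (ln (real q))))) = 1"
      unfolding middle_cantor_measure_def by (rule A.khintchine_divergence)
  next
    fix \<psi> :: "nat \<Rightarrow> real"
    assume "\<forall>q\<ge>1. 0 < \<psi> q \<and> \<psi> q \<le> 1" "antimono_on {1..} \<psi>" "summable \<psi>"
    then show "emeasure (middle_cantor_measure 15) (W \<psi>) = 0"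
      unfolding middle_cantor_measure_def by (intro A.khintchine_convergence) auto
  qed (use part3 c0 in auto)
qed

end
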